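(* Let $q=2$. Let $A=\begin{pmatrix}a_{11} & a_{12} \\ a_{21} & 0\end{pmatrix}$ with entries in $\mathbb{C}_\infty$, $\operatorname{ord}a_{11}=-1$, $a_{12}\neq0$, $a_{21}\neq0$, and put $u=\operatorname{ord}a_{12}$, $v=\operatorname{ord}a_{21}$. If $(u,v)\in D_{13}$ and $-\frac23<v\le0$, then $h^1(M(A))=4$.
   Context: Let $q=2$ and $\theta$ a variable. $\mathbb{C}_\infty$ is the completion of an algebraic closure of the completion of $\mathbb{F}_q(\theta)$ at the valuation at infinity $\operatorname{ord}$, normalized by $\operatorname{ord}\theta=-1$ (and $\operatorname{ord}0=+\infty$). $\mathbb{C}_\infty[T,\tau]$ is the ring of non-commutative polynomials with relations $Ta=aT$, $T\tau=\tau T$, $\tau a=a^q\tau$ for $a\in\mathbb{C}_\infty$; $\mathbb{C}_\infty\{\tau\}$ is the subring generated over $\mathbb{C}_\infty$ by $\tau$. For a $2\times2$ matrix $A$ over $\mathbb{C}_\infty$, $M(A)$ is the left $\mathbb{C}_\infty[T,\tau]$-module (Anderson t-motive of dimension 2 and rank 4) which is free over $\mathbb{C}_\infty\{\tau\}$ with basis $e_1,e_2$, where multiplication by $T$ is given, for the column $e_*=(e_1,e_2)^t$, by $Te_*=\theta e_*+A\tau e_*+\tau^2e_*$. It is free of rank 4 over $\mathbb{C}_\infty[T]$. $\mathbb{C}_\infty\{T\}$ is the ring of power series $\sum_{i\ge0}a_iT^i$ with $a_i\in\mathbb{C}_\infty$, $a_i\to0$, on which $\tau$ acts by $\tau(\sum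 a_iT^i)=\sum a_i^qT^i$. On $M\otimes_{\mathbb{C}_\infty[T]}\mathbb{C}_\infty\{T\}$, $\tau$ acts by $\tau(m\otimes f)=\tau(m)\otimes\tau(f)$. $H^1(M)$ is the $\mathbb{F}_q[T]$-module of $\tau$-invariant elements of $M\otimes_{\mathbb{C}_\infty[T]}\mathbb{C}_\infty\{T\}$; it is free, and $h^1(M)$ is its rank over $\mathbb{F}_q[T]$. The domain $D_{13}$ is the set of $(u,v)$ with $\operatorname{ord}\frac{\theta^{q^2}}{a_{21}^{q^2}}<\operatorname{ord}\frac{\theta^q}{a_{21}}$ and $\operatorname{ord}\frac{\theta^{q^2}}{a_{21}^{q^2}}<\operatorname{ord}a_{12}^q$; for $q=2$ this is $-4v-4<-v-2$ and $-4v-4<2u$, i.e. $v>-\frac23$ and $v>-\frac12u-1$. *)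

theory Defs
  imports
    "HOL-Analysis.Analysis"
    "HOL-Algebra.Algebraic_Closure_Type"
    "HOL-Algebra.Free_Abelian_Groups"
    "HOL-Algebra.Generated_Groups"
begin

section \<open>The field of coefficients\<close>

locale valuation =
  fixes ord :: "'c::field \<Rightarrow> ereal"
  assumes ord_not_minf: "ord x \<noteq> -\<infinity>"
    and ord_eq_inf_iff: "ord x = \<infinity> \<longleftrightarrow> x = 0"
    and ord_mult: "ord (x * y) = ord x + ord y"
    and ord_add: "min (ord x) (ord y) \<le> ord (x + y)"

definition val_tendsto :: "('c::field \<Rightarrow> ereal) \<Rightarrow> (nat \<Rightarrow> 'c) \<Rightarrow> 'c \<Rightarrow> bool" where
  "val_tendsto ord s x \<longleftrightarrow> (\<lambda>n. ord (s n - x)) \<longlonglongrightarrow> \<infinity>"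

definition val_Cauchy :: "('c::field \<Rightarrow> ereal) \<Rightarrow> (nat \<Rightarrow> 'c) \<Rightarrow> bool" where
  "val_Cauchy ord s \<longleftrightarrow> (\<forall>B::real. \<exists>N. \<forall>m\<ge>N. \<forall>n\<ge>N. ereal B < ord (s m - s n))"

definition val_closure :: "('c::field \<Rightarrow> ereal) \<Rightarrow> 'c set \<Rightarrow> 'c set" where
  "val_closure ord S = {x. \<exists>s. (\<forall>n. s n \<in> S) \<and> val_tendsto ord s x}"

definition Fq :: "nat \<Rightarrow> 'c::field set" where
  "Fq q = {x. x ^ q = x}"

definition polys_over :: "'c::field set \<Rightarrow> 'c poly set" where
  "polys_over S = {p. \<forall>i. Polynomial.coeff p i \<in> S}"

definition rational_functions :: "nat \<Rightarrow> 'c::field \<Rightarrow> 'c set" where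
  "rational_functions q \<theta> =
     {poly p \<theta> / poly r \<theta> | p r. p \<in> polys_over (Fq q) \<and> r \<in> polys_over (Fq q) \<and> poly r \<theta> \<noteq> 0}"

definition algebraic_elements :: "'c::field set \<Rightarrow> 'c set" where
  "algebraic_elements K = {x. \<exists>p \<in> polys_over K. p \<noteq> 0 \<and> poly p x = 0}"

text \<open>
  The type \<open>'c\<close> with \<open>ord\<close> and \<open>\<theta>\<close> is a model of $\mathbb{C}_\infty$, which is thereby determined
  up to isometric isomorphism. Each field of the tower
  $\mathbb{F}_q(\theta) \subset K_\infty \subset \overline{K_\infty} \subset \mathbb{C}_\infty$
  is realised as a subset of \<open>'c\<close>. Since \<open>'c\<close> is complete, the completion $K_\infty$ of
  $\mathbb{F}_q(\theta)$ is its closure in \<open>'c\<close>.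
  The normalisation \<open>ord \<theta> = -1\<close> forces \<open>\<theta>\<close> to be transcendental over $\mathbb{F}_q$ and
  \<open>ord\<close> to be the valuation at infinity on $\mathbb{F}_q(\theta)$, because \<open>ord\<close> vanishes on the
  roots of unity $\mathbb{F}_q^*$.
\<close>
locale C_infinity = valuation ord for ord :: "'c::field \<Rightarrow> ereal" +
  fixes q :: nat and \<theta> :: 'c
  assumes prime_char: "Factorial_Ring.prime CHAR('c)"
    and q_prime_power: "\<exists>k>0. q = CHAR('c) ^ k"
    and ord_theta: "ord \<theta> = -1"
    and alg_closed:
      "\<And>p. p \<in> polys_over (algebraic_elements (val_closure ord (rational_functions q \<theta>))) \<Longrightarrow>
           Polynomial.degree p > 0 \<Longrightarrow>
           \<exists>x \<in> algebraic_elements (val_closure ord (rational_functions q \<theta>)). poly p x = 0"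
    and dense:
      "val_closure ord (algebraic_elements (val_closure ord (rational_functions q \<theta>))) = UNIV"
    and complete: "\<And>s. val_Cauchy ord s \<Longrightarrow> \<exists>x. val_tendsto ord s x"


section \<open>Tensor products and ranks of free modules\<close>

text \<open>
  Modules are records of \<^theory>\<open>HOL-Algebra.Module\<close>, whose inherited ring multiplication and unit
  are meaningless and set to \<open>undefined\<close>.
\<close>

definition tensor_rels ::
  "('r, 'x) ring_scheme \<Rightarrow> ('r, 'm, 'y) module_scheme \<Rightarrow> ('r, 'n, 'z) module_scheme
     \<Rightarrow> ('m \<times> 'n \<Rightarrow>\<^sub>0 int) set" where
  "tensor_rels R M N =
     {frag_of (m \<oplus>\<^bsub>M\<^esub> m', n) - frag_of (m, n) - frag_of (m', n) | m m' n.
        m \<in> carrier M \<and> m' \<in> carrier M \<and> n \<in> carrier N} \<union>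
     {frag_of (m, n \<oplus>\<^bsub>N\<^esub> n') - frag_of (m, n) - frag_of (m, n') | m n n'.
        m \<in> carrier M \<and> n \<in> carrier N \<and> n' \<in> carrier N} \<union>
     {frag_of (r \<odot>\<^bsub>M\<^esub> m, n) - frag_of (m, r \<odot>\<^bsub>N\<^esub> n) | r m n.
        r \<in> carrier R \<and> m \<in> carrier M \<and> n \<in> carrier N}"

definition tensor_subgroup ::
  "('r, 'x) ring_scheme \<Rightarrow> ('r, 'm, 'y) module_scheme \<Rightarrow> ('r, 'n, 'z) module_scheme
     \<Rightarrow> ('m \<times> 'n \<Rightarrow>\<^sub>0 int) set" where
  "tensor_subgroup R M N =
     generate (free_Abelian_group (carrier M \<times> carrier N)) (tensor_rels R M N)"

text \<open>
  The additive map of the tensor product with \<open>m \<otimes> n \<mapsto> m' \<otimes> n'\<close> where \<open>(m', n') = g (m, n)\<close>;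
  meaningful if \<open>g\<close> respects the defining relations of the tensor product.
\<close>
definition tensor_map ::
  "('r, 'x) ring_scheme \<Rightarrow> ('r, 'm, 'y) module_scheme \<Rightarrow> ('r, 'n, 'z) module_scheme
     \<Rightarrow> ('m \<times> 'n \<Rightarrow> 'm \<times> 'n) \<Rightarrow> ('m \<times> 'n \<Rightarrow>\<^sub>0 int) set \<Rightarrow> ('m \<times> 'n \<Rightarrow>\<^sub>0 int) set" where
  "tensor_map R M N g c =
     (let F = free_Abelian_group (carrier M \<times> carrier N)
      in the_elem ((\<lambda>x. tensor_subgroup R M N #>\<^bsub>F\<^esub> frag_extend (\<lambda>z. frag_of (g z)) x) ` c))"

definition tensor_product ::
  "('r, 'x) ring_scheme \<Rightarrow> ('r, 'm, 'y) module_scheme \<Rightarrow> ('r, 'n, 'z) module_scheme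
     \<Rightarrow> ('r, ('m \<times> 'n \<Rightarrow>\<^sub>0 int) set) module" where
  "tensor_product R M N =
     (let Q = free_Abelian_group (carrier M \<times> carrier N) Mod tensor_subgroup R M N
      in \<lparr>carrier = carrier Q, monoid.mult = undefined, monoid.one = undefined,
          ring.zero = \<one>\<^bsub>Q\<^esub>, ring.add = (\<lambda>x y. x \<otimes>\<^bsub>Q\<^esub> y),
          module.smult = (\<lambda>r. tensor_map R M N (\<lambda>(m, n). (m, r \<odot>\<^bsub>N\<^esub> n)))\<rparr>)"

definition module_basis ::
  "('r, 'x) ring_scheme \<Rightarrow> ('r, 'm, 'y) module_scheme \<Rightarrow> 'm set \<Rightarrow> bool" where
  "module_basis R M B \<longleftrightarrow>
     finite B \<and> B \<subseteq> carrier M \<and>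
     (\<forall>x \<in> carrier M. \<exists>!c. c \<in> B \<rightarrow>\<^sub>E carrier R \<and> x = (\<Oplus>\<^bsub>M\<^esub>b\<in>B. c b \<odot>\<^bsub>M\<^esub> b))"

text \<open>Meaningful only for free modules of finite rank over a nontrivial commutative ring.\<close>
definition free_rank :: "('r, 'x) ring_scheme \<Rightarrow> ('r, 'm, 'y) module_scheme \<Rightarrow> nat" where
  "free_rank R M = (THE n. \<exists>B. module_basis R M B \<and> card B = n)"


section \<open>The t-motive \<open>M(A)\<close>\<close>

text \<open>
  The polynomial $\sum_k c_k x^k$ of type \<^typ>\<open>'c poly\<close> represents $\sum_k c_k \tau^k$, with
  coefficients on the left, as an element of $\mathbb{C}_\infty\{\tau\}$; the product reflects
  $\tau^i a = a^{q^i} \tau^i$.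
\<close>
definition twisted_mult :: "nat \<Rightarrow> 'c::field poly \<Rightarrow> 'c poly \<Rightarrow> 'c poly" where
  "twisted_mult q P S =
     (\<Sum>i\<le>Polynomial.degree P. \<Sum>j\<le>Polynomial.degree S.
        Polynomial.monom (Polynomial.coeff P i * Polynomial.coeff S j ^ (q ^ i)) (i + j))"

text \<open>
  $M(A)$ is the free left $\mathbb{C}_\infty\{\tau\}$-module of vectors \<open>m\<close>, standing for
  $\sum_i m_i e_i$.
\<close>
definition motive_scale :: "nat \<Rightarrow> 'c::field poly \<Rightarrow> 'c poly ^ 2 \<Rightarrow> 'c poly ^ 2" where
  "motive_scale q P m = (\<chi> i. twisted_mult q P (vec_nth m i))"

definition motive_tau :: "nat \<Rightarrow> 'c::field poly ^ 2 \<Rightarrow> 'c poly ^ 2" where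
  "motive_tau q = motive_scale q (Polynomial.monom 1 1)"

definition motive_T_basis :: "nat \<Rightarrow> 'c::field \<Rightarrow> 'c ^ 2 ^ 2 \<Rightarrow> 2 \<Rightarrow> 'c poly ^ 2" where
  "motive_T_basis q \<theta> A i =
     motive_scale q [:\<theta>:] (axis i 1)
     + (\<Sum>j\<in>UNIV. motive_scale q (Polynomial.monom (vec_nth (vec_nth A i) j) 1) (axis j 1))
     + motive_scale q (Polynomial.monom 1 2) (axis i 1)"

text \<open>\<open>T\<close> commutes with $\mathbb{C}_\infty\{\tau\}$, so it is determined by its values on the $e_i$.\<close>
definition motive_T :: "nat \<Rightarrow> 'c::field \<Rightarrow> 'c ^ 2 ^ 2 \<Rightarrow> 'c poly ^ 2 \<Rightarrow> 'c poly ^ 2" where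
  "motive_T q \<theta> A m = (\<Sum>i\<in>UNIV. motive_scale q (vec_nth m i) (motive_T_basis q \<theta> A i))"

text \<open>
  From here on \<^typ>\<open>'c poly\<close> as a ring of scalars is the commutative ring $\mathbb{C}_\infty[T]$.
\<close>
abbreviation polyring_T :: "'c::field poly ring" where
  "polyring_T \<equiv> ring_of_type_algebra"

definition polyring_T_Fq :: "nat \<Rightarrow> 'c::field poly ring" where
  "polyring_T_Fq q = polyring_T\<lparr>carrier := polys_over (Fq q)\<rparr>"

definition motive :: "nat \<Rightarrow> 'c::field \<Rightarrow> 'c ^ 2 ^ 2 \<Rightarrow> ('c poly, 'c poly ^ 2) module" where
  "motive q \<theta> A =
     \<lparr>carrier = UNIV, monoid.mult = undefined, monoid.one = undefined, ring.zero = 0, ring.add = (+),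
      module.smult = (\<lambda>p m. \<Sum>k\<le>Polynomial.degree p.
                 motive_scale q [:Polynomial.coeff p k:] ((motive_T q \<theta> A ^^ k) m))\<rparr>"


section \<open>The module \<open>H\<^sup>1\<close>\<close>

text \<open>$\mathbb{C}_\infty\{T\}$ as a module over $\mathbb{C}_\infty[T]$.\<close>
definition tate_module :: "('c::field \<Rightarrow> ereal) \<Rightarrow> ('c poly, 'c fps) module" where
  "tate_module ord =
     \<lparr>carrier = {f. (\<lambda>i. ord (fps_nth f i)) \<longlonglongrightarrow> \<infinity>}, monoid.mult = undefined, monoid.one = undefined,
      ring.zero = 0, ring.add = (+), module.smult = (\<lambda>p f. fps_of_poly p * f)\<rparr>"

definition tate_tau :: "nat \<Rightarrow> 'c::field fps \<Rightarrow> 'c fps" where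
  "tate_tau q f = Abs_fps (\<lambda>i. fps_nth f i ^ q)"

type_synonym 'c motive_tensor = "(('c poly ^ 2) \<times> 'c fps \<Rightarrow>\<^sub>0 int) set"

definition motive_tate ::
  "nat \<Rightarrow> ('c::field \<Rightarrow> ereal) \<Rightarrow> 'c \<Rightarrow> 'c ^ 2 ^ 2 \<Rightarrow> ('c poly, 'c motive_tensor) module" where
  "motive_tate q ord \<theta> A = tensor_product polyring_T (motive q \<theta> A) (tate_module ord)"

definition motive_tate_tau ::
  "nat \<Rightarrow> ('c::field \<Rightarrow> ereal) \<Rightarrow> 'c \<Rightarrow> 'c ^ 2 ^ 2 \<Rightarrow> 'c motive_tensor \<Rightarrow> 'c motive_tensor" where
  "motive_tate_tau q ord \<theta> A =
     tensor_map polyring_T (motive q \<theta> A) (tate_module ord)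
       (\<lambda>(m, f). (motive_tau q m, tate_tau q f))"

definition H1 ::
  "nat \<Rightarrow> ('c::field \<Rightarrow> ereal) \<Rightarrow> 'c \<Rightarrow> 'c ^ 2 ^ 2 \<Rightarrow> ('c poly, 'c motive_tensor) module" where
  "H1 q ord \<theta> A = (motive_tate q ord \<theta> A)
     \<lparr>carrier := {x \<in> carrier (motive_tate q ord \<theta> A). motive_tate_tau q ord \<theta> A x = x}\<rparr>"

definition h1 :: "nat \<Rightarrow> ('c::field \<Rightarrow> ereal) \<Rightarrow> 'c \<Rightarrow> 'c ^ 2 ^ 2 \<Rightarrow> nat" where
  "h1 q ord \<theta> A = free_rank (polyring_T_Fq q) (H1 q ord \<theta> A)"


section \<open>The domain\<close>

text \<open>
  With \<open>ord \<theta> = -1\<close>, \<open>u = ord a12\<close>, \<open>v = ord a21\<close>, this says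
  $\mathrm{ord}(\theta^{q^2}/a_{21}^{q^2}) < \mathrm{ord}(\theta^q/a_{21})$ and
  $\mathrm{ord}(\theta^{q^2}/a_{21}^{q^2}) < \mathrm{ord}(a_{12}^q)$.
\<close>
definition D13 :: "nat \<Rightarrow> (real \<times> real) set" where
  "D13 q = {(u, v). - real (q ^ 2) - real (q ^ 2) * v < - real q - v \<and>
                    - real (q ^ 2) - real (q ^ 2) * v < real q * u}"

end

theory Submission
  imports Defs
begin

text \<open>
  In the coordinates at \<open>e\<^sub>1, e\<^sub>2, \<tau>e\<^sub>1, \<tau>e\<^sub>2\<close>, a \<open>\<tau>\<close>-invariant element is determined by two power series
  \<open>\<Sum> x\<^sub>k T\<^sup>k\<close> and \<open>\<Sum> y\<^sub>k T\<^sup>k\<close> whose coefficients satisfy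
  \<open>\<theta>\<^sup>2 x\<^sub>k\<^sup>4 + a\<^sub>1\<^sub>1 x\<^sub>k\<^sup>2 + a\<^sub>2\<^sub>1 y\<^sub>k\<^sup>2 + x\<^sub>k = x\<^sub>k\<^sub>-\<^sub>1\<^sup>4\<close> and \<open>\<theta>\<^sup>2 y\<^sub>k\<^sup>4 + a\<^sub>1\<^sub>2 x\<^sub>k\<^sup>2 + y\<^sub>k = y\<^sub>k\<^sub>-\<^sub>1\<^sup>4\<close>.
  Elimination of \<open>y\<^sub>0\<close> gives a separable polynomial of degree 16 for \<open>x\<^sub>0\<close>, hence 16 initial values.
  The inequalities defining the domain give \<open>ord x\<^sub>0 \<ge> w\<close> and \<open>ord y\<^sub>0 \<ge> (w - v)/2\<close> for \<open>w = 1/2\<close>,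
  and if such bounds hold for \<open>(x\<^sub>k, y\<^sub>k)\<close> then \<open>(x\<^sub>k\<^sub>+\<^sub>1, y\<^sub>k\<^sub>+\<^sub>1)\<close> can be chosen to satisfy them with \<open>4w\<close> in
  place of \<open>w\<close>. So every initial value extends to a convergent solution. Sixteen invariant elements
  with distinct constant terms contain four whose determinant does not vanish, and then the rank
  is four.
\<close>

section \<open>Subfields and algebraic elements\<close>

text \<open>Three obstacles shape the development. Algebraic closedness is assumed only for the
  algebraic closure of the local field at infinity; the count of sixteen roots and every step of the
  recursion need roots in \<open>'c\<close> itself, so it has to be carried over to the completion.
  The determinant of four invariants is not invariant: it differs from its Frobenius twist by the
  factor \<open>(T - \<theta>)^2\<close>, which the square of an auxiliary series absorbs. The
  tensor product is a raw quotient of a free abelian group, so it must be identified with vectors of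
  four power series before anything can be computed. Sixteen is q^4, while a space of dimension
  three contains at most q^3 = 8 of the fixed vectors. The value w = 1/2 is the order of x at which
  \<open>\<theta>^2 x^4\<close> and \<open>a11 x^2\<close> balance; below it
  \<open>\<theta>^2 x^4\<close> outweighs both other terms in x, so that ord x determines ord y. The
  factor 4 comes from the fourth powers on the right of the recursion; it is attained because the
  linear coefficient \<open>1 / a21\<close> of the elimination polynomial has order exactly
  -v.\<close>

definition is_subfield :: "'a::field set \<Rightarrow> bool" where
  "is_subfield S \<longleftrightarrow> 0 \<in> S \<and> 1 \<in> S \<and> (\<forall>x\<in>S. - x \<in> S \<and> inverse x \<in> S) \<and>
     (\<forall>x\<in>S. \<forall>y\<in>S. x + y \<in> S \<and> x * y \<in> S)"

lemma is_subfield_UNIV: "is_subfield UNIV"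
  by (simp add: is_subfield_def)

lemma is_subfieldD:
  assumes "is_subfield S"
  shows "0 \<in> S" "1 \<in> S" "x \<in> S \<Longrightarrow> - x \<in> S" "x \<in> S \<Longrightarrow> inverse x \<in> S"
    "x \<in> S \<Longrightarrow> y \<in> S \<Longrightarrow> x + y \<in> S" "x \<in> S \<Longrightarrow> y \<in> S \<Longrightarrow> x * y \<in> S"
  using assms by (auto simp: is_subfield_def)

lemma is_subfield_sum: "is_subfield S \<Longrightarrow> (\<And>i. i \<in> I \<Longrightarrow> f i \<in> S) \<Longrightarrow> sum f I \<in> S"
  by (induction I rule: infinite_finite_induct) (auto simp: is_subfieldD)

lemma polys_over_pCons_iff [simp]:
  "pCons a p \<in> polys_over S \<longleftrightarrow> a \<in> S \<and> p \<in> polys_over S"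
  by (auto simp: polys_over_def coeff_pCons split: nat.splits)

lemma polys_over_0: "is_subfield S \<Longrightarrow> 0 \<in> polys_over S"
  by (simp add: polys_over_def is_subfieldD)

lemma polys_over_add:
  "is_subfield S \<Longrightarrow> p \<in> polys_over S \<Longrightarrow> r \<in> polys_over S \<Longrightarrow> p + r \<in> polys_over S"
  by (simp add: polys_over_def is_subfieldD)

lemma polys_over_mult:
  "is_subfield S \<Longrightarrow> p \<in> polys_over S \<Longrightarrow> r \<in> polys_over S \<Longrightarrow> p * r \<in> polys_over S"
  by (auto simp: polys_over_def coeff_mult is_subfieldD intro!: is_subfield_sum)

lemma polys_over_uminus: "is_subfield S \<Longrightarrow> p \<in> polys_over S \<Longrightarrow> - p \<in> polys_over S"
  by (simp add: polys_over_def is_subfieldD)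

lemma polys_over_diff:
  "is_subfield S \<Longrightarrow> p \<in> polys_over S \<Longrightarrow> r \<in> polys_over S \<Longrightarrow> p - r \<in> polys_over S"
  using polys_over_add[of S p "- r"] polys_over_uminus[of S r] by simp

lemma poly_in_subfield:
  "is_subfield S \<Longrightarrow> p \<in> polys_over S \<Longrightarrow> x \<in> S \<Longrightarrow> poly p x \<in> S"
  by (induction p) (auto simp: is_subfieldD)

lemma polys_over_pcompose:
  "is_subfield S \<Longrightarrow> p \<in> polys_over S \<Longrightarrow> r \<in> polys_over S \<Longrightarrow> pcompose p r \<in> polys_over S"
  by (induction p) (auto simp: pcompose_pCons is_subfieldD intro!: polys_over_add polys_over_mult polys_over_0)

lemma polys_over_synthetic_div:
  "is_subfield S \<Longrightarrow> p \<in> polys_over S \<Longrightarrow> x \<in> S \<Longrightarrow> synthetic_div p x \<in> polys_over S"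
  by (induction p) (auto simp: polys_over_0 intro: poly_in_subfield)

lemma poly_Poly_snoc:
  fixes x :: "'a::comm_semiring_1"
  shows "poly (Poly (xs @ [a])) x = poly (Poly xs) x + a * x ^ length xs"
  by (induction xs) (auto simp: algebra_simps)

lemma Fq_subfield:
  assumes "Factorial_Ring.prime CHAR('c::field)" "q = CHAR('c) ^ k" "k > 0"
  shows "is_subfield (Fq q :: 'c set)"
proof -
  have q0: "q > 0"
    using assms prime_gt_0_nat by auto
  have add: "(x + y) ^ q = x ^ q + y ^ q" for x y :: 'c
    using freshmans_dream'[of q k x y] assms by simp
  \<comment> \<open>Additivity of the Frobenius yields the sign rule without a case distinction on
    the parity of \<open>q\<close>.\<close>
  have minus: "- x \<in> Fq q" if "x \<in> Fq q" for x :: 'c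
  proof -
    have "x ^ q + (- x) ^ q = 0" using add[of x "- x"] q0 by (simp add: power_0_left)
    thus ?thesis using that by (simp add: Fq_def add_eq_0_iff)
  qed
  show ?thesis
    using q0 minus by (auto simp: is_subfield_def Fq_def add power_mult_distrib power_inverse)
qed

lemma rational_functions_subfield:
  fixes \<theta> :: "'c::field"
  assumes "is_subfield (Fq q :: 'c set)"
  shows "is_subfield (rational_functions q \<theta>)"
proof -
  let ?P = "polys_over (Fq q) :: 'c poly set"
  \<comment> \<open>Division by zero is zero, so the denominator may vanish here; this also covers
    \<open>inverse 0\<close> below.\<close>
  have mem: "poly p \<theta> / poly r \<theta> \<in> rational_functions q \<theta>"
    if "p \<in> ?P" "r \<in> ?P" for p r
  proof (cases "poly r \<theta> = 0")
    case True
    have "poly 0 \<theta> / poly [:1:] \<theta> \<in> rational_functions q \<theta>"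
      unfolding rational_functions_def
      using is_subfieldD[OF assms] polys_over_0[OF assms] by (intro CollectI exI[of _ 0] exI[of _ "[:1:]"]) auto
    thus ?thesis using True by simp
  qed (use that in \<open>auto simp: rational_functions_def\<close>)
  have one: "1 \<in> ?P" using is_subfieldD[OF assms] polys_over_0[OF assms]
    by (simp add: one_pCons)
  have E: "\<exists>p\<in>?P. \<exists>r\<in>?P. poly r \<theta> \<noteq> 0 \<and> x = poly p \<theta> / poly r \<theta>"
    if "x \<in> rational_functions q \<theta>" for x
    using that by (auto simp: rational_functions_def)
  have "0 \<in> rational_functions q \<theta>" "1 \<in> rational_functions q \<theta>"
    using mem[OF polys_over_0[OF assms] one] mem[OF one one] by simp_all
  moreover have "- x \<in> rational_functions q \<theta>" "inverse x \<in> rational_functions q \<theta>"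
    if x: "x \<in> rational_functions q \<theta>" for x
  proof -
    obtain p r where pr: "p \<in> ?P" "r \<in> ?P" "x = poly p \<theta> / poly r \<theta>" using E[OF x] by blast
    show "- x \<in> rational_functions q \<theta>" "inverse x \<in> rational_functions q \<theta>"
      using mem[OF polys_over_uminus[OF assms pr(1)] pr(2)] mem[OF pr(2,1)] pr(3) by simp_all
  qed
  moreover have "x + y \<in> rational_functions q \<theta>" "x * y \<in> rational_functions q \<theta>"
    if x: "x \<in> rational_functions q \<theta>" and y: "y \<in> rational_functions q \<theta>" for x y
  proof -
    obtain p r where pr: "p \<in> ?P" "r \<in> ?P" "poly r \<theta> \<noteq> 0" "x = poly p \<theta> / poly r \<theta>"
      using E[OF x] by blast
    obtain p' r' where pr': "p' \<in> ?P" "r' \<in> ?P" "poly r' \<theta> \<noteq> 0" "y = poly p' \<theta> / poly r' \<theta>"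
      using E[OF y] by blast
    have "x + y = poly (p * r' + p' * r) \<theta> / poly (r * r') \<theta>"
      using pr pr' by (simp add: add_frac_eq mult.commute)
    moreover have "x * y = poly (p * p') \<theta> / poly (r * r') \<theta>"
      using pr pr' by simp
    ultimately show "x + y \<in> rational_functions q \<theta>" "x * y \<in> rational_functions q \<theta>"
      using pr pr' by (auto simp only: intro!: mem polys_over_add polys_over_mult assms)
  qed
  ultimately show ?thesis by (auto simp: is_subfield_def)
qed

text \<open>That sums and products of algebraic elements are algebraic is taken from the theory of
  fields as records: the type \<open>'c\<close> is viewed as such a record and the two notions of
  algebraic element are matched.\<close>

lemma algebraic_elements_subfield:
  fixes K :: "'c::field set"
  assumes "is_subfield K"
  shows "is_subfield (algebraic_elements K)"
proof -
  define R where "R = (ring_of_type_algebra :: 'c ring)"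
  interpret R: field R unfolding R_def by (rule field_from_type_algebra)
  have [simp]: "carrier R = UNIV" "x \<oplus>\<^bsub>R\<^esub> y = x + y" "x \<otimes>\<^bsub>R\<^esub> y = x * y"
    "\<zero>\<^bsub>R\<^esub> = 0" "\<one>\<^bsub>R\<^esub> = 1" for x y
    by (simp_all add: R_def ring_of_type_algebra_def)
  have [simp]: "\<ominus>\<^bsub>R\<^esub> x = - x" for x by (rule R.minus_equality) auto
  have [simp]: "inv\<^bsub>R\<^esub> x = inverse x" if "x \<noteq> 0" for x
    by (rule R.comm_inv_char) (use that in auto)
  have pow: "x [^]\<^bsub>R\<^esub> n = x ^ n" for x and n :: nat
    by (induction n) (auto simp: mult.commute)
  \<comment> \<open>Coefficient lists of \<open>univ_poly\<close> start with the leading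
    coefficient, those of \<open>Poly\<close> with the constant one; hence the reversal.\<close>
  have ev: "R.eval xs x = poly (Poly (rev xs)) x" for xs x
    by (induction xs) (auto simp: poly_Poly_snoc pow)
  have "subring K R"
    by (rule R.subringI) (use is_subfieldD[OF assms] in auto)
  hence "subfield K R"
    by (rule R.subfieldI') (use is_subfieldD[OF assms] in auto)
  hence *: "subfield {x \<in> carrier R. (R.algebraic over K) x} R" by (rule R.subfield_of_algebraics)
  have eq: "{x \<in> carrier R. (R.algebraic over K) x} = algebraic_elements K"
  proof (intro equalityI subsetI)
    fix x assume "x \<in> {x \<in> carrier R. (R.algebraic over K) x}"
    then obtain p where p: "p \<in> carrier (univ_poly R K)" "p \<noteq> []" "R.eval p x = \<zero>\<^bsub>R\<^esub>"
      using R.algebraicE[OF \<open>subring K R\<close>, of x] by auto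
    have pK: "set p \<subseteq> K" "hd p \<noteq> 0"
      using p(1,2) by (auto simp flip: univ_poly_carrier simp: polynomial_def)
    have "Poly (rev p) \<in> polys_over K"
      using pK(1) is_subfieldD(1)[OF assms]
      by (auto simp: polys_over_def nth_default_def rev_nth subset_iff)
    moreover have "Poly (rev p) \<noteq> 0"
    proof
      assume "Poly (rev p) = 0"
      hence "\<forall>y\<in>set (rev p). y = 0" by (auto simp: Poly_eq_0 dest: arg_cong[of _ _ set])
      thus False using pK(2) p(2) by (cases p) auto
    qed
    ultimately show "x \<in> algebraic_elements K"
      using p(3) by (auto simp: algebraic_elements_def ev)
  next
    fix x assume "x \<in> algebraic_elements K"
    then obtain p where p: "p \<in> polys_over K" "p \<noteq> 0" "poly p x = 0"
      by (auto simp: algebraic_elements_def)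
    have "rev (Polynomial.coeffs p) \<in> carrier (univ_poly R K)"
      using p(1,2) last_coeffs_eq_coeff_degree[of p]
      by (auto simp flip: univ_poly_carrier simp: polynomial_def polys_over_def coeffs_def hd_rev)
    hence "(R.algebraic over K) x"
      by (rule R.algebraicI) (use p in \<open>auto simp: ev\<close>)
    thus "x \<in> {x \<in> carrier R. (R.algebraic over K) x}" by simp
  qed
  have **: "subfield (algebraic_elements K) R" using * eq by simp
  note E = subringE[OF subfieldE(1)[OF **]]
  have "inverse x \<in> algebraic_elements K" if "x \<in> algebraic_elements K" for x
    using R.subfield_m_inv(1)[OF **, of x] that by (cases "x = 0") auto
  thus ?thesis using E by (auto simp: is_subfield_def)
qed

section \<open>Non-archimedean valuations\<close>

context valuation
begin

lemma ord_zero [simp]: "ord 0 = \<infinity>"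
  using ord_eq_inf_iff by simp

lemma ord_real:
  assumes "x \<noteq> 0"
  obtains r where "ord x = ereal r"
  using assms ord_not_minf[of x] ord_eq_inf_iff[of x] by (cases "ord x") auto

lemma ord_nonzero: "ord x = ereal r \<Longrightarrow> x \<noteq> 0"
  by auto

lemma ord_one [simp]: "ord 1 = 0"
proof -
  obtain r where r: "ord 1 = ereal r" by (rule ord_real[of 1]) auto
  have "ord (1 * 1) = ord 1 + ord 1" by (rule ord_mult)
  thus ?thesis using r by simp
qed

lemma ord_minus [simp]: "ord (- x) = ord x"
proof -
  obtain r where r: "ord (-1) = ereal r" by (rule ord_real[of "-1"]) auto
  have "ord (- 1 * - 1) = ord (-1) + ord (-1)" by (rule ord_mult)
  hence "ord (-1) = 0" using r by simp
  thus ?thesis using ord_mult[of "-1" x] by simp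
qed

lemma ord_power_eq: "ord x = ereal r \<Longrightarrow> ord (x ^ n) = ereal (real n * r)"
  by (induction n) (auto simp: ord_mult algebra_simps zero_ereal_def)

lemma ord_mult_eq: "ord x = ereal r \<Longrightarrow> ord y = ereal s \<Longrightarrow> ord (x * y) = ereal (r + s)"
  by (simp add: ord_mult)

lemma ord_inverse_eq: "ord x = ereal r \<Longrightarrow> ord (inverse x) = ereal (- r)"
proof -
  assume r: "ord x = ereal r"
  obtain s where s: "ord (inverse x) = ereal s"
    by (rule ord_real[of "inverse x"]) (use r in auto)
  have "ord (x * inverse x) = ereal (r + s)" using ord_mult_eq[OF r s] .
  moreover have "x * inverse x = 1" using r by (intro right_inverse) auto
  ultimately show ?thesis using s by (simp add: zero_ereal_def)
qed

lemma ord_ge_add: "c \<le> ord x \<Longrightarrow> c \<le> ord y \<Longrightarrow> c \<le> ord (x + y)"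
  using ord_add[of x y] by (meson min.boundedI order_trans)

lemma ord_ge_diff: "c \<le> ord x \<Longrightarrow> c \<le> ord y \<Longrightarrow> c \<le> ord (x - y)"
  using ord_ge_add[of c x "- y"] by simp

lemma ord_gr_add: "c < ord x \<Longrightarrow> c < ord y \<Longrightarrow> c < ord (x + y)"
  using ord_add[of x y] by (metis less_le_trans min_less_iff_conj)

lemma ord_gr_diff: "c < ord x \<Longrightarrow> c < ord y \<Longrightarrow> c < ord (x - y)"
  using ord_gr_add[of c x "- y"] by simp

lemma ord_diff_commute: "ord (x - y) = ord (y - x)"
  using ord_minus[of "x - y"] by simp

lemma ord_ge_sum: "(\<And>i. i \<in> I \<Longrightarrow> c \<le> ord (f i)) \<Longrightarrow> c \<le> ord (sum f I)"
  by (induction I rule: infinite_finite_induct) (auto intro: ord_ge_add)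

lemma ord_gr_sum: "c < \<infinity> \<Longrightarrow> (\<And>i. i \<in> I \<Longrightarrow> c < ord (f i)) \<Longrightarrow> c < ord (sum f I)"
  by (induction I rule: infinite_finite_induct) (auto intro: ord_gr_add)

lemma ord_ge_mult: "ereal a \<le> ord x \<Longrightarrow> ereal b \<le> ord y \<Longrightarrow> ereal (a + b) \<le> ord (x * y)"
  using add_mono[of "ereal a" "ord x" "ereal b" "ord y"] by (simp add: ord_mult)

lemma ord_gr_mult_eq: "ereal a < ord x \<Longrightarrow> ord y = ereal b \<Longrightarrow> ereal (a + b) < ord (x * y)"
  by (cases "ord x") (auto simp: ord_mult)

lemma ord_ge_power: "ereal a \<le> ord x \<Longrightarrow> ereal (real n * a) \<le> ord (x ^ n)"
proof (induction n)
  case (Suc n)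
  thus ?case using ord_ge_mult[of a x "real n * a" "x ^ n"] by (simp add: algebra_simps)
qed (simp add: zero_ereal_def)

lemma ord_ge_divide:
  "ereal a \<le> ord x \<Longrightarrow> ord y = ereal b \<Longrightarrow> ereal (a - b) \<le> ord (x / y)"
  using ord_ge_mult[of a x "- b" "inverse y"] by (simp add: ord_inverse_eq divide_inverse)

lemma ord_divide_eq:
  "ord x = ereal a \<Longrightarrow> ord y = ereal b \<Longrightarrow> ord (x / y) = ereal (a - b)"
  by (simp add: divide_inverse ord_mult ord_inverse_eq)

lemma ord_add_eq: "ord x < ord y \<Longrightarrow> ord (x + y) = ord x"
proof (rule antisym)
  assume l: "ord x < ord y"
  show "ord x \<le> ord (x + y)" using l by (intro ord_ge_add) auto
  show "ord (x + y) \<le> ord x"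
  proof (rule ccontr)
    assume "\<not> ord (x + y) \<le> ord x"
    hence "ord x < ord (x + y - y)" using l by (intro ord_gr_diff) auto
    thus False by simp
  qed
qed

lemma val_tendsto_iff:
  "val_tendsto ord s x \<longleftrightarrow> (\<forall>B::real. \<exists>N. \<forall>n\<ge>N. ereal B < ord (s n - x))"
  unfolding val_tendsto_def by (simp add: tendsto_PInfty eventually_sequentially)

section \<open>Valuations of values and roots of polynomials\<close>

lemma poly_ord_ge:
  assumes "ereal b \<le> ord x" "b \<le> 0" "Polynomial.degree p \<le> n" "\<And>i. ereal a \<le> ord (Polynomial.coeff p i)"
  shows "ereal (a + real n * b) \<le> ord (poly p x)"
  unfolding poly_altdef
proof (rule ord_ge_sum)
  fix i assume i: "i \<in> {..Polynomial.degree p}"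
  have "a + real n * b \<le> a + real i * b"
    using i assms by (auto intro!: mult_right_mono_neg)
  thus "ereal (a + real n * b) \<le> ord (Polynomial.coeff p i * x ^ i)"
    using ord_ge_mult[OF assms(4)[of i] ord_ge_power[OF assms(1), of i]]
    by (meson ereal_less_eq(3) order_trans)
qed

text \<open>
  In terms of the Newton polygon: every coefficient lies strictly above the line of slope \<open>-w\<close>
  through the point of the constant coefficient.
\<close>
lemma coeffs_above_line:
  assumes S: "is_subfield S"
    and root: "\<And>p. p \<in> polys_over S \<Longrightarrow> Polynomial.degree p > 0 \<Longrightarrow> \<exists>x\<in>S. poly p x = 0"
  shows "p \<in> polys_over S \<Longrightarrow> p \<noteq> 0 \<Longrightarrow> (\<And>x. x \<in> S \<Longrightarrow> poly p x = 0 \<Longrightarrow> ord x < ereal w) \<Longrightarrow>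
     \<exists>a. ord (Polynomial.coeff p 0) = ereal a \<and> (\<forall>i\<ge>1. ereal (a - real i * w) < ord (Polynomial.coeff p i))"
proof (induction "Polynomial.degree p" arbitrary: p)
  case 0
  hence "Polynomial.coeff p 0 \<noteq> 0" by (metis leading_coeff_0_iff)
  then obtain a where "ord (Polynomial.coeff p 0) = ereal a" by (rule ord_real)
  moreover have "Polynomial.coeff p i = 0" if "i \<ge> 1" for i
    using that 0 by (intro coeff_eq_0) auto
  ultimately show ?case by auto
next
  case (Suc n)
  then obtain r where r: "r \<in> S" "poly p r = 0" using root[of p] by auto
  define s where "s = synthetic_div p r"
  have p: "p = [:- r, 1:] * s"
    using synthetic_div_correct'[of r p] r by (simp add: s_def)
  have s: "s \<in> polys_over S" "s \<noteq> 0" "n = Polynomial.degree s"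
  proof -
    show "s \<in> polys_over S"
      unfolding s_def by (rule polys_over_synthetic_div[OF S Suc.prems(1) r(1)])
    show "s \<noteq> 0" using p Suc.prems(2) by (metis mult_zero_right)
    show "n = Polynomial.degree s" using Suc.hyps(2) by (simp add: s_def degree_synthetic_div)
  qed
  have "ord r < ereal w" using Suc.prems(3) r by auto
  then obtain \<rho> where \<rho>: "ord r = ereal \<rho>" "\<rho> < w"
    using ord_not_minf[of r] by (cases "ord r") auto
  have "\<exists>a. ord (Polynomial.coeff s 0) = ereal a \<and> (\<forall>i\<ge>1. ereal (a - real i * w) < ord (Polynomial.coeff s i))"
  proof (rule Suc.hyps(1)[OF s(3,1,2)])
    show "ord x < ereal w" if "x \<in> S" "poly s x = 0" for x
      using that by (intro Suc.prems(3)) (simp_all add: arg_cong[OF p, of "\<lambda>p. poly p x"])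
  qed
  then obtain a where a: "ord (Polynomial.coeff s 0) = ereal a"
    "\<And>i. i \<ge> 1 \<Longrightarrow> ereal (a - real i * w) < ord (Polynomial.coeff s i)" by auto
  have c0: "Polynomial.coeff p 0 = - (r * Polynomial.coeff s 0)" and cS: "Polynomial.coeff p (Suc i) = Polynomial.coeff s i - r * Polynomial.coeff s (Suc i)" for i
    by (simp_all add: p coeff_pCons)
  have "ord (Polynomial.coeff p 0) = ereal (a + \<rho>)" using a(1) \<rho> by (simp add: c0 ord_mult)
  \<comment> \<open>In \<open>coeff s j - r * coeff s (j + 1)\<close> the first term has index lower
    by one, and \<open>\<rho> < w\<close> pays for that shift (also for j = 0, where only equality
    is known). The second term lies above the line for \<open>s\<close>, moved by exactly
    \<open>\<rho>\<close>.\<close>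
  moreover have "ereal (a + \<rho> - real i * w) < ord (Polynomial.coeff p i)" if i1: "i \<ge> 1" for i
  proof -
    obtain j where j: "i = Suc j" using i1 by (cases i) auto
    have "ereal (a + \<rho> - real i * w) < ord (Polynomial.coeff s j)"
    proof (cases "j = 0")
      case False
      have "ereal (a + \<rho> - real i * w) < ereal (a - real j * w)"
        using \<rho> j by (simp add: algebra_simps)
      also have "\<dots> < ord (Polynomial.coeff s j)" using a(2) False by simp
      finally show ?thesis .
    qed (use a \<rho> j in simp)
    moreover have "ereal ((a - real i * w) + \<rho>) < ord (Polynomial.coeff s i * r)"
      using a(2)[of i] \<rho> i1 by (intro ord_gr_mult_eq) auto
    ultimately show ?thesis
      unfolding j cS by (intro ord_gr_diff) (auto simp: algebra_simps)
  qed
  ultimately show ?case by blast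
qed

corollary small_root:
  assumes "is_subfield S"
    and "\<And>p. p \<in> polys_over S \<Longrightarrow> Polynomial.degree p > 0 \<Longrightarrow> \<exists>x\<in>S. poly p x = 0"
    and "p \<in> polys_over S" "i \<ge> 1" "ord (Polynomial.coeff p i) = ereal b"
    and "ereal (b + real i * w) \<le> ord (Polynomial.coeff p 0)"
  shows "\<exists>x\<in>S. poly p x = 0 \<and> ereal w \<le> ord x"
proof (rule ccontr)
  assume "\<not> ?thesis"
  moreover have "p \<noteq> 0" using assms(5) by auto
  ultimately obtain a where a: "ord (Polynomial.coeff p 0) = ereal a"
    "\<forall>i\<ge>1. ereal (a - real i * w) < ord (Polynomial.coeff p i)"
    using coeffs_above_line[OF assms(1,2,3), of w] by (auto simp: not_le)
  hence "a - real i * w < b" using assms(4,5) by auto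
  thus False using a assms(6) by simp
qed

text \<open>If ord x were below -a, hence negative, the leading term x^n would have strictly smaller
  order than every other term and could not cancel.\<close>

lemma root_ord_ge:
  assumes p: "Polynomial.lead_coeff p = 1" "Polynomial.degree p > 0" "poly p x = 0"
    and a: "\<And>i. ereal (- a) \<le> ord (Polynomial.coeff p i)" "a \<ge> 0"
  shows "ereal (- a) \<le> ord x"
proof (rule ccontr)
  assume "\<not> ?thesis"
  then obtain r where r: "ord x = ereal r" "r < - a"
    using ord_not_minf[of x] by (cases "ord x") auto
  define n where "n = Polynomial.degree p"
  have "x ^ n + (\<Sum>i<n. Polynomial.coeff p i * x ^ i) = 0"
    using p by (simp add: poly_altdef n_def lessThan_Suc_atMost[symmetric] add.commute)
  hence eq: "x ^ n = - (\<Sum>i<n. Polynomial.coeff p i * x ^ i)" by (simp add: add_eq_0_iff)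
  have "ereal (real n * r) < ord (\<Sum>i<n. Polynomial.coeff p i * x ^ i)"
  proof (rule ord_gr_sum)
    fix i assume i: "i \<in> {..<n}"
    have "real i * r \<ge> (real n - 1) * r"
      using i r a(2) by (intro mult_right_mono_neg) auto
    hence "ereal (real n * r) < ereal (- a + real i * r)"
      using r by (simp add: algebra_simps)
    also have "\<dots> \<le> ord (Polynomial.coeff p i * x ^ i)"
      using a(1)[of i] ord_power_eq[OF r(1), of i] by (intro ord_ge_mult) auto
    finally show "ereal (real n * r) < ord (Polynomial.coeff p i * x ^ i)" .
  qed simp
  also have "\<dots> = ord (x ^ n)" unfolding eq by simp
  also have "\<dots> = ereal (real n * r)" by (rule ord_power_eq[OF r(1)])
  finally show False by simp
qed

lemma poly_ord_lower_bound: "\<exists>a\<ge>0. \<forall>i. ereal (- a) \<le> ord (Polynomial.coeff p i)"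
proof -
  have "\<exists>a\<ge>0. \<forall>i<n. ereal (- a) \<le> ord (Polynomial.coeff p i)" for n
  proof (induction n)
    case (Suc n)
    then obtain a where a: "a \<ge> 0" "\<forall>i<n. ereal (- a) \<le> ord (Polynomial.coeff p i)" by auto
    obtain b :: real where b: "ereal b \<le> ord (Polynomial.coeff p n)"
      using ord_not_minf[of "Polynomial.coeff p n"] by (cases "ord (Polynomial.coeff p n)") auto
    have "ereal (- max a (- b)) \<le> ord (Polynomial.coeff p i)" if "i < Suc n" for i
    proof (cases "i = n")
      case True
      have "ereal (- max a (- b)) \<le> ereal b" by (auto simp: max_def)
      thus ?thesis using b True by (metis order_trans)
    next
      case False
      have "ereal (- max a (- b)) \<le> ereal (- a)" by auto
      thus ?thesis using a(2) that False by (metis less_antisym order_trans)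
    qed
    thus ?case using a by (intro exI[of _ "max a (- b)"]) auto
  qed (auto intro: exI[of _ 0])
  then obtain a where a: "a \<ge> 0" "\<forall>i<Suc (Polynomial.degree p). ereal (- a) \<le> ord (Polynomial.coeff p i)" by blast
  have "ereal (- a) \<le> ord (Polynomial.coeff p i)" for i
    using a(2) coeff_eq_0[of p i] by (cases "i \<le> Polynomial.degree p") auto
  thus ?thesis using a(1) by blast
qed

text \<open>Expansion at \<open>x\<close> gives p(x + z) = c + z r(z). If c were nonzero, the second
  term would eventually have larger order, and the order of p(s n) would stay at ord c.\<close>

lemma poly_limit_root:
  assumes lim: "val_tendsto ord s x"
    and pz: "\<And>B::real. \<exists>N. \<forall>n\<ge>N. ereal B < ord (poly p (s n))"
  shows "poly p x = 0"
proof (rule ccontr)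
  assume nz: "poly p x \<noteq> 0"
  obtain c r where cr: "pcompose p [:x, 1:] = pCons c r" by (rule pCons_cases)
  have c: "c = poly p x"
    using arg_cong[OF cr, of "\<lambda>r. poly r 0"] by (simp add: poly_pcompose)
  obtain b where b: "ord c = ereal b" using nz c by (metis ord_real)
  obtain a where a: "a \<ge> 0" "\<And>i. ereal (- a) \<le> ord (Polynomial.coeff r i)"
    using poly_ord_lower_bound[of r] by auto
  obtain N1 where N1: "\<And>n. n \<ge> N1 \<Longrightarrow> ereal (max 0 (b + a)) < ord (s n - x)"
    using lim unfolding val_tendsto_iff by blast
  obtain N2 where N2: "\<And>n. n \<ge> N2 \<Longrightarrow> ereal b < ord (poly p (s n))" using pz by blast
  define n where "n = max N1 N2"
  define z where "z = s n - x"
  have z: "ereal (max 0 (b + a)) < ord z" using N1[of n] by (simp add: n_def z_def)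
  have z0: "ereal 0 \<le> ord z"
    using z by (metis ereal_less_eq(3) less_imp_le max.cobounded1 order_trans)
  have "ereal (- a) \<le> ord (poly r z)"
    using poly_ord_ge[OF z0 _ order_refl[of "Polynomial.degree r"], of "- a"] a by simp
  moreover have "ereal (b + a) < ord z"
    using z by (metis ereal_less_eq(3) max.cobounded2 order_le_less_trans)
  ultimately have "ereal b < ord (z * poly r z)"
    unfolding ord_mult by (cases "ord z"; cases "ord (poly r z)") auto
  hence "ord (poly (pCons c r) z) = ereal b" using ord_add_eq[of c "z * poly r z"] b by simp
  moreover have "poly (pCons c r) z = poly p (s n)"
    unfolding cr[symmetric] by (simp add: poly_pcompose z_def)
  ultimately show False using N2[of n] by (simp add: n_def)
qed

section \<open>Closures of subfields and the completion of an algebraically closed field\<close>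

lemma val_closure_iff:
  "x \<in> val_closure ord S \<longleftrightarrow> (\<forall>B::real. \<exists>y\<in>S. ereal B < ord (y - x))"
proof
  assume "x \<in> val_closure ord S"
  then obtain s where "\<And>n. s n \<in> S" "val_tendsto ord s x" by (auto simp: val_closure_def)
  thus "\<forall>B::real. \<exists>y\<in>S. ereal B < ord (y - x)"
    unfolding val_tendsto_iff by blast
next
  assume r: "\<forall>B::real. \<exists>y\<in>S. ereal B < ord (y - x)"
  have "\<forall>n::nat. \<exists>y\<in>S. ereal (real n) < ord (y - x)" using r by blast
  then obtain s where s: "\<And>n::nat. s n \<in> S" "\<And>n. ereal (real n) < ord (s n - x)" by metis
  have "\<exists>N. \<forall>n\<ge>N. ereal B < ord (s n - x)" for B :: real
  proof (intro exI allI impI)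
    fix n assume "n \<ge> nat \<lceil>B\<rceil>"
    hence "ereal B \<le> ereal (real n)" by (simp; linarith)
    thus "ereal B < ord (s n - x)" using s(2) by (rule order_le_less_trans)
  qed
  thus "x \<in> val_closure ord S"
    using s(1) by (auto simp: val_closure_def val_tendsto_iff)
qed

lemma val_closure_subfield:
  assumes S: "is_subfield S"
  shows "is_subfield (val_closure ord S)"
proof -
  have sub: "x \<in> val_closure ord S" if "x \<in> S" for x
    unfolding val_closure_iff using that by force
  have add: "x + y \<in> val_closure ord S" if xy: "x \<in> val_closure ord S" "y \<in> val_closure ord S" for x y
    unfolding val_closure_iff
  proof
    fix B :: real
    obtain s t where st: "s \<in> S" "t \<in> S" "ereal B < ord (s - x)" "ereal B < ord (t - y)"
      using xy unfolding val_closure_iff by meson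
    have "ereal B < ord ((s - x) + (t - y))" by (rule ord_gr_add[OF st(3,4)])
    moreover have "(s - x) + (t - y) = (s + t) - (x + y)" by simp
    ultimately show "\<exists>z\<in>S. ereal B < ord (z - (x + y))"
      using is_subfieldD(5)[OF S st(1,2)] by metis
  qed
  have mult: "x * y \<in> val_closure ord S" if xy: "x \<in> val_closure ord S" "y \<in> val_closure ord S" for x y
    unfolding val_closure_iff
  proof
    fix B :: real
    \<comment> \<open>The polynomial \<open>[:x, y:]\<close> only serves to give \<open>x\<close>
      and \<open>y\<close> a common lower bound.\<close>
    obtain a where a0: "a \<ge> 0" "\<And>i. ereal (- a) \<le> ord (Polynomial.coeff [:x, y:] i)"
      using poly_ord_lower_bound[of "[:x, y:]"] by blast
    have a: "a \<ge> 0" "ereal (- a) \<le> ord x" "ereal (- a) \<le> ord y"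
      using a0(1) a0(2)[of 0] a0(2)[of 1] by simp_all
    obtain s where s: "s \<in> S" "ereal (max 0 B + a) < ord (s - x)"
      using xy unfolding val_closure_iff by meson
    obtain t where t: "t \<in> S" "ereal (max 0 B + a) < ord (t - y)"
      using xy unfolding val_closure_iff by meson
    have as: "ereal (- a) \<le> ord s"
    proof -
      have "ereal (- a) \<le> ereal (max 0 B + a)" using a by simp
      hence "ereal (- a) \<le> ord (s - x)" using s(2) by (meson less_imp_le order_trans)
      from ord_ge_add[OF this a(2)] show ?thesis by simp
    qed
    have gr: "ereal B < ord (c * d)" if "ereal (max 0 B + a) < ord c" "ereal (- a) \<le> ord d" for c d
    proof -
      define B' where "B' = max 0 B"
      have "ereal B' < ord (c * d)"
        using that unfolding B'_def[symmetric] by (cases "ord c"; cases "ord d") (auto simp: ord_mult)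
      moreover have "ereal B \<le> ereal B'" by (simp add: B'_def)
      ultimately show ?thesis by (rule order_le_less_trans[rotated])
    qed
    have "ereal B < ord ((s - x) * y + (t - y) * s)"
      by (intro ord_gr_add gr s t as a)
    moreover have "(s - x) * y + (t - y) * s = s * t - x * y" by (simp add: algebra_simps)
    ultimately show "\<exists>z\<in>S. ereal B < ord (z - x * y)"
      using is_subfieldD(6)[OF S s(1) t(1)] by metis
  qed
  have minus: "- x \<in> val_closure ord S" if "x \<in> val_closure ord S" for x
    using mult[OF sub[of "-1"] that] is_subfieldD[OF S] by simp
  have inv: "inverse x \<in> val_closure ord S" if x: "x \<in> val_closure ord S" for x
  proof (cases "x = 0")
    case False
    then obtain a where a: "ord x = ereal a" by (rule ord_real)
    show ?thesis unfolding val_closure_iff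
    proof
      fix B :: real
      \<comment> \<open>Precision beyond \<open>a\<close> makes ord s equal to ord x; the summand
        \<open>2 * a\<close> compensates the denominator \<open>s * x\<close> in the difference of
        the inverses.\<close>
      obtain s where s: "s \<in> S" "ereal (max a (B + 2 * a)) < ord (s - x)"
        using x unfolding val_closure_iff by meson
      have s1: "ereal a < ord (s - x)" "ereal (B + 2 * a) < ord (s - x)"
        using s(2) by (metis ereal_less_eq(3) max.cobounded1 order_le_less_trans)
          (use s(2) in \<open>metis ereal_less_eq(3) max.cobounded2 order_le_less_trans\<close>)
      have os: "ord s = ereal a" using ord_add_eq[of x "s - x"] a s1 by simp
      have "ereal (B + 2 * a + - (a + a)) < ord ((x - s) * inverse (s * x))"
        by (rule ord_gr_mult_eq[OF _ ord_inverse_eq[OF ord_mult_eq[OF os a]]])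
          (use s1 in \<open>simp add: ord_diff_commute\<close>)
      moreover have "(x - s) * inverse (s * x) = inverse s - inverse x"
        using False os by (subst inverse_diff_inverse) (auto simp: algebra_simps)
      ultimately have "ereal B < ord (inverse s - inverse x)" by simp
      thus "\<exists>z\<in>S. ereal B < ord (z - inverse x)" using is_subfieldD(4)[OF S s(1)] by blast
    qed
  qed (use sub is_subfieldD[OF S] in auto)
  show ?thesis
    unfolding is_subfield_def
    using sub[OF is_subfieldD(1)[OF S]] sub[OF is_subfieldD(2)[OF S]] add mult minus inv by simp
qed

text \<open>
  A polynomial is approximated by polynomials \<open>P n\<close> over the algebraically closed dense subfield,
  and each root of \<open>P n\<close> is moved to a near root of \<open>P (n + 1)\<close>.
\<close>
lemma completion_algebraically_closed:
  fixes p :: "'c poly"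
  assumes S: "is_subfield S"
    and root: "\<And>p. p \<in> polys_over S \<Longrightarrow> Polynomial.degree p > 0 \<Longrightarrow> \<exists>x\<in>S. poly p x = 0"
    and dense: "val_closure ord S = UNIV"
    and complete: "\<And>s. val_Cauchy ord s \<Longrightarrow> \<exists>x. val_tendsto ord s x"
    and p: "Polynomial.degree p > 0"
  shows "\<exists>x. poly p x = 0"
proof -
  define c where "c = Polynomial.lead_coeff p"
  define f where "f = Polynomial.smult (inverse c) p"
  define n where "n = Polynomial.degree p"
  have c: "c \<noteq> 0" using p by (auto simp: c_def)
  have f: "Polynomial.coeff f n = 1" "Polynomial.degree f = n" "n > 0"
    using c p by (auto simp: f_def n_def c_def)
  obtain a where a: "a \<ge> 0" "\<And>i. ereal (- a) \<le> ord (Polynomial.coeff f i)"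
    using poly_ord_lower_bound[of f] by auto
  have "\<exists>y\<in>S. ereal (real m) < ord (y - z)" for m :: nat and z
    using dense val_closure_iff[of z S] by blast
  then obtain app where app: "\<And>m z. app m z \<in> S" "\<And>(m::nat) z. ereal (real m) < ord (app m z - z)"
    by metis
  define P where "P m = Polynomial.monom 1 n + (\<Sum>i<n. Polynomial.monom (app m (Polynomial.coeff f i)) i)" for m
  have P_coeff: "Polynomial.coeff (P m) i =
      (if i = n then 1 else if i < n then app m (Polynomial.coeff f i) else 0)" for m i
    by (auto simp: P_def coeff_sum)
  have P_deg: "Polynomial.degree (P m) = n" for m
    by (intro antisym degree_le le_degree) (auto simp: P_coeff)
  have P_S: "P m \<in> polys_over S" for m
    using app(1) is_subfieldD[OF S] by (auto simp: polys_over_def P_coeff)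
  have P_f: "ereal (real m) \<le> ord (Polynomial.coeff (P m) i - Polynomial.coeff f i)" for m i
    using app(2)[of m "Polynomial.coeff f i"] f coeff_eq_0[of f i]
    by (auto simp: P_coeff intro: less_imp_le)
  \<comment> \<open>The errors have nonnegative order, so one bound serves all \<open>P m\<close>;
    by \<open>root_ord_ge\<close> their roots then lie in one common ball.\<close>
  have P_a: "ereal (- a) \<le> ord (Polynomial.coeff (P m) i)" for m i
  proof -
    have "ereal (- a) \<le> ereal (real m)" using a(1) by simp
    from ord_ge_add[OF order_trans[OF this P_f] a(2), of i i] show ?thesis by simp
  qed
  have root_a: "ereal (- a) \<le> ord x" if "poly (P m) x = 0" for m x
    using root_ord_ge[of "P m" x a] that f a(1) P_a by (simp add: P_deg P_coeff)
  \<comment> \<open>The loss of precision when the coefficientwise estimate is evaluated at a point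
    of order at least -a, for degree at most n.\<close>
  define b where "b = real n * a"
  have P_diff: "ereal (real m - b) \<le> ord (poly (P m) x - poly f x)"
    if "ereal (- a) \<le> ord x" for m x
  proof -
    have "ereal (real m + real n * (- a)) \<le> ord (poly (P m - f) x)"
      using that a(1) P_f f by (intro poly_ord_ge) (auto simp: P_deg intro: degree_diff_le)
    thus ?thesis by (simp add: b_def)
  qed
  have step: "\<exists>y\<in>S. poly (P (Suc m)) y = 0 \<and> ereal ((real m - b) / real n) \<le> ord (y - x)"
    if x: "x \<in> S" "poly (P m) x = 0" for m x
  proof -
    \<comment> \<open>Translation turns roots near \<open>x\<close> into roots near 0. The leading
      coefficient 1 at index \<open>n\<close> against a constant coefficient of order at least m - b
      gives a root of order at least (m - b)/n.\<close>
    define g where "g = pcompose (P (Suc m)) [:x, 1:]"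
    have "ereal (real m - b) \<le> ord (poly (P (Suc m)) x)"
    proof -
      have "ereal (real m - b) \<le> ereal (real (Suc m) - b)" by simp
      hence "ereal (real m - b) \<le> ord (poly (P (Suc m)) x - poly f x)"
        using P_diff[OF root_a[OF x(2)], of "Suc m"] by (rule order_trans)
      moreover have "ereal (real m - b) \<le> ord (poly (P m) x - poly f x)"
        by (rule P_diff[OF root_a[OF x(2)]])
      ultimately have "ereal (real m - b) \<le>
          ord ((poly (P (Suc m)) x - poly f x) - (poly (P m) x - poly f x))"
        by (rule ord_ge_diff)
      thus ?thesis using x(2) by simp
    qed
    moreover have "poly (P (Suc m)) x = Polynomial.coeff g 0"
      by (simp add: g_def poly_pcompose flip: poly_0_coeff_0)
    moreover have "Polynomial.coeff g n = 1"
      using lead_coeff_comp[of "[:x, 1:]" "P (Suc m)"] degree_pcompose[of "P (Suc m)" "[:x, 1:]"]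
      by (simp add: g_def P_deg P_coeff)
    moreover have "g \<in> polys_over S"
      unfolding g_def using P_S x(1) is_subfieldD[OF S] polys_over_0[OF S]
      by (intro polys_over_pcompose S) auto
    ultimately obtain z where z: "z \<in> S" "poly g z = 0" "ereal ((real m - b) / real n) \<le> ord z"
      using small_root[OF S root, of g n 0 "(real m - b) / real n"] f(3)
      by (auto simp: zero_ereal_def)
    have "x + z \<in> S" by (rule is_subfieldD(5)[OF S x(1) z(1)])
    moreover have "poly (P (Suc m)) (x + z) = 0" using z(2) by (simp add: g_def poly_pcompose)
    ultimately show ?thesis using z(3) by (intro bexI[of _ "x + z"]) auto
  qed
  have "\<exists>x0. x0 \<in> S \<and> poly (P 0) x0 = 0" using root[OF P_S, of 0] P_deg f(3) by auto
  then obtain s where s: "\<And>m. s m \<in> S \<and> poly (P m) (s m) = 0"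
    "\<And>m. ereal ((real m - b) / real n) \<le> ord (s (Suc m) - s m)"
    using dependent_nat_choice[of "\<lambda>m x. x \<in> S \<and> poly (P m) x = 0"
        "\<lambda>m x y. ereal ((real m - b) / real n) \<le> ord (y - x)"] step by metis
  have lin: "\<exists>N. \<forall>m\<ge>N. B < (real m - b) / real n" for B :: real
  proof (intro exI allI impI)
    fix m assume "m \<ge> nat \<lceil>B * real n + b\<rceil> + 1"
    hence "real m > B * real n + b" by linarith
    thus "B < (real m - b) / real n" using f(3) by (simp add: field_simps)
  qed
  \<comment> \<open>By the ultrametric inequality, control of consecutive differences suffices for
    the Cauchy property.\<close>
  have far: "ereal B < ord (s m - s N)"
    if N: "\<forall>m\<ge>N. B < (real m - b) / real n" and m: "m \<ge> N" for B N m
    using m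
  proof (induction m rule: dec_induct)
    case (step k)
    have "ereal B < ord (s (Suc k) - s k)"
      using N step.hyps s(2)[of k] by (meson ereal_less(2) less_ereal.simps(1) order_less_le_trans)
    from ord_gr_add[OF this step.IH] show ?case by simp
  qed simp
  have "val_Cauchy ord s"
    unfolding val_Cauchy_def
  proof
    fix B :: real
    obtain N where N: "\<forall>m\<ge>N. B < (real m - b) / real n" using lin by blast
    have "ereal B < ord (s k - s m)" if "k \<ge> N" "m \<ge> N" for k m
      using ord_gr_diff[OF far[OF N that(1)] far[OF N that(2)]] by simp
    thus "\<exists>N. \<forall>m\<ge>N. \<forall>n\<ge>N. ereal B < ord (s m - s n)" by blast
  qed
  then obtain x where x: "val_tendsto ord s x" using complete by blast
  have "poly f x = 0"
  proof (rule poly_limit_root[OF x])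
    fix B :: real
    show "\<exists>N. \<forall>m\<ge>N. ereal B < ord (poly f (s m))"
    proof (intro exI allI impI)
      fix m assume "m \<ge> nat \<lceil>B + b\<rceil> + 1"
      hence "ereal B < ereal (real m - b)" by (simp; linarith)
      also have "\<dots> \<le> ord (poly (P m) (s m) - poly f (s m))"
        using s(1)[of m] by (intro P_diff root_a) auto
      also have "\<dots> = ord (poly f (s m))" using s(1)[of m] by simp
      finally show "ereal B < ord (poly f (s m))" .
    qed
  qed
  thus ?thesis using c by (auto simp: f_def)
qed

end

section \<open>Algebraic closedness of the completed field\<close>

context C_infinity
begin

lemma algebraically_closed:
  fixes p :: "'c poly"
  assumes "Polynomial.degree p > 0"
  shows "\<exists>x. poly p x = 0"
proof -
  obtain k where "k > 0" "q = CHAR('c) ^ k" using q_prime_power by auto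
  hence "is_subfield (Fq q :: 'c set)" using Fq_subfield[OF prime_char] by simp
  hence "is_subfield (algebraic_elements (val_closure ord (rational_functions q \<theta>)))"
    by (intro algebraic_elements_subfield val_closure_subfield rational_functions_subfield)
  from completion_algebraically_closed[OF this alg_closed dense complete assms]
  show ?thesis by blast
qed

lemma small_root_exists:
  fixes p :: "'c poly"
  assumes "i \<ge> 1" "ord (Polynomial.coeff p i) = ereal b" "ereal (b + real i * w) \<le> ord (Polynomial.coeff p 0)"
  shows "\<exists>x. poly p x = 0 \<and> ereal w \<le> ord x"
  using small_root[OF is_subfield_UNIV _ _ assms] algebraically_closed by (auto simp: polys_over_def)

end

section \<open>The ring of convergent power series and its Frobenius\<close>

lemma sum_UNIV_Plus: "(\<Sum>k\<in>UNIV. f k) = (\<Sum>j\<in>UNIV. f (Inl j)) + (\<Sum>j\<in>UNIV. f (Inr j))"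
  for f :: "'a::finite + 'b::finite \<Rightarrow> 'c::comm_monoid_add"
proof -
  have "(\<Sum>k\<in>UNIV. f k) = sum f (range Inl) + sum f (range Inr)"
    unfolding UNIV_sum by (rule sum.union_disjoint) auto
  thus ?thesis by (simp add: sum.reindex)
qed

definition tate :: "('c::field \<Rightarrow> ereal) \<Rightarrow> 'c fps set" where
  "tate ord = {f. (\<lambda>i. ord (fps_nth f i)) \<longlonglongrightarrow> \<infinity>}"

context valuation
begin

lemma tate_iff: "f \<in> tate ord \<longleftrightarrow> (\<forall>B::real. \<exists>N. \<forall>n\<ge>N. ereal B < ord (fps_nth f n))"
  by (simp add: tate_def tendsto_PInfty eventually_sequentially)

lemma tate_bounded:
  assumes "f \<in> tate ord"
  obtains a where "a \<ge> 0" "\<And>i. ereal (- a) \<le> ord (fps_nth f i)"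
proof -
  obtain N where N: "\<And>n. n \<ge> N \<Longrightarrow> ereal 0 < ord (fps_nth f n)"
    using assms unfolding tate_iff by blast
  \<comment> \<open>The finitely many coefficients of possibly negative order are packed into a
    polynomial, whose coefficients have a common bound.\<close>
  define p where "p = (\<Sum>i<N. Polynomial.monom (fps_nth f i) i)"
  obtain a where a: "a \<ge> 0" "\<And>i. ereal (- a) \<le> ord (Polynomial.coeff p i)"
    using poly_ord_lower_bound[of p] by blast
  have "ereal (- a) \<le> ord (fps_nth f i)" for i
  proof (cases "i < N")
    case True
    thus ?thesis using a(2)[of i] by (simp add: p_def coeff_sum)
  next
    case False
    hence "ereal 0 < ord (fps_nth f i)" using N by simp
    moreover have "ereal (- a) \<le> ereal 0" using a(1) by simp
    ultimately show ?thesis by (meson less_imp_le order_trans)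
  qed
  thus thesis by (rule that[OF a(1)])
qed

lemma tate_0: "0 \<in> tate ord" and tate_const: "fps_const c \<in> tate ord"
  and tate_1: "1 \<in> tate ord" and tate_X: "fps_X \<in> tate ord"
  unfolding tate_iff by (auto intro: exI[of _ 2])

lemma tate_add: "f \<in> tate ord \<Longrightarrow> g \<in> tate ord \<Longrightarrow> f + g \<in> tate ord"
  unfolding tate_iff fps_add_nth by (meson ord_gr_add max.boundedE)

lemma tate_uminus: "f \<in> tate ord \<Longrightarrow> - f \<in> tate ord"
  unfolding tate_iff by simp

lemma tate_diff: "f \<in> tate ord \<Longrightarrow> g \<in> tate ord \<Longrightarrow> f - g \<in> tate ord"
  using tate_add[of f "- g"] tate_uminus[of g] by simp

lemma tate_sum: "(\<And>i. i \<in> I \<Longrightarrow> f i \<in> tate ord) \<Longrightarrow> sum f I \<in> tate ord"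
  by (induction I rule: infinite_finite_induct) (auto intro: tate_0 tate_add)

text \<open>In every summand of a late coefficient of the product one factor has a large index,
  hence large order, while the other is uniformly bounded.\<close>

lemma tate_mult:
  assumes f: "f \<in> tate ord" and g: "g \<in> tate ord"
  shows "f * g \<in> tate ord"
  unfolding tate_iff
proof
  fix B :: real
  obtain a where a: "a \<ge> 0" "\<And>i. ereal (- a) \<le> ord (fps_nth f i)" using tate_bounded[OF f] by metis
  obtain b where b: "b \<ge> 0" "\<And>i. ereal (- b) \<le> ord (fps_nth g i)" using tate_bounded[OF g] by metis
  obtain N where N: "\<And>n. n \<ge> N \<Longrightarrow> ereal (B + b) < ord (fps_nth f n)"
    using f unfolding tate_iff by blast
  obtain M where M: "\<And>n. n \<ge> M \<Longrightarrow> ereal (B + a) < ord (fps_nth g n)"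
    using g unfolding tate_iff by blast
  have gr: "ereal B < ord (x * y)" if "ereal (B + c) < ord x" "ereal (- c) \<le> ord y" for x y c
    using that by (cases "ord x"; cases "ord y") (auto simp: ord_mult)
  have "ereal B < ord (fps_nth (f * g) n)" if n: "n \<ge> N + M" for n
    unfolding fps_mult_nth
  proof (rule ord_gr_sum)
    fix i assume "i \<in> {0..n}"
    show "ereal B < ord (fps_nth f i * fps_nth g (n - i))"
    proof (cases "i \<ge> N")
      case True
      thus ?thesis using gr[OF N b(2)] by blast
    next
      case False
      hence "n - i \<ge> M" using n by simp
      thus ?thesis using gr[OF M a(2)] by (simp add: mult.commute)
    qed
  qed simp
  thus "\<exists>N. \<forall>n\<ge>N. ereal B < ord (fps_nth (f * g) n)" by blast
qed

lemma tate_prod: "(\<And>i. i \<in> I \<Longrightarrow> f i \<in> tate ord) \<Longrightarrow> prod f I \<in> tate ord"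
  by (induction I rule: infinite_finite_induct) (auto intro: tate_1 tate_mult)

lemma tate_fps_of_poly: "fps_of_poly p \<in> tate ord"
  unfolding tate_iff
proof
  fix B :: real
  show "\<exists>N. \<forall>n\<ge>N. ereal B < ord (fps_nth (fps_of_poly p) n)"
    by (rule exI[of _ "Suc (Polynomial.degree p)"]) (simp add: coeff_eq_0)
qed

lemma tate_tau_closed:
  assumes "f \<in> tate ord" "q > 0"
  shows "tate_tau q f \<in> tate ord"
  unfolding tate_iff
proof
  fix B :: real
  \<comment> \<open>Positivity is required in addition to \<open>B\<close>: only positive orders do
    not decrease when multiplied by \<open>q\<close>.\<close>
  obtain N where N: "\<And>n. n \<ge> N \<Longrightarrow> ereal (max 0 B) < ord (fps_nth f n)"
    using assms unfolding tate_iff by blast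
  have "ereal B < ord (fps_nth (tate_tau q f) n)" if "n \<ge> N" for n
  proof (cases "fps_nth f n = 0")
    case False
    then obtain r where r: "ord (fps_nth f n) = ereal r" by (rule ord_real)
    have "max 0 B < r" using N[OF that] r by (simp add: max_def split: if_splits)
    hence "0 < r" "B < r" by auto
    moreover have "r \<le> real q * r" using assms(2) \<open>0 < r\<close> by (simp add: mult_le_cancel_right1)
    ultimately have "B < real q * r" by linarith
    thus ?thesis using ord_power_eq[OF r, of q] by (simp add: tate_tau_def)
  qed (use assms in \<open>simp add: tate_tau_def power_0_left\<close>)
  thus "\<exists>N. \<forall>n\<ge>N. ereal B < ord (fps_nth (tate_tau q f) n)" by blast
qed

end

section \<open>The Frobenius on power series and its fixed elements\<close>

context C_infinity
begin

lemma frobenius_add: "((x :: 'c) + y) ^ q = x ^ q + y ^ q"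
proof -
  obtain k where "q = CHAR('c) ^ k" using q_prime_power by auto
  thus ?thesis using freshmans_dream'[of q k x y] prime_char by simp
qed

lemma q_gt_1: "q > 1"
proof -
  obtain k where k: "q = CHAR('c) ^ k" "k > 0" using q_prime_power by auto
  thus ?thesis using one_less_power[OF prime_gt_1_nat[OF prime_char], of k] by simp
qed

lemma frobenius_0 [simp]: "(0 :: 'c) ^ q = 0"
  using q_gt_1 by (simp add: power_0_left)

lemma frobenius_minus: "(- (x :: 'c)) ^ q = - (x ^ q)"
  using frobenius_add[of x "- x"] by (simp add: add_eq_0_iff)

lemma frobenius_diff: "((x :: 'c) - y) ^ q = x ^ q - y ^ q"
  using frobenius_add[of x "- y"] by (simp add: frobenius_minus)

lemma frobenius_sum: "(\<Sum>i\<in>I. f i :: 'c) ^ q = (\<Sum>i\<in>I. f i ^ q)"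
  by (induction I rule: infinite_finite_induct) (auto simp: frobenius_add)

lemma Fq_is_subfield: "is_subfield (Fq q :: 'c set)"
  using Fq_subfield[OF prime_char] q_prime_power by auto

abbreviation frob :: "'c fps \<Rightarrow> 'c fps" where
  "frob \<equiv> tate_tau q"

lemma frob_add: "frob (f + g) = frob f + frob g"
  and frob_diff: "frob (f - g) = frob f - frob g"
  by (simp_all add: tate_tau_def fps_eq_iff frobenius_add frobenius_diff)

lemma frob_const [simp]: "frob (fps_const c) = fps_const (c ^ q)"
  by (simp add: tate_tau_def fps_eq_iff)

lemma frob_0 [simp]: "frob 0 = 0"
  by (simp add: tate_tau_def fps_eq_iff)

lemma frob_1 [simp]: "frob 1 = 1"
  by (simp add: tate_tau_def fps_eq_iff)

lemma frob_X [simp]: "frob fps_X = fps_X"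
  by (simp add: tate_tau_def fps_eq_iff)

lemma frob_mult: "frob (f * g) = frob f * frob g"
  by (simp add: tate_tau_def fps_eq_iff fps_mult_nth frobenius_sum power_mult_distrib)

lemma frob_eq_iff_Fq: "frob f = f \<longleftrightarrow> (\<forall>i. fps_nth f i \<in> Fq q)"
  by (simp add: tate_tau_def fps_eq_iff Fq_def)

lemma frob_fps_of_poly: "p \<in> polys_over (Fq q) \<Longrightarrow> frob (fps_of_poly p) = fps_of_poly p"
  unfolding frob_eq_iff_Fq by (simp add: polys_over_def)

lemma frob_closed: "f \<in> tate ord \<Longrightarrow> frob f \<in> tate ord"
  using q_gt_1 by (intro tate_tau_closed) auto

text \<open>The coefficients lie in F_q, whose nonzero elements have order 0 because q r = r;
  coefficients tending to zero must therefore vanish from some index on.\<close>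

lemma frob_fixed_polynomial:
  assumes "f \<in> tate ord" "frob f = f"
  shows "\<exists>p \<in> polys_over (Fq q). fps_of_poly p = f"
proof -
  obtain N where N: "\<And>n. n \<ge> N \<Longrightarrow> ereal 0 < ord (fps_nth f n)"
    using assms(1) unfolding tate_iff by blast
  have F: "fps_nth f i ^ q = fps_nth f i" for i
    using assms(2) by (simp add: frob_eq_iff_Fq Fq_def)
  have z: "fps_nth f n = 0" if n: "n \<ge> N" for n
  proof (rule ccontr)
    assume "fps_nth f n \<noteq> 0"
    then obtain r where r: "ord (fps_nth f n) = ereal r" by (rule ord_real)
    have "real q * r = r" using ord_power_eq[OF r, of q] F[of n] r by simp
    moreover have "r > 0" using N[OF n] r by simp
    ultimately show False using q_gt_1 by simp
  qed
  define p where "p = (\<Sum>i<N. Polynomial.monom (fps_nth f i) i)"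
  have "Polynomial.coeff p i = fps_nth f i" for i
    using z[of i] by (auto simp: p_def coeff_sum not_less)
  hence "fps_of_poly p = f" "p \<in> polys_over (Fq q)"
    by (auto simp: fps_eq_iff polys_over_def Fq_def F)
  thus ?thesis by blast
qed

text \<open>
  The solution is the Anderson--Thakur function. Multiplication by its square makes determinants of
  four invariant elements Frobenius invariant.
\<close>
lemma exists_eta:
  "\<exists>\<eta> \<in> tate ord. \<eta> \<noteq> 0 \<and> frob \<eta> = (fps_X - fps_const \<theta>) * \<eta>"
proof -
  have "\<theta> \<noteq> 0" using ord_nonzero[of \<theta> "- 1"] ord_theta by (simp add: one_ereal_def)
  \<comment> \<open>The constant term of the functional equation reads
    \<open>x0^q = - \<theta> * x0\<close>; division by \<open>x0\<close> excludes the zero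
    solution.\<close>
  define p0 :: "'c poly" where "p0 = Polynomial.monom 1 (q - 1) + [:\<theta>:]"
  have "Polynomial.degree p0 > 0"
    using q_gt_1 unfolding p0_def by (subst degree_add_eq_left) (auto simp: degree_monom_eq)
  then obtain x0 where x0: "poly p0 x0 = 0" using algebraically_closed by blast
  have x0': "x0 \<noteq> 0" using x0 \<open>\<theta> \<noteq> 0\<close> q_gt_1 by (auto simp: p0_def poly_monom power_0_left)
  have "x0 ^ q = x0 * x0 ^ (q - 1)" using q_gt_1 by (simp flip: power_Suc)
  also have "x0 ^ (q - 1) = - \<theta>" using x0 by (simp add: p0_def poly_monom add_eq_0_iff2)
  finally have x0q: "x0 ^ q = - \<theta> * x0" by simp
  obtain b where b: "ord x0 = ereal b" using x0' by (rule ord_real)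
  have "\<exists>s. \<forall>n. (ereal (b + real n) \<le> ord (s n) \<and> (n = 0 \<longrightarrow> s n = x0)) \<and>
      s (Suc n) ^ q + \<theta> * s (Suc n) = s n"
  proof (rule dependent_nat_choice)
    show "\<exists>x. ereal (b + real 0) \<le> ord x \<and> (0 = 0 \<longrightarrow> x = x0)" using b by auto
  next
    fix x n assume "ereal (b + real n) \<le> ord x \<and> (n = 0 \<longrightarrow> x = x0)"
    \<comment> \<open>Comparison of the coefficients of T^(n+1). Since the linear coefficient
      \<open>\<theta>\<close> has order -1, a root of order one larger than the bound for
      \<open>x\<close> exists.\<close>
    define p :: "'c poly" where "p = Polynomial.monom 1 q + [:- x, \<theta>:]"
    have "ord (Polynomial.coeff p 1) = ereal (- 1)" "Polynomial.coeff p 0 = - x"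
      using q_gt_1 ord_theta by (simp_all add: p_def one_ereal_def)
    then obtain y where y: "poly p y = 0" "ereal (b + real (Suc n)) \<le> ord y"
      using small_root_exists[of 1 p "- 1" "b + real (Suc n)"] \<open>_ \<and> _\<close> by auto
    have "y ^ q + \<theta> * y = x" using y(1) by (simp add: p_def poly_monom algebra_simps)
    thus "\<exists>y. (ereal (b + real (Suc n)) \<le> ord y \<and> (Suc n = 0 \<longrightarrow> y = x0)) \<and> y ^ q + \<theta> * y = x"
      using y(2) by auto
  qed
  then obtain s where s: "\<And>n. ereal (b + real n) \<le> ord (s n)" "s 0 = x0"
    "\<And>n. s (Suc n) ^ q + \<theta> * s (Suc n) = s n" by auto
  have "Abs_fps s \<in> tate ord"
    unfolding tate_iff
  proof (intro allI exI impI)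
    fix B :: real and n assume "n \<ge> nat \<lceil>B - b\<rceil> + 1"
    hence "ereal B < ereal (b + real n)" by (simp; linarith)
    also note s(1)[of n]
    finally show "ereal B < ord (fps_nth (Abs_fps s) n)" by simp
  qed
  moreover have "Abs_fps s \<noteq> 0"
    using x0' s(2) by (auto simp: fps_eq_iff dest: spec[of _ 0])
  moreover have "frob (Abs_fps s) = (fps_X - fps_const \<theta>) * Abs_fps s"
  proof (rule fps_ext)
    fix n
    show "fps_nth (frob (Abs_fps s)) n = fps_nth ((fps_X - fps_const \<theta>) * Abs_fps s) n"
    proof (cases n)
      case 0
      thus ?thesis using x0q s(2) by (simp add: tate_tau_def left_diff_distrib)
    next
      case (Suc m)
      thus ?thesis using s(3)[of m] by (simp add: tate_tau_def left_diff_distrib algebra_simps)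
    qed
  qed
  ultimately show ?thesis by blast
qed

end

section \<open>Determinants\<close>

text \<open>Serves three homomorphisms: the Frobenius, the constant term and the embedding into
  Laurent series.\<close>

lemma det_hom:
  fixes A :: "'a::comm_ring_1^'n^'n" and h :: "'a \<Rightarrow> 'b::comm_ring_1"
  assumes add: "\<And>x y. h (x + y) = h x + h y" and mult: "\<And>x y. h (x * y) = h x * h y"
    and one: "h 1 = 1"
  shows "det (\<chi> i j. h (A $ i $ j)) = h (det A)"
proof -
  have zero: "h 0 = 0" using add[of 0 0] by simp
  have minus: "h (- x) = - h x" for x using add[of x "- x"] zero by (simp add: add_eq_0_iff)
  have sum: "h (sum f I) = (\<Sum>i\<in>I. h (f i))" for f :: "'c \<Rightarrow> 'a" and I
    by (induction I rule: infinite_finite_induct) (auto simp: add zero)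
  have prod: "h (prod f I) = (\<Prod>i\<in>I. h (f i))" for f :: "'c \<Rightarrow> 'a" and I
    by (induction I rule: infinite_finite_induct) (auto simp: mult one)
  have sign: "h (of_int (sign p)) = of_int (sign p)" for p :: "'n \<Rightarrow> 'n"
    by (auto simp: sign_def one minus)
  show ?thesis by (simp add: det_def sum mult prod sign)
qed

definition replace_row :: "'a^'m^'n \<Rightarrow> 'n \<Rightarrow> 'a^'m \<Rightarrow> 'a^'m^'n" where
  "replace_row A k x = (\<chi> i. if i = k then x else A $ i)"

lemma det_replace_row_add:
  fixes A :: "'a::comm_ring_1^'n^'n"
  shows "det (replace_row A k (x + y)) = det (replace_row A k x) + det (replace_row A k y)"
  unfolding replace_row_def using det_row_add[of k "\<lambda>_. x" "\<lambda>_. y" "\<lambda>i. A $ i"] by simp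

lemma det_replace_row_scale:
  fixes A :: "'a::comm_ring_1^'n^'n"
  shows "det (replace_row A k (c *s x)) = c * det (replace_row A k x)"
  unfolding replace_row_def using det_row_mul[of k c "\<lambda>_. x" "\<lambda>i. A $ i"] by simp

lemma det_replace_row_self:
  fixes A :: "'a::comm_ring_1^'n^'n"
  shows "det (replace_row A k (A $ i)) = (if i = k then det A else 0)"
proof (cases "i = k")
  case True
  hence "replace_row A k (A $ i) = A" by (simp add: replace_row_def vec_eq_iff)
  thus ?thesis using True by simp
next
  case False
  thus ?thesis
    using det_identical_rows[of i k "replace_row A k (A $ i)"]
    by (simp add: row_def replace_row_def)
qed

text \<open>By multilinearity only the k-th summand survives, as any other repeats a row. This is
  used to reduce Cramer numerators modulo \<open>det A\<close>, and with x = 0 to prove linear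
  independence.\<close>

lemma det_replace_row_diff_sum:
  fixes A :: "'a::comm_ring_1^'n^'n"
  shows "det (replace_row A k (x - (\<Sum>i\<in>UNIV. c i *s A $ i))) = det (replace_row A k x) - c k * det A"
proof -
  let ?D = "\<lambda>x. det (replace_row A k x)"
  have "?D 0 = 0" using det_replace_row_add[of A k 0 0] by simp
  hence "?D (\<Sum>i\<in>I. c i *s A $ i) = (\<Sum>i\<in>I. c i * ?D (A $ i))" for I
    by (induction I rule: infinite_finite_induct)
      (auto simp: det_replace_row_add det_replace_row_scale)
  hence s: "?D (\<Sum>i\<in>UNIV. c i *s A $ i) = c k * det A"
    by (simp add: det_replace_row_self if_distrib sum.delta cong: if_cong)
  have "?D x = ?D (x - (\<Sum>i\<in>UNIV. c i *s A $ i)) + ?D (\<Sum>i\<in>UNIV. c i *s A $ i)"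
    by (simp flip: det_replace_row_add)
  thus ?thesis using s by simp
qed

text \<open>Power series do not form a field, so the linear system is solved over Laurent series;
  multiplied by \<open>det A\<close>, the identity descends because the embedding is
  injective.\<close>

lemma cramer_rows:
  fixes A :: "'a::field fps^'n^'n"
  assumes "det A \<noteq> 0"
  shows "det A *s x = (\<Sum>i\<in>UNIV. det (replace_row A i x) *s A $ i)"
proof -
  let ?h = "fps_to_fls :: 'a fps \<Rightarrow> 'a fls"
  define B where "B = (\<chi> i j. ?h (A $ i $ j))"
  define y where "y = (\<chi> j. ?h (x $ j))"
  have detB: "det B = ?h (det A)"
    unfolding B_def by (rule det_hom) (simp_all add: fls_times_fps_to_fls)
  hence nz: "det B \<noteq> 0" using assms by simp
  hence "det (transpose B) \<noteq> 0" by simp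
  from cramer[OF this] obtain c where "transpose B *v c = y" by blast
  hence y: "y = (\<Sum>i\<in>UNIV. c $ i *s row i B)"
    by (simp add: matrix_mult_sum column_transpose)
  have c: "?h (det (replace_row A k x)) = c $ k * det B" for k
  proof -
    have "?h (det (replace_row A k x)) = det (\<chi> i j. ?h (replace_row A k x $ i $ j))"
      by (rule det_hom[symmetric]) (simp_all add: fls_times_fps_to_fls)
    also have "(\<chi> i j. ?h (replace_row A k x $ i $ j)) = (\<chi> i. if i = k then y else row i B)"
      by (simp add: vec_eq_iff replace_row_def y_def B_def row_def)
    also have "det \<dots> = c $ k * det B" unfolding y by (rule cramer_lemma_transpose)
    finally show ?thesis .
  qed
  have "?h (det A * x $ j) = ?h (\<Sum>i\<in>UNIV. det (replace_row A i x) * A $ i $ j)" for j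
  proof -
    have hsum: "?h (sum f I) = (\<Sum>i\<in>I. ?h (f i))" for f :: "'n \<Rightarrow> _" and I
      by (induction I rule: infinite_finite_induct) auto
    have "?h (det A * x $ j) = det B * y $ j" by (simp add: fls_times_fps_to_fls detB y_def)
    also have "\<dots> = (\<Sum>i\<in>UNIV. (c $ i * det B) * ?h (A $ i $ j))"
      by (simp add: y row_def B_def sum_distrib_left mult_ac)
    also have "\<dots> = ?h (\<Sum>i\<in>UNIV. det (replace_row A i x) * A $ i $ j)"
      by (simp add: hsum fls_times_fps_to_fls c)
    finally show ?thesis .
  qed
  thus ?thesis by (simp add: vec_eq_iff)
qed

text \<open>The point is that quotient and remainder keep their coefficients in the subfield. The
  induction follows Horner's scheme: the remainder is multiplied by the variable, and at most one
  multiple of \<open>d\<close> is subtracted.\<close>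

lemma polys_over_division:
  fixes p d :: "'a::field poly"
  assumes S: "is_subfield S" and d: "d \<in> polys_over S" "d \<noteq> 0"
  shows "p \<in> polys_over S \<Longrightarrow> \<exists>s\<in>polys_over S. \<exists>r\<in>polys_over S.
    p = s * d + r \<and> (r = 0 \<or> Polynomial.degree r < Polynomial.degree d)"
proof (induction p)
  case 0
  thus ?case using polys_over_0[OF S] by (intro bexI[of _ 0]) auto
next
  case (pCons a p)
  then obtain s r where sr: "s \<in> polys_over S" "r \<in> polys_over S" "p = s * d + r"
    "r = 0 \<or> Polynomial.degree r < Polynomial.degree d" by auto
  define n where "n = Polynomial.degree d"
  define t where "t = pCons a r"
  define c where "c = Polynomial.coeff t n / Polynomial.lead_coeff d"
  have t: "t \<in> polys_over S" "Polynomial.degree t \<le> n"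
    using sr(2,4) pCons.prems by (auto simp: t_def n_def)
  have c: "c \<in> S"
    using t(1) d(1) is_subfieldD[OF S] by (auto simp: c_def polys_over_def divide_inverse)
  define r' where "r' = t - Polynomial.smult c d"
  have r': "r' \<in> polys_over S"
    using t(1) d(1) c polys_over_mult[OF S _ d(1), of "[:c:]"] polys_over_0[OF S]
    by (auto simp: r'_def intro!: polys_over_diff S)
  have "Polynomial.degree r' \<le> n" "Polynomial.coeff r' n = 0"
    using t(2) d(2) by (auto simp: r'_def c_def n_def intro!: degree_diff_le)
  hence "r' = 0 \<or> Polynomial.degree r' < n"
    by (metis le_neq_implies_less leading_coeff_0_iff)
  moreover have "pCons a p = (pCons c s) * d + r'"
    by (simp add: r'_def t_def sr(3) algebra_simps)
  moreover have "pCons c s \<in> polys_over S" using c sr(1) by simp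
  ultimately show ?case using r' unfolding n_def by blast
qed

section \<open>The module of invariants\<close>

context C_infinity
begin

text \<open>
  \<open>Inl j\<close> and \<open>Inr j\<close> index the coordinates at the \<open>\<complex>\<^sub>\<infinity>[T]\<close>-basis elements \<open>e\<^sub>j\<close> and \<open>\<tau> e\<^sub>j\<close>
  of the motive.
\<close>
definition sigma_matrix :: "'c^2^2 \<Rightarrow> 'c fps^(2 + 2)^(2 + 2)" where
  "sigma_matrix A = (\<chi> k l. case k of
      Inl j \<Rightarrow> (case l of Inl i \<Rightarrow> 0 | Inr i \<Rightarrow> if i = j then fps_X - fps_const \<theta> else 0)
    | Inr j \<Rightarrow> (case l of Inl i \<Rightarrow> if i = j then 1 else 0 | Inr i \<Rightarrow> - fps_const (A $ i $ j)))"

text \<open>The semilinear action of \<open>\<tau>\<close> in coordinates. The columns of the matrix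
  come from \<open>\<tau>(e_j) = \<tau> e_j\<close> and, solving the relation for
  \<open>T e_j\<close>, from \<open>\<tau>(\<tau> e_j) = (T - \<theta>) e_j - (\<Sum>k. A_jk \<tau>
  e_k)\<close>.\<close>

definition sigma :: "'c^2^2 \<Rightarrow> 'c fps^(2 + 2) \<Rightarrow> 'c fps^(2 + 2)" where
  "sigma A x = sigma_matrix A *v (\<chi> k. frob (x $ k))"

definition invariants :: "'c^2^2 \<Rightarrow> ('c fps^(2 + 2)) set" where
  "invariants A = {x. (\<forall>k. x $ k \<in> tate ord) \<and> sigma A x = x}"

lemma sigma_nth:
  "sigma A x $ Inl j = (fps_X - fps_const \<theta>) * frob (x $ Inr j)"
  "sigma A x $ Inr j = frob (x $ Inl j) - (\<Sum>i\<in>UNIV. fps_const (A $ i $ j) * frob (x $ Inr i))"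
  by (simp_all add: sigma_def matrix_vector_mult_def sigma_matrix_def sum_UNIV_Plus
      if_distrib[of "\<lambda>x. x * _"] sum.delta sum_negf cong: if_cong del: fps_const_neg)

lemma sigma_add: "sigma A (x + y) = sigma A x + sigma A y"
proof -
  have "(\<chi> k. frob ((x + y) $ k)) = (\<chi> k. frob (x $ k)) + (\<chi> k. frob (y $ k))"
    by (simp add: vec_eq_iff frob_add)
  thus ?thesis by (simp add: sigma_def matrix_vector_right_distrib)
qed

lemma sigma_scale: "sigma A (f *s x) = frob f *s sigma A x"
proof -
  have "(\<chi> k. frob ((f *s x) $ k)) = frob f *s (\<chi> k. frob (x $ k))"
    by (simp add: vec_eq_iff frob_mult)
  thus ?thesis
    by (simp add: sigma_def matrix_vector_mult_def vec_eq_iff sum_distrib_left mult_ac)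
qed

lemma sigma_0 [simp]: "sigma A 0 = 0"
  using sigma_add[of A 0 0] by simp

lemma sigma_closed:
  fixes x :: "'c fps^(2 + 2)"
  assumes "\<And>k. x $ k \<in> tate ord"
  shows "sigma A x $ k \<in> tate ord"
proof (cases k)
  case (Inl j)
  thus ?thesis using assms
    by (auto simp: sigma_nth intro!: tate_mult tate_diff tate_X tate_const frob_closed)
next
  case (Inr j)
  thus ?thesis using assms
    by (auto simp: sigma_nth intro!: tate_mult tate_diff tate_const tate_sum frob_closed)
qed

text \<open>The upper left 2 by 2 block vanishes, so \<open>A\<close> drops out; interchanging two
  blocks of size two is an even permutation, hence no sign.\<close>

lemma det_sigma_matrix: "det (sigma_matrix A) = (fps_X - fps_const \<theta>)\<^sup>2"
proof -
  have U: "UNIV = {Inl 1, Inl 2, Inr 1, Inr 2 :: 2 + 2}"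
    using exhaust_2 by (auto simp: UNIV_sum UNIV_2)
  have f: "finite {Inl 2, Inr 1, Inr 2 :: 2 + 2}" "Inl 1 \<notin> {Inl 2, Inr 1, Inr 2 :: 2 + 2}"
    "finite {Inr 1, Inr 2 :: 2 + 2}" "Inl 2 \<notin> {Inr 1, Inr 2 :: 2 + 2}"
    "finite {Inr 2 :: 2 + 2}" "Inr 1 \<notin> {Inr 2 :: 2 + 2}"
    by auto
  show ?thesis
    unfolding det_def U
    unfolding sum_over_permutations_insert[OF f(1,2)] sum_over_permutations_insert[OF f(3,4)]
      sum_over_permutations_insert[OF f(5,6)]
    unfolding permutes_sing
    by (simp add: sign_swap_id permutation_swap_id permutation_compose sign_compose sign_id
        swap_id_eq sigma_matrix_def power2_eq_square Transposition.transpose_def)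
qed

lemma invariants_0: "0 \<in> invariants A"
  by (simp add: invariants_def tate_0)

lemma invariants_add: "x \<in> invariants A \<Longrightarrow> y \<in> invariants A \<Longrightarrow> x + y \<in> invariants A"
  by (auto simp: invariants_def sigma_add intro: tate_add)

lemma invariants_scale:
  "p \<in> polys_over (Fq q) \<Longrightarrow> x \<in> invariants A \<Longrightarrow> fps_of_poly p *s x \<in> invariants A"
  by (auto simp: invariants_def sigma_scale frob_fps_of_poly intro: tate_mult tate_fps_of_poly)

lemma invariants_uminus: "x \<in> invariants A \<Longrightarrow> - x \<in> invariants A"
proof -
  assume "x \<in> invariants A"
  moreover have "[:- 1:] \<in> polys_over (Fq q :: 'c set)"
    using is_subfieldD[OF Fq_is_subfield] polys_over_0[OF Fq_is_subfield] by simp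
  ultimately have "fps_of_poly [:- 1:] *s x \<in> invariants A" by (intro invariants_scale)
  moreover have "fps_of_poly [:- 1:] *s x = - x"
    by (simp add: vec_eq_iff fps_of_poly_pCons del: fps_const_neg) (simp flip: fps_const_neg)
  ultimately show ?thesis by simp
qed

lemma invariants_sum: "(\<And>i. i \<in> I \<Longrightarrow> f i \<in> invariants A) \<Longrightarrow> sum f I \<in> invariants A"
  by (induction I rule: infinite_finite_induct) (auto intro: invariants_0 invariants_add)

text \<open>Invariance of all rows says that the matrix is its entrywise Frobenius twist times the
  transposed matrix of \<open>sigma\<close>; then determinants are taken.\<close>

lemma det_invariants:
  fixes \<Psi> :: "'c fps^(2 + 2)^(2 + 2)"
  assumes "\<And>i. \<Psi> $ i \<in> invariants A"
  shows "det \<Psi> = frob (det \<Psi>) * (fps_X - fps_const \<theta>)\<^sup>2"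
proof -
  have "\<Psi> = (\<chi> i j. frob (\<Psi> $ i $ j)) ** Finite_Cartesian_Product.transpose (sigma_matrix A)"
  proof -
    have "((\<chi> i j. frob (\<Psi> $ i $ j)) ** Finite_Cartesian_Product.transpose (sigma_matrix A)) $ i $ j =
        sigma A (\<Psi> $ i) $ j" for i j
      by (simp add: matrix_matrix_mult_def sigma_def matrix_vector_mult_def
          Finite_Cartesian_Product.transpose_def mult.commute)
    moreover have "sigma A (\<Psi> $ i) = \<Psi> $ i" for i using assms by (simp add: invariants_def)
    ultimately show ?thesis by (simp add: vec_eq_iff)
  qed
  hence "det \<Psi> = det (\<chi> i j. frob (\<Psi> $ i $ j)) * det (sigma_matrix A)"
    by (metis det_mul det_transpose)
  also have "det (\<chi> i j. frob (\<Psi> $ i $ j)) = frob (det \<Psi>)"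
    by (rule det_hom) (simp_all add: frob_add frob_mult)
  finally show ?thesis by (simp add: det_sigma_matrix)
qed

text \<open>
  Multiplied by \<open>\<eta>\<^sup>2\<close>, the determinant of four invariant elements becomes a polynomial over \<open>F\<^sub>q\<close>.
  Four elements for which this polynomial is nonzero and of least degree form a basis: by Cramer's
  rule, an element outside their span would allow a division with remainder that lowers the degree.
\<close>
lemma invariants_basis:
  fixes \<Psi>0 :: "'c fps^(2 + 2)^(2 + 2)"
  assumes \<Psi>0: "\<And>i. \<Psi>0 $ i \<in> invariants A" "det \<Psi>0 \<noteq> 0"
  shows "\<exists>\<Psi>. (\<forall>i. \<Psi> $ i \<in> invariants A) \<and> det \<Psi> \<noteq> 0 \<and>
    (\<forall>x\<in>invariants A. \<exists>c. (\<forall>i. c i \<in> polys_over (Fq q)) \<and>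
       x = (\<Sum>i\<in>UNIV. fps_of_poly (c i) *s \<Psi> $ i))"
proof -
  obtain \<eta> where \<eta>: "\<eta> \<in> tate ord" "\<eta> \<noteq> 0" "frob \<eta> = (fps_X - fps_const \<theta>) * \<eta>"
    using exists_eta by blast
  define Inv where "Inv = (\<lambda>\<Psi> :: 'c fps^(2 + 2)^(2 + 2). \<forall>i. \<Psi> $ i \<in> invariants A)"
  have "\<exists>p\<in>polys_over (Fq q). fps_of_poly p = \<eta>\<^sup>2 * det \<Psi>" if "Inv \<Psi>" for \<Psi>
  proof (rule frob_fixed_polynomial)
    have "\<Psi> $ i $ j \<in> tate ord" for i j using that by (auto simp: Inv_def invariants_def)
    hence "det \<Psi> \<in> tate ord"
      unfolding det_def by (intro tate_sum tate_mult tate_prod)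
        (auto simp: sign_def intro: tate_1 tate_uminus)
    thus "\<eta>\<^sup>2 * det \<Psi> \<in> tate ord" by (auto simp: power2_eq_square intro: tate_mult \<eta>)
    have "frob (\<eta>\<^sup>2 * det \<Psi>) = \<eta>\<^sup>2 * (frob (det \<Psi>) * (fps_X - fps_const \<theta>)\<^sup>2)"
      by (simp add: frob_mult power2_eq_square \<eta>(3) mult_ac)
    also have "frob (det \<Psi>) * (fps_X - fps_const \<theta>)\<^sup>2 = det \<Psi>"
      using det_invariants[of \<Psi> A] that by (simp add: Inv_def)
    finally show "frob (\<eta>\<^sup>2 * det \<Psi>) = \<eta>\<^sup>2 * det \<Psi>" .
  qed
  then obtain P where P: "\<And>\<Psi>. Inv \<Psi> \<Longrightarrow> P \<Psi> \<in> polys_over (Fq q)"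
    "\<And>\<Psi>. Inv \<Psi> \<Longrightarrow> fps_of_poly (P \<Psi>) = \<eta>\<^sup>2 * det \<Psi>" by metis
  obtain \<Psi> where \<Psi>: "Inv \<Psi>" "det \<Psi> \<noteq> 0" and
    least: "\<And>\<Phi>. Inv \<Phi> \<Longrightarrow> det \<Phi> \<noteq> 0 \<Longrightarrow> Polynomial.degree (P \<Psi>) \<le> Polynomial.degree (P \<Phi>)"
    using ex_has_least_nat[of "\<lambda>\<Psi>. Inv \<Psi> \<and> det \<Psi> \<noteq> 0" \<Psi>0 "\<lambda>\<Psi>. Polynomial.degree (P \<Psi>)"] \<Psi>0
    by (auto simp: Inv_def)
  have P0: "P \<Psi> \<noteq> 0" using P(2)[OF \<Psi>(1)] \<Psi>(2) \<eta>(2) by auto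
  have repl: "Inv (replace_row \<Psi> k x)" if "x \<in> invariants A" for k x
    using \<Psi>(1) that by (auto simp: Inv_def replace_row_def)
  have "\<exists>c. (\<forall>i. c i \<in> polys_over (Fq q)) \<and> x = (\<Sum>i\<in>UNIV. fps_of_poly (c i) *s \<Psi> $ i)"
    if x: "x \<in> invariants A" for x
  proof -
    have "\<exists>s r. s \<in> polys_over (Fq q) \<and> P (replace_row \<Psi> k x) = s * P \<Psi> + r \<and>
        (r = 0 \<or> Polynomial.degree r < Polynomial.degree (P \<Psi>))" for k
      using polys_over_division[OF Fq_is_subfield P(1)[OF \<Psi>(1)] P0 P(1)[OF repl[OF x]]] by metis
    then obtain s r where s: "\<And>k. s k \<in> polys_over (Fq q)"
      and sr: "\<And>k. P (replace_row \<Psi> k x) = s k * P \<Psi> + r k"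
      and r: "\<And>k. r k = 0 \<or> Polynomial.degree (r k) < Polynomial.degree (P \<Psi>)" by metis
    define y where "y = x - (\<Sum>i\<in>UNIV. fps_of_poly (s i) *s \<Psi> $ i)"
    have y: "y \<in> invariants A"
    proof -
      have "- (\<Sum>i\<in>UNIV. fps_of_poly (s i) *s \<Psi> $ i) \<in> invariants A"
        using \<Psi>(1) s by (intro invariants_uminus invariants_sum invariants_scale) (auto simp: Inv_def)
      from invariants_add[OF x this] show ?thesis by (simp add: y_def)
    qed
    \<comment> \<open>Passing from \<open>x\<close> to \<open>y\<close> changes the k-th Cramer
      numerator by \<open>s k * P \<Psi>\<close> only, so exactly the remainder is left; minimality
      of the degree then forces it to vanish.\<close>
    have Pr: "P (replace_row \<Psi> k y) = r k" for k
    proof -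
      have "fps_of_poly (P (replace_row \<Psi> k y)) =
          \<eta>\<^sup>2 * det (replace_row \<Psi> k x) - fps_of_poly (s k) * (\<eta>\<^sup>2 * det \<Psi>)"
        unfolding P(2)[OF repl[OF y]] unfolding y_def det_replace_row_diff_sum
        by (simp add: algebra_simps)
      also have "\<dots> = fps_of_poly (P (replace_row \<Psi> k x) - s k * P \<Psi>)"
        by (simp add: fps_of_poly_diff fps_of_poly_mult P(2)[OF repl[OF x]] P(2)[OF \<Psi>(1)])
      finally show ?thesis by (simp add: sr)
    qed
    have "det (replace_row \<Psi> k y) = 0" for k
    proof (rule ccontr)
      assume nz: "det (replace_row \<Psi> k y) \<noteq> 0"
      hence "r k \<noteq> 0" using P(2)[OF repl[OF y], of k] Pr[of k] \<eta>(2) by auto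
      thus False using r[of k] least[OF repl[OF y] nz] Pr[of k] by simp
    qed
    hence "det \<Psi> *s y = 0" using cramer_rows[OF \<Psi>(2), of y] by simp
    hence "y = 0" using \<Psi>(2) by (simp add: vec_eq_iff)
    thus ?thesis using s by (intro exI[of _ s]) (simp add: y_def)
  qed
  thus ?thesis using \<Psi> by (auto simp: Inv_def)
qed

end

section \<open>Independence of invariants by way of their constant terms\<close>

context C_infinity
begin

lemma card_Fq: "finite (Fq q :: 'c set)" "card (Fq q :: 'c set) \<le> q"
proof -
  define p :: "'c poly" where "p = Polynomial.monom 1 q - [:0, 1:]"
  have "Polynomial.coeff p q = 1" using q_gt_1 by (simp add: p_def coeff_pCons split: nat.splits)
  hence p: "p \<noteq> 0" by auto
  have deg: "Polynomial.degree p \<le> q"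
    using q_gt_1 unfolding p_def by (intro degree_diff_le) (auto simp: degree_monom_le)
  have eq: "(Fq q :: 'c set) = {x. poly p x = 0}" by (auto simp: Fq_def p_def poly_monom)
  show "finite (Fq q :: 'c set)" unfolding eq by (rule poly_roots_finite[OF p])
  show "card (Fq q :: 'c set) \<le> q"
    unfolding eq using card_poly_roots_bound[OF p] deg by simp
qed

definition constant_terms :: "'c fps^(2 + 2) \<Rightarrow> 'c^(2 + 2)" where
  "constant_terms x = (\<chi> k. fps_nth (x $ k) 0)"

text \<open>The reduction of \<open>sigma\<close> modulo T, in which \<open>T - \<theta>\<close>
  becomes \<open>- \<theta>\<close>.\<close>

definition sigma0 :: "'c^2^2 \<Rightarrow> 'c^(2 + 2) \<Rightarrow> 'c^(2 + 2)" where
  "sigma0 A w = (\<chi> k. case k of Inl j \<Rightarrow> - \<theta> * (w $ Inr j) ^ q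
     | Inr j \<Rightarrow> (w $ Inl j) ^ q - (\<Sum>i\<in>UNIV. A $ i $ j * (w $ Inr i) ^ q))"

lemma sigma0_add: "sigma0 A (w + z) = sigma0 A w + sigma0 A z"
  by (simp add: sigma0_def vec_eq_iff frobenius_add algebra_simps sum.distrib split: sum.splits)

lemma sigma0_scale: "sigma0 A (c *s w) = c ^ q *s sigma0 A w"
  by (simp add: sigma0_def vec_eq_iff power_mult_distrib algebra_simps sum_distrib_left split: sum.splits)

lemma sigma0_sum: "sigma0 A (sum f I) = (\<Sum>i\<in>I. sigma0 A (f i))"
proof (induction I rule: infinite_finite_induct)
  case empty
  show ?case using sigma0_add[of A 0 0] by simp
qed (use sigma0_add[of A 0 0] in \<open>simp_all add: sigma0_add\<close>)

lemma sigma0_constant_terms: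
  assumes "x \<in> invariants A"
  shows "sigma0 A (constant_terms x) = constant_terms x"
proof -
  have "sigma0 A (constant_terms x) $ k = constant_terms (sigma A x) $ k" for k
    by (cases k) (simp_all add: sigma0_def constant_terms_def sigma_nth tate_tau_def fps_sum_nth)
  hence "sigma0 A (constant_terms x) = constant_terms (sigma A x)" by (simp add: vec_eq_iff)
  thus ?thesis using assms by (simp add: invariants_def)
qed

text \<open>
  Coefficients of vectors fixed by \<open>sigma0\<close> with respect to linearly independent fixed vectors lie
  in \<open>F\<^sub>q\<close>, so more than \<open>q\<^sup>3\<close> such vectors span a space of dimension four.
\<close>
lemma independent_invariants:
  assumes W: "W \<subseteq> constant_terms ` invariants A" "finite W" "card W > q ^ 3"
  shows "\<exists>\<Psi> :: 'c fps^(2 + 2)^(2 + 2). (\<forall>i. \<Psi> $ i \<in> invariants A) \<and> det \<Psi> \<noteq> 0"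
proof -
  obtain B where B: "B \<subseteq> W" "vec.independent B" "W \<subseteq> vec.span B"
    by (rule vec.maximal_independent_subset)
  have finB: "finite B" using B(1) W(2) by (rule finite_subset)
  have fixed: "sigma0 A w = w" if "w \<in> W" for w
    using W(1) that sigma0_constant_terms by auto
  \<comment> \<open>Applying \<open>sigma0\<close> to w = sum of c_b b, with \<open>w\<close> and
    all \<open>b\<close> fixed, raises the coefficients to the power \<open>q\<close>; independence
    gives c_b^q = c_b. Hence \<open>W\<close> has at most q^(card B) elements.\<close>
  have "W \<subseteq> (\<lambda>c. \<Sum>b\<in>B. c b *s b) ` (B \<rightarrow>\<^sub>E Fq q)"
  proof
    fix w assume w: "w \<in> W"
    then obtain c where c: "w = (\<Sum>b\<in>B. c b *s b)"
      using B(3) vec.span_finite[OF finB] by auto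
    have "sigma0 A w = (\<Sum>b\<in>B. c b ^ q *s b)"
      using B(1) fixed by (auto simp: c sigma0_sum sigma0_scale intro!: sum.cong)
    hence "(\<Sum>b\<in>B. (c b ^ q - c b) *s b) = 0"
      using fixed[OF w] c by (simp add: vec.scale_left_diff_distrib sum_subtractf)
    hence cq: "c b ^ q = c b" if "b \<in> B" for b
      using vec.independentD[OF B(2) finB order_refl, of "\<lambda>b. c b ^ q - c b"] that by auto
    have "w = (\<Sum>b\<in>B. restrict c B b *s b)" unfolding c by (rule sum.cong) auto
    moreover have "restrict c B \<in> B \<rightarrow>\<^sub>E Fq q" using cq by (auto simp: Fq_def)
    ultimately show "w \<in> (\<lambda>c. \<Sum>b\<in>B. c b *s b) ` (B \<rightarrow>\<^sub>E Fq q)" by blast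
  qed
  hence "card W \<le> card (B \<rightarrow>\<^sub>E (Fq q :: 'c set))"
    using finB card_Fq(1) by (intro surj_card_le finite_PiE) auto
  also have "\<dots> = card (Fq q :: 'c set) ^ card B" using finB by (simp add: card_PiE)
  also have "\<dots> \<le> q ^ card B" by (intro power_mono card_Fq) simp
  finally have "q ^ 3 < q ^ card B" using W(3) by simp
  hence "card B > 3" using q_gt_1 by simp
  moreover have "card B \<le> CARD(2 + 2)"
    using vec.independent_card_le_dim[of B UNIV] B(2) by (simp add: vec.dim_UNIV card_cart_basis)
  ultimately have "card B = CARD(2 + 2)" by simp
  then obtain h where h: "bij_betw h (UNIV :: (2 + 2) set) B"
    using finite_same_card_bij[OF finite finB] by metis
  have "\<exists>x\<in>invariants A. constant_terms x = h i" for i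
  proof -
    have "h i \<in> B" using h by (auto simp: bij_betw_def)
    thus ?thesis using B(1) W(1) by fastforce
  qed
  then obtain f where f: "\<And>i. f i \<in> invariants A" "\<And>i. constant_terms (f i) = h i" by metis
  define \<Psi> where "\<Psi> = (\<chi> i. f i)"
  define M where "M = (\<chi> i j. fps_nth (\<Psi> $ i $ j) 0)"
  have row: "row i M = h i" for i
    using f(2)[of i] by (simp add: row_def M_def \<Psi>_def constant_terms_def vec_eq_iff)
  have "c i = 0" if c: "(\<Sum>i\<in>UNIV. c i *s row i M) = 0" for c i
  proof -
    have "(\<Sum>i\<in>UNIV. c i *s row i M) = (\<Sum>b\<in>B. c (inv_into UNIV h b) *s b)"
    proof -
      have "(\<Sum>i\<in>UNIV. c i *s row i M) = (\<Sum>i\<in>UNIV. c (inv_into UNIV h (h i)) *s h i)"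
        using h by (simp add: row bij_betw_def)
      also have "\<dots> = (\<Sum>b\<in>B. c (inv_into UNIV h b) *s b)"
        by (rule sum.reindex_bij_betw[OF h])
      finally show ?thesis .
    qed
    hence "(\<Sum>b\<in>B. c (inv_into UNIV h b) *s b) = 0" using c by simp
    moreover have "h i \<in> B" using h by (auto simp: bij_betw_def)
    ultimately have "c (inv_into UNIV h (h i)) = 0"
      by (rule vec.independentD[OF B(2) finB order_refl])
    thus "c i = 0" using h by (simp add: bij_betw_def)
  qed
  \<comment> \<open>\<open>M\<close> is \<open>\<Psi>\<close> modulo T; its invertibility makes the
    constant term of \<open>det \<Psi>\<close> nonzero.\<close>
  hence "\<exists>N. M ** N = mat 1" by (auto simp: matrix_right_invertible_independent_rows)
  hence "det M \<noteq> 0" by (metis det_I det_mul mult_zero_left zero_neq_one)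
  moreover have "det M = fps_nth (det \<Psi>) 0"
    unfolding M_def by (rule det_hom) simp_all
  ultimately have "det \<Psi> \<noteq> 0" by auto
  thus ?thesis using f(1) by (intro exI[of _ \<Psi>]) (simp add: \<Psi>_def)
qed

end

section \<open>Tensor products\<close>

text \<open>The homomorphism out of the free abelian group that extends \<open>g\<close>; integers
  act through \<open>of_int\<close> on the coordinates.\<close>

definition frag_eval :: "('z \<Rightarrow> 'v::comm_ring_1^'k) \<Rightarrow> ('z \<Rightarrow>\<^sub>0 int) \<Rightarrow> 'v^'k" where
  "frag_eval g c = (\<Sum>z\<in>Poly_Mapping.keys c. of_int (Poly_Mapping.lookup c z) *s g z)"

lemma frag_eval_superset:
  "finite S \<Longrightarrow> Poly_Mapping.keys c \<subseteq> S \<Longrightarrow>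
     frag_eval g c = (\<Sum>z\<in>S. of_int (Poly_Mapping.lookup c z) *s g z)"
  unfolding frag_eval_def by (rule sum.mono_neutral_left) (auto simp: in_keys_iff)

lemma frag_eval_0 [simp]: "frag_eval g 0 = 0"
  by (simp add: frag_eval_def)

lemma frag_eval_of [simp]: "frag_eval g (frag_of z) = g z"
  by (simp add: frag_eval_def vec_eq_iff)

lemma frag_eval_diff: "frag_eval g (a - b) = frag_eval g a - frag_eval g b"
proof -
  let ?S = "Poly_Mapping.keys a \<union> Poly_Mapping.keys b"
  have "Poly_Mapping.keys (a - b) \<subseteq> ?S" by (rule keys_diff)
  thus ?thesis
    by (simp add: frag_eval_superset[of ?S] lookup_minus sum_subtractf vector_sub_rdistrib)
qed

lemma frag_eval_add: "frag_eval g (a + b) = frag_eval g a + frag_eval g b"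
  using frag_eval_diff[of g "a + b" b] by simp

lemma frag_eval_sum: "frag_eval g (sum f I) = (\<Sum>i\<in>I. frag_eval g (f i))"
  by (induction I rule: infinite_finite_induct) (auto simp: frag_eval_add)

text \<open>
  A balanced biadditive map \<open>pr\<close> into a group \<open>E\<close> identifies the tensor product with \<open>E\<close> if it has a
  section \<open>lift\<close> that is additive and inverse to \<open>pr\<close> modulo the defining relations.
\<close>
locale tensor_representation =
  fixes R :: "('r, 'x) ring_scheme" and M :: "('r, 'm, 'y) module_scheme"
    and N :: "('r, 'n, 'z) module_scheme"
    and pr :: "'m \<times> 'n \<Rightarrow> 'v::comm_ring_1^'k" and E :: "('v^'k) set"
    and lift :: "'v^'k \<Rightarrow> ('m \<times> 'n \<Rightarrow>\<^sub>0 int)"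
  assumes pr_add_left: "m \<in> carrier M \<Longrightarrow> m' \<in> carrier M \<Longrightarrow> n \<in> carrier N \<Longrightarrow>
      pr (m \<oplus>\<^bsub>M\<^esub> m', n) = pr (m, n) + pr (m', n)"
    and pr_add_right: "m \<in> carrier M \<Longrightarrow> n \<in> carrier N \<Longrightarrow> n' \<in> carrier N \<Longrightarrow>
      pr (m, n \<oplus>\<^bsub>N\<^esub> n') = pr (m, n) + pr (m, n')"
    and pr_balanced: "r \<in> carrier R \<Longrightarrow> m \<in> carrier M \<Longrightarrow> n \<in> carrier N \<Longrightarrow>
      pr (r \<odot>\<^bsub>M\<^esub> m, n) = pr (m, r \<odot>\<^bsub>N\<^esub> n)"
    and add_closed_M: "m \<in> carrier M \<Longrightarrow> m' \<in> carrier M \<Longrightarrow> m \<oplus>\<^bsub>M\<^esub> m' \<in> carrier M"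
    and add_closed_N: "n \<in> carrier N \<Longrightarrow> n' \<in> carrier N \<Longrightarrow> n \<oplus>\<^bsub>N\<^esub> n' \<in> carrier N"
    and smult_closed_M: "r \<in> carrier R \<Longrightarrow> m \<in> carrier M \<Longrightarrow> r \<odot>\<^bsub>M\<^esub> m \<in> carrier M"
    and smult_closed_N: "r \<in> carrier R \<Longrightarrow> n \<in> carrier N \<Longrightarrow> r \<odot>\<^bsub>N\<^esub> n \<in> carrier N"
    and pr_closed: "z \<in> carrier M \<times> carrier N \<Longrightarrow> pr z \<in> E"
    and E_0: "0 \<in> E" and E_diff: "v \<in> E \<Longrightarrow> w \<in> E \<Longrightarrow> v - w \<in> E"
    and lift_closed: "v \<in> E \<Longrightarrow> Poly_Mapping.keys (lift v) \<subseteq> carrier M \<times> carrier N"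
    and eval_lift: "v \<in> E \<Longrightarrow> frag_eval pr (lift v) = v"
    and lift_add: "v \<in> E \<Longrightarrow> w \<in> E \<Longrightarrow> lift (v + w) - lift v - lift w \<in> tensor_subgroup R M N"
    and lift_pr: "z \<in> carrier M \<times> carrier N \<Longrightarrow> frag_of z - lift (pr z) \<in> tensor_subgroup R M N"

lemma tensor_subgroup_subgroup:
  assumes "\<And>m m'. m \<in> carrier M \<Longrightarrow> m' \<in> carrier M \<Longrightarrow> m \<oplus>\<^bsub>M\<^esub> m' \<in> carrier M"
    and "\<And>n n'. n \<in> carrier N \<Longrightarrow> n' \<in> carrier N \<Longrightarrow> n \<oplus>\<^bsub>N\<^esub> n' \<in> carrier N"
    and "\<And>r m. r \<in> carrier R \<Longrightarrow> m \<in> carrier M \<Longrightarrow> r \<odot>\<^bsub>M\<^esub> m \<in> carrier M"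
    and "\<And>r n. r \<in> carrier R \<Longrightarrow> n \<in> carrier N \<Longrightarrow> r \<odot>\<^bsub>N\<^esub> n \<in> carrier N"
  shows "subgroup (tensor_subgroup R M N) (free_Abelian_group (carrier M \<times> carrier N))"
  unfolding tensor_subgroup_def
proof (rule group.generate_is_subgroup[OF group_free_Abelian_group])
  show "tensor_rels R M N \<subseteq> carrier (free_Abelian_group (carrier M \<times> carrier N))"
    unfolding tensor_rels_def
    by (auto dest!: keys_diff[THEN subsetD] simp: assms)
qed

lemma tensor_subgroup_group:
  assumes "subgroup (tensor_subgroup R M N) (free_Abelian_group (carrier M \<times> carrier N))"
  shows "0 \<in> tensor_subgroup R M N"
    and "x \<in> tensor_subgroup R M N \<Longrightarrow> y \<in> tensor_subgroup R M N \<Longrightarrow> x + y \<in> tensor_subgroup R M N"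
    and "x \<in> tensor_subgroup R M N \<Longrightarrow> y \<in> tensor_subgroup R M N \<Longrightarrow> x - y \<in> tensor_subgroup R M N"
    and "x \<in> tensor_subgroup R M N \<Longrightarrow> Poly_Mapping.keys x \<subseteq> carrier M \<times> carrier N"
proof -
  interpret K: subgroup "tensor_subgroup R M N" "free_Abelian_group (carrier M \<times> carrier N)" by fact
  show "0 \<in> tensor_subgroup R M N" using K.one_closed by simp
  show add: "x + y \<in> tensor_subgroup R M N" if "x \<in> tensor_subgroup R M N" "y \<in> tensor_subgroup R M N" for x y
    using K.m_closed[OF that] by simp
  show keys: "Poly_Mapping.keys x \<subseteq> carrier M \<times> carrier N" if "x \<in> tensor_subgroup R M N" for x
    using K.mem_carrier[OF that] by simp
  show "x - y \<in> tensor_subgroup R M N" if "x \<in> tensor_subgroup R M N" "y \<in> tensor_subgroup R M N"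
    using add[OF that(1) K.m_inv_closed[OF that(2)]] keys[OF that(2)] by simp
qed

context tensor_representation
begin

abbreviation "K \<equiv> tensor_subgroup R M N"
abbreviation "F \<equiv> free_Abelian_group (carrier M \<times> carrier N)"
abbreviation "ev \<equiv> frag_eval pr"

lemma K_subgroup: "subgroup K F"
  by (rule tensor_subgroup_subgroup)
    (auto intro: add_closed_M add_closed_N smult_closed_M smult_closed_N)

lemmas K_group = tensor_subgroup_group[OF K_subgroup]

lemma ev_closed: "Poly_Mapping.keys x \<subseteq> carrier M \<times> carrier N \<Longrightarrow> ev x \<in> E"
  by (induction x rule: frag_induction) (auto simp: E_0 frag_eval_diff intro: E_diff pr_closed)

lemma ev_K: "x \<in> K \<Longrightarrow> ev x = 0"
proof -
  assume "x \<in> K"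
  hence "x \<in> generate F (tensor_rels R M N)" by (simp add: tensor_subgroup_def)
  thus "ev x = 0"
  proof (induction x rule: generate.induct)
    case (incl h)
    thus ?case
      by (auto simp: tensor_rels_def frag_eval_diff pr_add_left pr_add_right pr_balanced)
  next
    case (inv h)
    have "h \<in> K" unfolding tensor_subgroup_def by (rule generate.incl[OF inv])
    hence "inv\<^bsub>F\<^esub> h = 0 - h" using K_group(4) by simp
    moreover have "ev h = 0"
      using inv by (auto simp: tensor_rels_def frag_eval_diff pr_add_left pr_add_right pr_balanced)
    ultimately show ?case by (simp add: frag_eval_diff del: diff_0)
  qed (simp_all add: frag_eval_add)
qed

text \<open>Modulo the relations every formal sum equals the lift of its value. The claim holds for
  generators by \<open>lift_pr\<close> and passes to differences by \<open>lift_add\<close>; it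
  yields that \<open>K\<close> is the whole kernel of \<open>ev\<close>.\<close>

lemma diff_lift_in_K:
  "Poly_Mapping.keys x \<subseteq> carrier M \<times> carrier N \<Longrightarrow> ev x \<in> E \<and> x - lift (ev x) \<in> K"
proof (induction x rule: frag_induction)
  case zero
  have "lift (0 + 0) - lift 0 - lift 0 \<in> K" by (rule lift_add[OF E_0 E_0])
  thus ?case using E_0 by simp
next
  case (one z)
  thus ?case using pr_closed lift_pr by simp
next
  case (diff a b)
  have E: "ev a - ev b \<in> E" using diff.IH by (auto intro: E_diff)
  have "lift ((ev a - ev b) + ev b) - lift (ev a - ev b) - lift (ev b) \<in> K"
    using diff.IH E by (intro lift_add) auto
  hence "lift (ev a) - lift (ev a - ev b) - lift (ev b) \<in> K" by simp
  hence "((a - lift (ev a)) - (b - lift (ev b))) + (lift (ev a) - lift (ev a - ev b) - lift (ev b)) \<in> K"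
    by (intro K_group(2) K_group(3)[OF conjunct2[OF diff.IH(1)] conjunct2[OF diff.IH(2)]])
  moreover have "((a - lift (ev a)) - (b - lift (ev b))) + (lift (ev a) - lift (ev a - ev b) - lift (ev b)) =
      (a - b) - lift (ev a - ev b)" by simp
  ultimately show ?case using E by (simp add: frag_eval_diff)
qed

lemma K_eq: "K = {x. Poly_Mapping.keys x \<subseteq> carrier M \<times> carrier N \<and> ev x = 0}"
proof (intro equalityI subsetI)
  fix x assume "x \<in> {x. Poly_Mapping.keys x \<subseteq> carrier M \<times> carrier N \<and> ev x = 0}"
  hence "x - lift 0 \<in> K" using diff_lift_in_K[of x] by simp
  moreover have "0 - lift 0 \<in> K" using diff_lift_in_K[of 0] by simp
  ultimately have "(x - lift 0) - (0 - lift 0) \<in> K" by (rule K_group(3))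
  thus "x \<in> K" by simp
qed (use ev_K K_group(4) in auto)

text \<open>A fibre of \<open>ev\<close>; for \<open>v\<close> in \<open>E\<close> it is a coset of
  \<open>K\<close>, so these sets are the elements of the tensor product, indexed by
  \<open>E\<close>.\<close>

definition tensor_class :: "'v^'k \<Rightarrow> ('m \<times> 'n \<Rightarrow>\<^sub>0 int) set" where
  "tensor_class v = {x. Poly_Mapping.keys x \<subseteq> carrier M \<times> carrier N \<and> ev x = v}"

lemma r_coset_eq:
  assumes "Poly_Mapping.keys x \<subseteq> carrier M \<times> carrier N"
  shows "K #>\<^bsub>F\<^esub> x = tensor_class (ev x)"
proof (intro equalityI subsetI)
  fix y assume "y \<in> K #>\<^bsub>F\<^esub> x"
  then obtain k where k: "k \<in> K" "y = k + x" by (auto simp: r_coset_def)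
  thus "y \<in> tensor_class (ev x)"
    using assms keys_add[of k x] K_group(4)[OF k(1)] ev_K[OF k(1)]
    by (auto simp: tensor_class_def frag_eval_add)
next
  fix y assume y: "y \<in> tensor_class (ev x)"
  hence "y - x \<in> K"
    using assms keys_diff[of y x] by (auto simp: K_eq tensor_class_def frag_eval_diff)
  thus "y \<in> K #>\<^bsub>F\<^esub> x" by (force simp: r_coset_def)
qed

lemma lift_in_class: "v \<in> E \<Longrightarrow> lift v \<in> tensor_class v"
  by (simp add: tensor_class_def lift_closed eval_lift)

lemma tensor_class_inj: "v \<in> E \<Longrightarrow> tensor_class v = tensor_class w \<Longrightarrow> v = w"
  using lift_in_class[of v] by (auto simp: tensor_class_def)

lemma tensor_carrier: "carrier (tensor_product R M N) = tensor_class ` E"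
proof -
  have "carrier (tensor_product R M N) = {K #>\<^bsub>F\<^esub> x | x. Poly_Mapping.keys x \<subseteq> carrier M \<times> carrier N}"
    by (auto simp: tensor_product_def Let_def FactGroup_def RCOSETS_def)
  also have "\<dots> = tensor_class ` E"
  proof (intro equalityI subsetI)
    fix c assume "c \<in> tensor_class ` E"
    then obtain v where v: "v \<in> E" "c = tensor_class v" by auto
    hence "c = K #>\<^bsub>F\<^esub> lift v" by (simp add: r_coset_eq lift_closed eval_lift)
    thus "c \<in> {K #>\<^bsub>F\<^esub> x | x. Poly_Mapping.keys x \<subseteq> carrier M \<times> carrier N}"
      using lift_closed[OF v(1)] by blast
  qed (auto simp: r_coset_eq ev_closed)
  finally show ?thesis .
qed

lemma tensor_zero: "\<zero>\<^bsub>tensor_product R M N\<^esub> = tensor_class 0"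
  by (simp add: tensor_product_def Let_def FactGroup_def K_eq tensor_class_def)

lemma tensor_add:
  assumes v: "v \<in> E" and w: "w \<in> E"
  shows "tensor_class v \<oplus>\<^bsub>tensor_product R M N\<^esub> tensor_class w = tensor_class (v + w)"
proof -
  have "tensor_class v <#>\<^bsub>F\<^esub> tensor_class w = tensor_class (v + w)"
  proof (intro equalityI subsetI)
    fix x assume "x \<in> tensor_class v <#>\<^bsub>F\<^esub> tensor_class w"
    then obtain a b where "a \<in> tensor_class v" "b \<in> tensor_class w" "x = a + b"
      by (auto simp: set_mult_def)
    thus "x \<in> tensor_class (v + w)"
      using keys_add[of a b] by (auto simp: tensor_class_def frag_eval_add)
  next
    fix x assume x: "x \<in> tensor_class (v + w)"
    have "x - lift w \<in> tensor_class v"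
      using x keys_diff[of x "lift w"] lift_in_class[OF w]
      by (auto simp: tensor_class_def frag_eval_diff)
    thus "x \<in> tensor_class v <#>\<^bsub>F\<^esub> tensor_class w"
      using lift_in_class[OF w] by (force simp: set_mult_def)
  qed
  thus ?thesis by (simp add: tensor_product_def Let_def FactGroup_def)
qed

text \<open>\<open>g\<close> itself need not be biadditive. Since it induces an additive map
  \<open>s\<close> on values, all representatives of a class land in one class, and
  \<open>the_elem\<close> is meaningful.\<close>

lemma tensor_map_class:
  assumes v: "v \<in> E"
    and g: "\<And>z. z \<in> carrier M \<times> carrier N \<Longrightarrow> g z \<in> carrier M \<times> carrier N"
      "\<And>z. z \<in> carrier M \<times> carrier N \<Longrightarrow> pr (g z) = s (pr z)"
    and s: "\<And>v w. s (v - w) = s v - s w"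
  shows "tensor_map R M N g (tensor_class v) = tensor_class (s v)"
proof -
  let ?e = "\<lambda>x. frag_extend (\<lambda>z. frag_of (g z)) x"
  have s0: "s 0 = 0" using s[of 0 0] by simp
  have *: "Poly_Mapping.keys (?e x) \<subseteq> carrier M \<times> carrier N \<and> ev (?e x) = s (ev x)"
    if "Poly_Mapping.keys x \<subseteq> carrier M \<times> carrier N" for x
    using that
  proof (induction x rule: frag_induction)
    case (diff a b)
    thus ?case using keys_diff[of "?e a" "?e b"]
      by (auto simp: frag_extend_diff frag_eval_diff s)
  qed (use g in \<open>auto simp: s0\<close>)
  have "(\<lambda>x. K #>\<^bsub>F\<^esub> ?e x) ` tensor_class v = {tensor_class (s v)}"
  proof (intro equalityI subsetI)
    fix c assume "c \<in> (\<lambda>x. K #>\<^bsub>F\<^esub> ?e x) ` tensor_class v"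
    then obtain x where "x \<in> tensor_class v" "c = K #>\<^bsub>F\<^esub> ?e x" by auto
    thus "c \<in> {tensor_class (s v)}" using *[of x] r_coset_eq[of "?e x"] by (simp add: tensor_class_def)
  next
    fix c assume "c \<in> {tensor_class (s v)}"
    hence "c = K #>\<^bsub>F\<^esub> ?e (lift v)"
      using *[of "lift v"] r_coset_eq[of "?e (lift v)"] lift_closed[OF v] eval_lift[OF v] by simp
    thus "c \<in> (\<lambda>x. K #>\<^bsub>F\<^esub> ?e x) ` tensor_class v" using lift_in_class[OF v] by blast
  qed
  thus ?thesis by (simp add: tensor_map_def Let_def)
qed

lemma tensor_smult:
  assumes r: "r \<in> carrier R" and v: "v \<in> E"
    and s: "\<And>m n. m \<in> carrier M \<Longrightarrow> n \<in> carrier N \<Longrightarrow> pr (m, r \<odot>\<^bsub>N\<^esub> n) = s (pr (m, n))"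
      "\<And>v w. s (v - w) = s v - s w"
  shows "r \<odot>\<^bsub>tensor_product R M N\<^esub> tensor_class v = tensor_class (s v)"
  unfolding tensor_product_def Let_def module.simps
  by (rule tensor_map_class[OF v]) (use r s smult_closed_N in auto)

end

section \<open>Coordinates on the motive\<close>

lemma motive_induct [case_names zero add monom]:
  fixes m :: "'a::field poly^'n"
  assumes "P 0" "\<And>m m'. P m \<Longrightarrow> P m' \<Longrightarrow> P (m + m')"
    and "\<And>j a n. P (axis j (Polynomial.monom a n))"
  shows "P m"
proof -
  have sum: "P (sum f I)" if "\<And>i. i \<in> I \<Longrightarrow> P (f i)" for f :: "'b \<Rightarrow> 'a poly^'n" and I
    using that by (induction I rule: infinite_finite_induct) (auto intro: assms)
  have ax: "axis j (sum f I) = (\<Sum>i\<in>I. axis j (f i))" for j :: 'n and f :: "nat \<Rightarrow> 'a poly" and I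
    by (simp add: vec_eq_iff axis_def if_distrib cong: if_cong)
  have "m = (\<Sum>j\<in>UNIV. axis j (vec_nth m j))"
    by (simp add: vec_eq_iff axis_def sum.delta)
  also have "\<dots> = (\<Sum>j\<in>UNIV. \<Sum>i\<le>Polynomial.degree (vec_nth m j).
      axis j (Polynomial.monom (Polynomial.coeff (vec_nth m j) i) i))"
    by (simp add: poly_as_sum_of_monoms flip: ax)
  finally have eq: "m = (\<Sum>j\<in>UNIV. \<Sum>i\<le>Polynomial.degree (vec_nth m j).
      axis j (Polynomial.monom (Polynomial.coeff (vec_nth m j) i) i))" .
  show ?thesis by (subst eq) (intro sum assms(3))
qed

context C_infinity
begin

lemma frobenius_power_add: "((x :: 'c) + y) ^ q ^ i = x ^ q ^ i + y ^ q ^ i"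
proof (induction i)
  case (Suc i)
  have "z ^ q ^ Suc i = (z ^ q ^ i) ^ q" for z :: 'c
    by (simp add: power_mult mult.commute flip: power_mult)
  thus ?case using Suc frobenius_add by simp
qed simp

lemma frobenius_power_0 [simp]: "(0 :: 'c) ^ q ^ i = 0"
  using q_gt_1 by (simp add: power_0_left)

text \<open>Common summation bounds for several polynomials make biadditivity a termwise
  matter.\<close>

lemma twisted_mult_superset:
  fixes P S :: "'c poly"
  assumes "Polynomial.degree P \<le> a" "Polynomial.degree S \<le> b"
  shows "twisted_mult q P S = (\<Sum>i\<le>a. \<Sum>j\<le>b.
    Polynomial.monom (Polynomial.coeff P i * Polynomial.coeff S j ^ q ^ i) (i + j))"
proof -
  have "twisted_mult q P S = (\<Sum>i\<le>Polynomial.degree P. \<Sum>j\<le>b.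
      Polynomial.monom (Polynomial.coeff P i * Polynomial.coeff S j ^ q ^ i) (i + j))"
    unfolding twisted_mult_def
    by (intro sum.cong refl sum.mono_neutral_left) (use assms in \<open>auto simp: coeff_eq_0\<close>)
  also have "\<dots> = (\<Sum>i\<le>a. \<Sum>j\<le>b.
      Polynomial.monom (Polynomial.coeff P i * Polynomial.coeff S j ^ q ^ i) (i + j))"
    by (intro sum.mono_neutral_left) (use assms in \<open>auto simp: coeff_eq_0\<close>)
  finally show ?thesis .
qed

lemma twisted_mult_add_left: "twisted_mult q (P + P') (S :: 'c poly) = twisted_mult q P S + twisted_mult q P' S"
proof -
  let ?a = "max (Polynomial.degree P) (Polynomial.degree P')"
  have "Polynomial.degree (P + P') \<le> ?a" by (rule degree_add_le_max)
  thus ?thesis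
    by (simp add: twisted_mult_superset[of _ ?a S "Polynomial.degree S"] algebra_simps
        flip: add_monom sum.distrib)
qed

lemma twisted_mult_add_right: "twisted_mult q P (S + S' :: 'c poly) = twisted_mult q P S + twisted_mult q P S'"
proof -
  let ?b = "max (Polynomial.degree S) (Polynomial.degree S')"
  have "Polynomial.degree (S + S') \<le> ?b" by (rule degree_add_le_max)
  thus ?thesis
    by (simp add: twisted_mult_superset[of P "Polynomial.degree P" _ ?b] algebra_simps
        frobenius_power_add flip: add_monom sum.distrib)
qed

lemma twisted_mult_0 [simp]: "twisted_mult q 0 (S :: 'c poly) = 0" "twisted_mult q P (0 :: 'c poly) = 0"
  by (simp_all add: twisted_mult_def)

lemma twisted_mult_monom:
  "twisted_mult q (Polynomial.monom a i) (Polynomial.monom (b :: 'c) j) = Polynomial.monom (a * b ^ q ^ i) (i + j)"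
proof -
  have "twisted_mult q (Polynomial.monom a i) (Polynomial.monom b j) =
      (\<Sum>k\<le>i. \<Sum>l\<le>j. if k = i then (if l = j then Polynomial.monom (a * b ^ q ^ i) (i + j) else 0) else 0)"
    unfolding twisted_mult_superset[OF degree_monom_le degree_monom_le]
    by (intro sum.cong) (auto simp del: power_eq_0_iff)
  also have "\<dots> = (\<Sum>k\<le>i. if k = i then Polynomial.monom (a * b ^ q ^ i) (i + j) else 0)"
    by (intro sum.cong) auto
  also have "\<dots> = Polynomial.monom (a * b ^ q ^ i) (i + j)" by simp
  finally show ?thesis .
qed

lemma motive_scale_const: "motive_scale q [:c:] m = (\<chi> j. Polynomial.smult c (vec_nth m j :: 'c poly))"
proof -
  have "twisted_mult q [:c:] S = Polynomial.smult c S" for S :: "'c poly"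
    using poly_as_sum_of_monoms[of "Polynomial.smult c S"]
    by (cases "c = 0") (simp_all add: twisted_mult_def)
  thus ?thesis by (simp add: motive_scale_def)
qed

lemma motive_scale_add: "motive_scale q P (m + m' :: 'c poly^2) = motive_scale q P m + motive_scale q P m'"
  by (simp add: motive_scale_def vec_eq_iff twisted_mult_add_right)

lemma motive_scale_monom_axis:
  "motive_scale q (Polynomial.monom a i) (axis j (Polynomial.monom (b :: 'c) n)) =
     axis j (Polynomial.monom (a * b ^ q ^ i) (i + n))"
  by (simp add: motive_scale_def vec_eq_iff axis_def twisted_mult_monom)

lemma motive_tau_add: "motive_tau q (m + m' :: 'c poly^2) = motive_tau q m + motive_tau q m'"
  by (simp add: motive_tau_def motive_scale_add)

lemma motive_tau_axis:
  "motive_tau q (axis j (Polynomial.monom (a :: 'c) n)) = axis j (Polynomial.monom (a ^ q) (Suc n))"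
  by (simp add: motive_tau_def motive_scale_monom_axis)

lemma motive_T_add: "motive_T q \<theta> A (m + m') = motive_T q \<theta> A m + motive_T q \<theta> A m'"
  by (simp add: motive_T_def motive_scale_def vec_eq_iff twisted_mult_add_left sum.distrib)

lemma motive_T_axis:
  "motive_T q \<theta> A (axis j (Polynomial.monom a n)) =
     axis j (Polynomial.monom (a * \<theta> ^ q ^ n) n) + axis j (Polynomial.monom a (n + 2)) +
     (\<Sum>k\<in>UNIV. axis k (Polynomial.monom (a * (A $ j $ k) ^ q ^ n) (n + 1)))"
proof -
  have "motive_scale q (Polynomial.monom b i) (axis k 1) = axis k (Polynomial.monom b i)"
    for b :: 'c and i k
    using motive_scale_monom_axis[of b i k 1 0] by (simp add: monom_eq_1)
  moreover have "[:\<theta>:] = Polynomial.monom \<theta> 0" by (simp add: monom_0)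
  ultimately have basis: "motive_T_basis q \<theta> A j = axis j (Polynomial.monom \<theta> 0) +
      (\<Sum>k\<in>UNIV. axis k (Polynomial.monom (A $ j $ k) 1)) + axis j (Polynomial.monom 1 2)"
    by (simp only: motive_T_basis_def)
  have "motive_T q \<theta> A (axis j (Polynomial.monom a n)) =
      (\<Sum>i\<in>UNIV. if i = j then motive_scale q (Polynomial.monom a n) (motive_T_basis q \<theta> A j) else 0)"
    unfolding motive_T_def
    by (intro sum.cong) (auto simp: axis_def motive_scale_def vec_eq_iff)
  also have "\<dots> = motive_scale q (Polynomial.monom a n) (motive_T_basis q \<theta> A j)"
    by simp
  also have "\<dots> = axis j (Polynomial.monom (a * \<theta> ^ q ^ n) n) +
      motive_scale q (Polynomial.monom a n) (\<Sum>k\<in>UNIV. axis k (Polynomial.monom (A $ j $ k) 1)) +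
      axis j (Polynomial.monom a (n + 2))"
    by (simp add: basis motive_scale_add motive_scale_monom_axis)
  also have "motive_scale q (Polynomial.monom a n) (\<Sum>k\<in>UNIV. axis k (Polynomial.monom (A $ j $ k) 1)) =
      (\<Sum>k\<in>UNIV. axis k (Polynomial.monom (a * (A $ j $ k) ^ q ^ n) (n + 1)))"
    by (simp add: sum_2 motive_scale_add motive_scale_monom_axis)
  finally show ?thesis by (simp add: algebra_simps)
qed

text \<open>Defined on the monomials \<open>a \<tau>^n e_j\<close> by iterating
  \<open>sigma\<close>, which avoids rewriting powers of \<open>\<tau>\<close> in terms of T;
  compatibility with T is then a lemma instead of part of the construction.\<close>

definition coords :: "'c^2^2 \<Rightarrow> 'c poly^2 \<Rightarrow> 'c fps^(2 + 2)" where
  "coords A m = (\<Sum>j\<in>UNIV. \<Sum>n\<le>Polynomial.degree (vec_nth m j).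
     fps_const (Polynomial.coeff (vec_nth m j) n) *s (sigma A ^^ n) (axis (Inl j) 1))"

lemma coords_superset:
  assumes "\<And>j. Polynomial.degree (vec_nth m j) \<le> N"
  shows "coords A m = (\<Sum>j\<in>UNIV. \<Sum>n\<le>N.
     fps_const (Polynomial.coeff (vec_nth m j) n) *s (sigma A ^^ n) (axis (Inl j) 1))"
  unfolding coords_def
  by (intro sum.cong refl sum.mono_neutral_left) (use assms in \<open>auto simp: coeff_eq_0\<close>)

lemma coords_add: "coords A (m + m') = coords A m + coords A m'"
proof -
  define N where "N = (\<Sum>j\<in>UNIV. Polynomial.degree (vec_nth m j)) + (\<Sum>j\<in>UNIV. Polynomial.degree (vec_nth m' j))"
  have "Polynomial.degree (vec_nth m j) \<le> N" "Polynomial.degree (vec_nth m' j) \<le> N" for j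
    using member_le_sum[of j UNIV "\<lambda>j. Polynomial.degree (vec_nth m j)"]
      member_le_sum[of j UNIV "\<lambda>j. Polynomial.degree (vec_nth m' j)"]
    by (auto simp: N_def)
  moreover from this have "Polynomial.degree (vec_nth (m + m') j) \<le> N" for j
    by (simp add: degree_add_le)
  ultimately show ?thesis
    by (simp add: coords_superset[of _ N] vector_sadd_rdistrib flip: sum.distrib fps_const_add)
qed

lemma coords_0 [simp]: "coords A 0 = 0"
  using coords_add[of A 0 0] by simp

lemma coords_sum: "coords A (sum f I) = (\<Sum>i\<in>I. coords A (f i))"
  by (induction I rule: infinite_finite_induct) (auto simp: coords_add)

lemma coords_axis:
  "coords A (axis j (Polynomial.monom a n)) = fps_const a *s (sigma A ^^ n) (axis (Inl j) 1)"
proof -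
  have "coords A (axis j (Polynomial.monom a n)) = (\<Sum>i\<in>UNIV. \<Sum>k\<le>n.
      if i = j then (if k = n then fps_const a *s (sigma A ^^ n) (axis (Inl j) 1) else 0) else 0)"
    by (subst coords_superset[of _ n]) (auto simp: axis_def degree_monom_le intro!: sum.cong)
  also have "\<dots> = (\<Sum>i\<in>UNIV. if i = j then fps_const a *s (sigma A ^^ n) (axis (Inl j) 1) else 0)"
    by (intro sum.cong) auto
  finally show ?thesis by simp
qed

lemma sigma_funpow_add: "(sigma A ^^ n) (x + y) = (sigma A ^^ n) x + (sigma A ^^ n) y"
  by (induction n) (auto simp: sigma_add)

lemma sigma_funpow_sum: "(sigma A ^^ n) (sum f I) = (\<Sum>i\<in>I. (sigma A ^^ n) (f i))"
proof -
  have "(sigma A ^^ n) 0 = 0" by (induction n) auto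
  thus ?thesis by (induction I rule: infinite_finite_induct) (auto simp: sigma_funpow_add)
qed

lemma sigma_funpow_const: "(sigma A ^^ n) (fps_const c *s x) = fps_const (c ^ q ^ n) *s (sigma A ^^ n) x"
proof (induction n)
  case (Suc n)
  have "(c ^ q ^ n) ^ q = c ^ q ^ Suc n" by (simp add: mult.commute flip: power_mult)
  thus ?case using Suc by (simp add: sigma_scale)
qed simp

lemma sigma_funpow_X: "(sigma A ^^ n) (fps_X *s x) = fps_X *s (sigma A ^^ n) x"
  by (induction n) (auto simp: sigma_scale)

lemma sigma_axis_Inl: "sigma A (axis (Inl j) 1) = axis (Inr j) 1"
proof -
  have "sigma A (axis (Inl j) 1) $ k = axis (Inr j) 1 $ k" for k
    by (cases k) (simp_all add: sigma_nth axis_def)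
  thus ?thesis by (simp add: vec_eq_iff)
qed

text \<open>The defining relation \<open>T e_j = \<theta> e_j + (\<Sum>k. A_jk \<tau> e_k) +
  \<tau>^2 e_j\<close>, read in coordinates.\<close>

lemma X_scale_axis_Inl:
  "fps_X *s axis (Inl j) 1 = fps_const \<theta> *s axis (Inl j) 1 + (sigma A ^^ 2) (axis (Inl j) 1) +
     (\<Sum>k\<in>UNIV. fps_const (A $ j $ k) *s sigma A (axis (Inl k) 1))"
proof -
  have "(fps_X *s axis (Inl j) 1 :: 'c fps^(2 + 2)) $ l = (fps_const \<theta> *s axis (Inl j) 1 + sigma A (axis (Inr j) 1) +
     (\<Sum>k\<in>UNIV. fps_const (A $ j $ k) *s axis (Inr k) 1)) $ l" for l
    by (cases l) (auto simp: sigma_nth axis_def if_distrib[of frob] if_distrib[of "\<lambda>x. _ * x"] cong: if_cong)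
  thus ?thesis by (simp add: vec_eq_iff sigma_axis_Inl numeral_2_eq_2)
qed

lemma coords_scale: "coords A (motive_scale q [:c:] m) = fps_const c *s coords A m"
proof (induction m rule: motive_induct)
  case (monom j a n)
  have "[:c:] = Polynomial.monom c 0" by (simp add: monom_0)
  thus ?case by (simp add: motive_scale_monom_axis coords_axis)
qed (simp_all add: motive_scale_const[of c 0] motive_scale_add coords_add vector_add_ldistrib flip: zero_vec_def)

lemma motive_T_0: "motive_T q \<theta> A 0 = 0"
  using motive_T_add[of A 0 0] by simp

text \<open>The Frobenius fixes \<open>fps_X\<close>, so \<open>sigma\<close> commutes with T and
  the relation for \<open>e_j\<close> propagates to all \<open>\<tau>^n e_j\<close>.\<close>

lemma coords_T: "coords A (motive_T q \<theta> A m) = fps_X *s coords A m"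
proof (induction m rule: motive_induct)
  case (monom j a n)
  have "fps_X *s coords A (axis j (Polynomial.monom a n)) =
      fps_const a *s (sigma A ^^ n) (fps_X *s axis (Inl j) 1)"
    by (simp add: coords_axis sigma_funpow_X mult.commute)
  also have "\<dots> = coords A (motive_T q \<theta> A (axis j (Polynomial.monom a n)))"
    unfolding X_scale_axis_Inl[of j A] motive_T_axis
    by (simp add: coords_add coords_sum coords_axis sigma_funpow_add sigma_funpow_sum
        sigma_funpow_const vector_add_ldistrib sum_2 numeral_2_eq_2 funpow_swap1[symmetric])
  finally show ?case by simp
qed (simp_all add: motive_T_0 motive_T_add coords_add vector_add_ldistrib)

lemma coords_tau: "coords A (motive_tau q m) = sigma A (coords A m)"
proof (induction m rule: motive_induct)
  case zero
  have "motive_tau q (0 :: 'c poly^2) = 0" using motive_tau_add[of 0 0] by simp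
  thus ?case by simp
qed (simp_all add: motive_tau_add coords_add sigma_add motive_tau_axis coords_axis sigma_scale)

lemma fps_of_poly_sum_monomials:
  "fps_of_poly p = (\<Sum>k\<le>Polynomial.degree p. fps_const (Polynomial.coeff p k) * fps_X ^ k)"
  by (rule fps_ext) (auto simp: fps_sum_nth fps_X_power_nth coeff_eq_0 if_distrib cong: if_cong)

lemma coords_smult: "coords A (p \<odot>\<^bsub>motive q \<theta> A\<^esub> m) = fps_of_poly p *s coords A m"
proof -
  have T: "coords A ((motive_T q \<theta> A ^^ k) m) = fps_X ^ k *s coords A m" for k
    by (induction k) (auto simp: coords_T)
  have "coords A (p \<odot>\<^bsub>motive q \<theta> A\<^esub> m) =
      (\<Sum>k\<le>Polynomial.degree p. (fps_const (Polynomial.coeff p k) * fps_X ^ k) *s coords A m)"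
    by (simp add: motive_def coords_sum coords_scale T)
  thus ?thesis by (simp add: fps_of_poly_sum_monomials vec_eq_iff sum_distrib_right)
qed

end

lemma tensor_relI:
  "m \<in> carrier M \<Longrightarrow> m' \<in> carrier M \<Longrightarrow> n \<in> carrier N \<Longrightarrow>
     frag_of (m \<oplus>\<^bsub>M\<^esub> m', n) - frag_of (m, n) - frag_of (m', n) \<in> tensor_subgroup R M N"
  "m \<in> carrier M \<Longrightarrow> n \<in> carrier N \<Longrightarrow> n' \<in> carrier N \<Longrightarrow>
     frag_of (m, n \<oplus>\<^bsub>N\<^esub> n') - frag_of (m, n) - frag_of (m, n') \<in> tensor_subgroup R M N"
  "r \<in> carrier R \<Longrightarrow> m \<in> carrier M \<Longrightarrow> n \<in> carrier N \<Longrightarrow>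
     frag_of (r \<odot>\<^bsub>M\<^esub> m, n) - frag_of (m, r \<odot>\<^bsub>N\<^esub> n) \<in> tensor_subgroup R M N"
  unfolding tensor_subgroup_def tensor_rels_def by (rule generate.incl, blast)+

section \<open>The motive tensored with the convergent power series\<close>

context C_infinity
begin

definition tate_vectors :: "('c fps^(2 + 2)) set" where
  "tate_vectors = {x. \<forall>k. x $ k \<in> tate ord}"

definition motive_basis :: "2 + 2 \<Rightarrow> 'c poly^2" where
  "motive_basis k = (case k of Inl j \<Rightarrow> axis j 1 | Inr j \<Rightarrow> axis j (Polynomial.monom 1 1))"

definition motive_pairing :: "'c^2^2 \<Rightarrow> ('c poly^2) \<times> 'c fps \<Rightarrow> 'c fps^(2 + 2)" where
  "motive_pairing A = (\<lambda>(m, f). f *s coords A m)"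

text \<open>Represents the sum of the \<open>b_k \<otimes> v_k\<close>; it is additive only modulo
  the relations, because \<open>frag_of\<close> is not additive.\<close>

definition motive_lift :: "'c fps^(2 + 2) \<Rightarrow> (('c poly^2) \<times> 'c fps \<Rightarrow>\<^sub>0 int)" where
  "motive_lift v = (\<Sum>k\<in>UNIV. frag_of (motive_basis k, v $ k))"

lemma tate_vectors_0: "0 \<in> tate_vectors"
  and tate_vectors_add: "v \<in> tate_vectors \<Longrightarrow> w \<in> tate_vectors \<Longrightarrow> v + w \<in> tate_vectors"
  and tate_vectors_diff: "v \<in> tate_vectors \<Longrightarrow> w \<in> tate_vectors \<Longrightarrow> v - w \<in> tate_vectors"
  and tate_vectors_scale: "f \<in> tate ord \<Longrightarrow> v \<in> tate_vectors \<Longrightarrow> f *s v \<in> tate_vectors"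
  by (auto simp: tate_vectors_def intro: tate_0 tate_add tate_diff tate_mult)

lemma coords_tate: "coords A m \<in> tate_vectors"
proof (induction m rule: motive_induct)
  case (monom j a n)
  have "(sigma A ^^ n) (axis (Inl j) 1) \<in> tate_vectors"
  proof (induction n)
    case 0
    show ?case by (simp add: tate_vectors_def axis_def tate_0 tate_1)
  next
    case (Suc n)
    thus ?case using sigma_closed by (simp add: tate_vectors_def)
  qed
  thus ?case by (simp add: coords_axis tate_vectors_scale tate_const)
qed (auto simp: coords_add intro: tate_vectors_0 tate_vectors_add)

lemma coords_motive_basis: "coords A (motive_basis k) = axis k 1"
proof (cases k)
  case (Inl j)
  thus ?thesis using coords_axis[of A j 1 0] by (simp add: motive_basis_def monom_eq_1)
qed (simp add: motive_basis_def coords_axis sigma_axis_Inl)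

lemma tate_module_simps [simp]:
  "carrier (tate_module ord) = tate ord" "f \<oplus>\<^bsub>tate_module ord\<^esub> g = f + g"
  "p \<odot>\<^bsub>tate_module ord\<^esub> f = fps_of_poly p * f"
  by (simp_all add: tate_module_def tate_def)

lemma motive_simps [simp]:
  "carrier (motive q \<theta> A) = UNIV" "m \<oplus>\<^bsub>motive q \<theta> A\<^esub> m' = m + m'"
  by (simp_all add: motive_def)

lemma motive_smult_const: "[:c:] \<odot>\<^bsub>motive q \<theta> A\<^esub> m = motive_scale q [:c:] m"
  by (simp add: motive_def)

lemma motive_smult_X: "[:0, 1:] \<odot>\<^bsub>motive q \<theta> A\<^esub> m = motive_T q \<theta> A m"
  by (simp add: motive_def motive_scale_const vec_eq_iff)

lemma motive_tensor_subgroup: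
  "subgroup (tensor_subgroup polyring_T (motive q \<theta> A) (tate_module ord))
     (free_Abelian_group (carrier (motive q \<theta> A) \<times> carrier (tate_module ord)))"
  by (rule tensor_subgroup_subgroup) (auto intro: tate_add tate_mult tate_fps_of_poly)

context
  fixes A :: "'c^2^2"
begin

abbreviation "KA \<equiv> tensor_subgroup polyring_T (motive q \<theta> A) (tate_module ord)"

lemmas KA_group = tensor_subgroup_group[OF motive_tensor_subgroup[of A]]

lemma KA_sum: "(\<And>i. i \<in> I \<Longrightarrow> f i \<in> KA) \<Longrightarrow> sum f I \<in> KA"
  by (induction I rule: infinite_finite_induct) (auto intro: KA_group(1,2))

lemma KA_rels:
  "f \<in> tate ord \<Longrightarrow> frag_of (m + m', f) - frag_of (m, f) - frag_of (m', f) \<in> KA"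
  "f \<in> tate ord \<Longrightarrow> g \<in> tate ord \<Longrightarrow> frag_of (m, f + g) - frag_of (m, f) - frag_of (m, g) \<in> KA"
  "f \<in> tate ord \<Longrightarrow> frag_of (p \<odot>\<^bsub>motive q \<theta> A\<^esub> m, f) - frag_of (m, fps_of_poly p * f) \<in> KA"
  using tensor_relI[where M = "motive q \<theta> A" and N = "tate_module ord" and R = polyring_T]
  by (simp_all add: ring_of_type_algebra_def)

lemma KA_zero: "frag_of (m, 0) \<in> KA"
proof -
  have "frag_of (m, 0 + 0) - frag_of (m, 0) - frag_of (m, 0) \<in> KA" by (rule KA_rels) (rule tate_0)+
  from KA_group(3)[OF KA_group(1) this] show ?thesis by simp
qed

lemma motive_lift_add:
  assumes "v \<in> tate_vectors" "w \<in> tate_vectors"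
  shows "motive_lift (v + w) - motive_lift v - motive_lift w \<in> KA"
proof -
  have "motive_lift (v + w) - motive_lift v - motive_lift w =
      (\<Sum>k\<in>UNIV. frag_of (motive_basis k, v $ k + w $ k) - frag_of (motive_basis k, v $ k) -
         frag_of (motive_basis k, w $ k))"
    by (simp add: motive_lift_def sum_subtractf)
  also have "\<dots> \<in> KA"
    using assms by (intro KA_sum KA_rels) (auto simp: tate_vectors_def)
  finally show ?thesis .
qed

definition spanned :: "'c poly^2 \<Rightarrow> bool" where
  "spanned m \<longleftrightarrow> (\<forall>f\<in>tate ord. frag_of (m, f) - motive_lift (f *s coords A m) \<in> KA)"

lemma spanned_add:
  assumes "spanned m" "spanned m'"
  shows "spanned (m + m')"
  unfolding spanned_def
proof
  fix f assume f: "f \<in> tate ord"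
  let ?v = "f *s coords A m" and ?w = "f *s coords A m'"
  have v: "?v \<in> tate_vectors" "?w \<in> tate_vectors"
    using f by (auto intro: tate_vectors_scale coords_tate)
  have "frag_of (m, f) - motive_lift ?v \<in> KA" "frag_of (m', f) - motive_lift ?w \<in> KA"
    using assms f by (simp_all add: spanned_def)
  note KA_group(3)[OF KA_group(2)[OF KA_rels(1)[OF f, of m m'] KA_group(2)[OF this]] motive_lift_add[OF v]]
  thus "frag_of (m + m', f) - motive_lift (f *s coords A (m + m')) \<in> KA"
    by (simp add: coords_add vector_add_ldistrib algebra_simps)
qed

lemma spanned_smult:
  assumes "spanned m"
  shows "spanned (p \<odot>\<^bsub>motive q \<theta> A\<^esub> m)"
  unfolding spanned_def
proof
  fix f assume f: "f \<in> tate ord"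
  hence pf: "fps_of_poly p * f \<in> tate ord" by (intro tate_mult tate_fps_of_poly)
  have "(frag_of (p \<odot>\<^bsub>motive q \<theta> A\<^esub> m, f) - frag_of (m, fps_of_poly p * f)) +
      (frag_of (m, fps_of_poly p * f) - motive_lift ((fps_of_poly p * f) *s coords A m)) \<in> KA"
    using assms f pf unfolding spanned_def by (intro KA_group(2) KA_rels) auto
  thus "frag_of (p \<odot>\<^bsub>motive q \<theta> A\<^esub> m, f) - motive_lift (f *s coords A (p \<odot>\<^bsub>motive q \<theta> A\<^esub> m)) \<in> KA"
    by (simp add: coords_smult mult.commute)
qed

lemma spanned_basis: "spanned (motive_basis k)"
  unfolding spanned_def
proof
  fix f assume f: "f \<in> tate ord"
  have eq: "(f *s axis k 1 :: 'c fps^(2 + 2)) $ l = (if l = k then f else 0)" for l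
    by (simp add: axis_def)
  have "motive_lift (f *s axis k 1) =
      frag_of (motive_basis k, f) + (\<Sum>l\<in>UNIV - {k}. frag_of (motive_basis l, 0))"
    unfolding motive_lift_def eq by (subst sum.remove[of _ k]) (auto intro!: sum.cong)
  hence "frag_of (motive_basis k, f) - motive_lift (f *s axis k 1) =
      0 - (\<Sum>l\<in>UNIV - {k}. frag_of (motive_basis l, 0))" by simp
  also have "\<dots> \<in> KA" by (intro KA_group(1,3) KA_sum KA_zero)
  finally show "frag_of (motive_basis k, f) - motive_lift (f *s coords A (motive_basis k)) \<in> KA"
    by (simp add: coords_motive_basis)
qed

lemma spanned_const: "spanned (axis j (Polynomial.monom 1 n)) \<Longrightarrow> spanned (axis j (Polynomial.monom a n))"
  using spanned_smult[of "axis j (Polynomial.monom 1 n)" "[:a:]"]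
    motive_scale_monom_axis[of a 0 j 1 n]
  by (simp add: motive_smult_const monom_0)

lemma spanned_uminus:
  assumes "spanned m"
  shows "spanned (- m)"
proof -
  have "[:- 1:] \<odot>\<^bsub>motive q \<theta> A\<^esub> m = - m"
    unfolding motive_smult_const motive_scale_const by (simp add: vec_eq_iff)
  thus ?thesis using spanned_smult[OF assms, of "[:- 1:]"] by simp
qed

text \<open>\<open>T \<tau>^k e_j\<close> contains \<open>\<tau>^(k+2) e_j\<close> with coefficient
  1, and its other terms have smaller degree in \<open>\<tau>\<close>. Solving for that term reduces
  everything to \<open>e_j\<close> and \<open>\<tau> e_j\<close>.\<close>

lemma spanned_monom: "spanned (axis j (Polynomial.monom 1 n))"
proof (induction n arbitrary: j rule: less_induct)
  case (less n)
  consider "n = 0" | "n = 1" | k where "n = k + 2"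
    by (metis One_nat_def add_2_eq_Suc' not0_implies_Suc)
  thus ?case
  proof cases
    case 1
    thus ?thesis using spanned_basis[of "Inl j"] by (simp add: motive_basis_def)
  next
    case 2
    thus ?thesis using spanned_basis[of "Inr j"] by (simp add: motive_basis_def)
  next
    case (3 k)
    let ?r = "axis j (Polynomial.monom (\<theta> ^ q ^ k) k) +
      (axis 1 (Polynomial.monom (vec_nth (vec_nth A j) 1 ^ q ^ k) (k + 1)) + axis 2 (Polynomial.monom (vec_nth (vec_nth A j) 2 ^ q ^ k) (k + 1)))"
    have s: "spanned (axis l (Polynomial.monom c i))" if "i < n" for l c i
      by (rule spanned_const[OF less.IH[OF that]])
    have "spanned ?r" using 3 by (intro spanned_add s) auto
    hence "spanned (- ?r)" by (rule spanned_uminus)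
    moreover have "spanned (motive_T q \<theta> A (axis j (Polynomial.monom 1 k)))"
      using spanned_smult[OF less.IH[of k j], of "[:0, 1:]"] 3 by (simp add: motive_smult_X)
    ultimately have "spanned (motive_T q \<theta> A (axis j (Polynomial.monom 1 k)) + - ?r)"
      by (intro spanned_add)
    moreover have "motive_T q \<theta> A (axis j (Polynomial.monom 1 k)) + - ?r = axis j (Polynomial.monom 1 n)"
      unfolding motive_T_axis by (simp add: sum_2 3)
    ultimately show ?thesis by simp
  qed
qed

lemma all_spanned: "spanned m"
proof (induction m rule: motive_induct)
  case zero
  have "[:0:] \<odot>\<^bsub>motive q \<theta> A\<^esub> m = 0" for m
    unfolding motive_smult_const motive_scale_const by (simp add: vec_eq_iff)
  thus ?case using spanned_smult[OF spanned_monom, of "[:0:]"] by metis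
qed (auto intro: spanned_add spanned_const spanned_monom)

lemma motive_tensor_representation:
  "tensor_representation polyring_T (motive q \<theta> A) (tate_module ord) (motive_pairing A)
     tate_vectors motive_lift"
proof
  show "motive_pairing A (m \<oplus>\<^bsub>motive q \<theta> A\<^esub> m', f) = motive_pairing A (m, f) + motive_pairing A (m', f)" for m m' f
    by (simp add: motive_pairing_def coords_add vector_add_ldistrib)
  show "motive_pairing A (m, f \<oplus>\<^bsub>tate_module ord\<^esub> g) = motive_pairing A (m, f) + motive_pairing A (m, g)" for m f g
    by (simp add: motive_pairing_def vector_sadd_rdistrib)
  show "motive_pairing A (p \<odot>\<^bsub>motive q \<theta> A\<^esub> m, f) = motive_pairing A (m, p \<odot>\<^bsub>tate_module ord\<^esub> f)" for p m f
    by (simp add: motive_pairing_def coords_smult mult.commute)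
  show "frag_eval (motive_pairing A) (motive_lift v) = v" for v
    by (simp add: motive_lift_def frag_eval_sum motive_pairing_def coords_motive_basis vec_eq_iff
        axis_def if_distrib cong: if_cong)
  show "Poly_Mapping.keys (motive_lift v) \<subseteq> carrier (motive q \<theta> A) \<times> carrier (tate_module ord)"
    if "v \<in> tate_vectors" for v
  proof
    fix z assume "z \<in> Poly_Mapping.keys (motive_lift v)"
    then obtain k where "z \<in> Poly_Mapping.keys (frag_of (motive_basis k, v $ k))"
      unfolding motive_lift_def using keys_sum[of "\<lambda>k. frag_of (motive_basis k, v $ k)" UNIV] by blast
    thus "z \<in> carrier (motive q \<theta> A) \<times> carrier (tate_module ord)"
      using that by (auto simp: tate_vectors_def)
  qed
  show "frag_of z - motive_lift (motive_pairing A z) \<in> KA"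
    if "z \<in> carrier (motive q \<theta> A) \<times> carrier (tate_module ord)" for z
    using that all_spanned by (auto simp: spanned_def motive_pairing_def)
qed (auto simp: motive_pairing_def intro: tate_add tate_mult tate_fps_of_poly tate_vectors_0
      tate_vectors_diff tate_vectors_scale coords_tate motive_lift_add)

end

end

section \<open>Ranks\<close>

lemma module_basis_iso:
  assumes N: "abelian_monoid N"
    and \<phi>: "bij_betw \<phi> (carrier N) (carrier M)"
    and add: "\<And>x y. x \<in> carrier N \<Longrightarrow> y \<in> carrier N \<Longrightarrow> \<phi> (x \<oplus>\<^bsub>N\<^esub> y) = \<phi> x \<oplus>\<^bsub>M\<^esub> \<phi> y"
    and zero: "\<phi> \<zero>\<^bsub>N\<^esub> = \<zero>\<^bsub>M\<^esub>"
    and smult: "\<And>r x. r \<in> carrier R \<Longrightarrow> x \<in> carrier N \<Longrightarrow> r \<odot>\<^bsub>N\<^esub> x \<in> carrier N"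
      "\<And>r x. r \<in> carrier R \<Longrightarrow> x \<in> carrier N \<Longrightarrow> \<phi> (r \<odot>\<^bsub>N\<^esub> x) = r \<odot>\<^bsub>M\<^esub> \<phi> x"
  shows "abelian_monoid M"
    and "module_basis R N B \<Longrightarrow> module_basis R M (\<phi> ` B)"
proof -
  interpret N: abelian_monoid N by fact
  have onto: "\<exists>x\<in>carrier N. y = \<phi> x" if "y \<in> carrier M" for y
    using \<phi> that by (auto simp: bij_betw_def)
  have into: "\<phi> x \<in> carrier M" if "x \<in> carrier N" for x
    using \<phi> that by (auto simp: bij_betw_def)
  have inj: "x = y" if "x \<in> carrier N" "y \<in> carrier N" "\<phi> x = \<phi> y" for x y
    using \<phi> that by (auto simp: bij_betw_def inj_on_def)
  show M: "abelian_monoid M"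
  proof (rule abelian_monoidI)
    show "\<zero>\<^bsub>M\<^esub> \<in> carrier M" using into[OF N.zero_closed] zero by simp
    show "x \<oplus>\<^bsub>M\<^esub> y \<in> carrier M" if "x \<in> carrier M" "y \<in> carrier M" for x y
      using onto[OF that(1)] onto[OF that(2)] by (auto simp: into simp flip: add)
    show "x \<oplus>\<^bsub>M\<^esub> y \<oplus>\<^bsub>M\<^esub> z = x \<oplus>\<^bsub>M\<^esub> (y \<oplus>\<^bsub>M\<^esub> z)"
      if "x \<in> carrier M" "y \<in> carrier M" "z \<in> carrier M" for x y z
      using onto[OF that(1)] onto[OF that(2)] onto[OF that(3)]
      by (auto simp: N.a_assoc simp flip: add)
    show "\<zero>\<^bsub>M\<^esub> \<oplus>\<^bsub>M\<^esub> x = x" if "x \<in> carrier M" for x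
      using onto[OF that] by (auto simp flip: add zero)
    show "x \<oplus>\<^bsub>M\<^esub> y = y \<oplus>\<^bsub>M\<^esub> x" if "x \<in> carrier M" "y \<in> carrier M" for x y
      using onto[OF that(1)] onto[OF that(2)] by (auto simp: N.a_comm simp flip: add)
  qed
  interpret M: abelian_monoid M by (rule M)
  have fsum: "\<phi> (finsum N f S) = finsum M (\<lambda>b. \<phi> (f b)) S \<and> finsum N f S \<in> carrier N"
    if "finite S" "f \<in> S \<rightarrow> carrier N" for f S
    using that
  proof (induction S)
    case (insert b S)
    hence *: "f \<in> S \<rightarrow> carrier N" "f b \<in> carrier N" "(\<lambda>b. \<phi> (f b)) \<in> S \<rightarrow> carrier M"
      "\<phi> (f b) \<in> carrier M" using into by auto
    thus ?case using insert by (simp add: add)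
  qed (simp add: zero)
  assume basis: "module_basis R N B"
  hence B: "finite B" "B \<subseteq> carrier N" by (auto simp: module_basis_def)
  have injB: "inj_on \<phi> B" using \<phi> B(2) by (auto simp: bij_betw_def intro: inj_on_subset)
  have comb: "(\<Oplus>\<^bsub>M\<^esub>b\<in>\<phi> ` B. c b \<odot>\<^bsub>M\<^esub> b) = \<phi> (\<Oplus>\<^bsub>N\<^esub>b\<in>B. c (\<phi> b) \<odot>\<^bsub>N\<^esub> b) \<and>
      (\<Oplus>\<^bsub>N\<^esub>b\<in>B. c (\<phi> b) \<odot>\<^bsub>N\<^esub> b) \<in> carrier N"
    if c: "c \<in> \<phi> ` B \<rightarrow> carrier R" for c
  proof -
    have N1: "(\<lambda>b. c (\<phi> b) \<odot>\<^bsub>N\<^esub> b) \<in> B \<rightarrow> carrier N"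
      using c B(2) smult(1) by (auto simp: Pi_iff subset_iff)
    have M1: "\<phi> (c (\<phi> b) \<odot>\<^bsub>N\<^esub> b) = c (\<phi> b) \<odot>\<^bsub>M\<^esub> \<phi> b" if "b \<in> B" for b
      using c B(2) smult(2) that by (auto simp: Pi_iff subset_iff)
    have M2: "c (\<phi> b) \<odot>\<^bsub>M\<^esub> \<phi> b \<in> carrier M" if "b \<in> B" for b
      using M1[OF that] N1 into that by (metis Pi_mem)
    have "(\<Oplus>\<^bsub>M\<^esub>b\<in>\<phi> ` B. c b \<odot>\<^bsub>M\<^esub> b) = (\<Oplus>\<^bsub>M\<^esub>b\<in>B. c (\<phi> b) \<odot>\<^bsub>M\<^esub> \<phi> b)"
      using M2 by (intro M.finsum_reindex injB) auto
    also have "\<dots> = (\<Oplus>\<^bsub>M\<^esub>b\<in>B. \<phi> (c (\<phi> b) \<odot>\<^bsub>N\<^esub> b))"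
      using M1 M2 by (intro M.finsum_cong') auto
    also have "\<dots> = \<phi> (\<Oplus>\<^bsub>N\<^esub>b\<in>B. c (\<phi> b) \<odot>\<^bsub>N\<^esub> b)"
      using fsum[OF B(1) N1] by simp
    finally show ?thesis using fsum[OF B(1) N1] by blast
  qed
  have "\<exists>!c. c \<in> \<phi> ` B \<rightarrow>\<^sub>E carrier R \<and> y = (\<Oplus>\<^bsub>M\<^esub>b\<in>\<phi> ` B. c b \<odot>\<^bsub>M\<^esub> b)"
    if y: "y \<in> carrier M" for y
  proof -
    obtain x where x: "x \<in> carrier N" "y = \<phi> x" using onto[OF y] by blast
    hence ex1: "\<exists>!d. d \<in> B \<rightarrow>\<^sub>E carrier R \<and> x = (\<Oplus>\<^bsub>N\<^esub>b\<in>B. d b \<odot>\<^bsub>N\<^esub> b)"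
      using basis by (simp only: module_basis_def)
    then obtain d where d: "d \<in> B \<rightarrow>\<^sub>E carrier R" "x = (\<Oplus>\<^bsub>N\<^esub>b\<in>B. d b \<odot>\<^bsub>N\<^esub> b)"
      by (elim ex1E conjE)
    have uniq: "e = d" if "e \<in> B \<rightarrow>\<^sub>E carrier R" "x = (\<Oplus>\<^bsub>N\<^esub>b\<in>B. e b \<odot>\<^bsub>N\<^esub> b)" for e
      by (rule ex1E[OF ex1]) (use d that in blast)
    have cong: "(\<Oplus>\<^bsub>N\<^esub>b\<in>B. e b \<odot>\<^bsub>N\<^esub> b) = (\<Oplus>\<^bsub>N\<^esub>b\<in>B. e' b \<odot>\<^bsub>N\<^esub> b)"
      if "\<And>b. b \<in> B \<Longrightarrow> e b = e' b" "e' \<in> B \<rightarrow> carrier R" for e e'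
      using that B(2) smult(1) by (intro N.finsum_cong') (auto simp: Pi_iff subset_iff)
    define c where "c = restrict (\<lambda>z. d (inv_into B \<phi> z)) (\<phi> ` B)"
    have cd: "c (\<phi> b) = d b" if "b \<in> B" for b using that injB by (simp add: c_def)
    show ?thesis
    proof (rule ex1I[of _ c])
      have c: "c \<in> \<phi> ` B \<rightarrow>\<^sub>E carrier R" using d(1) injB by (auto simp: c_def PiE_iff)
      have "(\<Oplus>\<^bsub>N\<^esub>b\<in>B. c (\<phi> b) \<odot>\<^bsub>N\<^esub> b) = x"
        unfolding d(2) by (rule cong) (use cd d(1) in \<open>auto simp: PiE_iff\<close>)
      thus "c \<in> \<phi> ` B \<rightarrow>\<^sub>E carrier R \<and> y = (\<Oplus>\<^bsub>M\<^esub>b\<in>\<phi> ` B. c b \<odot>\<^bsub>M\<^esub> b)"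
        using comb[OF PiE_mem[OF c, THEN Pi_I]] c x(2) by simp
    next
      fix c' assume c': "c' \<in> \<phi> ` B \<rightarrow>\<^sub>E carrier R \<and> y = (\<Oplus>\<^bsub>M\<^esub>b\<in>\<phi> ` B. c' b \<odot>\<^bsub>M\<^esub> b)"
      hence Pi: "c' \<in> \<phi> ` B \<rightarrow> carrier R" by (auto simp: PiE_iff)
      have "x = (\<Oplus>\<^bsub>N\<^esub>b\<in>B. c' (\<phi> b) \<odot>\<^bsub>N\<^esub> b)"
        using comb[OF Pi] c' x by (intro inj) auto
      also have "\<dots> = (\<Oplus>\<^bsub>N\<^esub>b\<in>B. restrict (\<lambda>b. c' (\<phi> b)) B b \<odot>\<^bsub>N\<^esub> b)"
        using Pi by (intro cong) auto
      finally have "restrict (\<lambda>b. c' (\<phi> b)) B = d"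
        using Pi by (intro uniq) auto
      hence "c' (\<phi> b) = d b" if "b \<in> B" for b using that by (metis restrict_apply')
      hence "c' z = c z" for z
        using cd c' by (cases "z \<in> \<phi> ` B") (auto simp: c_def PiE_iff extensional_def)
      thus "c' = c" by blast
    qed
  qed
  thus "module_basis R M (\<phi> ` B)"
    using B into by (auto simp: module_basis_def)
qed

lemma free_rank_iso:
  assumes N: "abelian_monoid N"
    and \<phi>: "bij_betw \<phi> (carrier N) (carrier M)"
    and add: "\<And>x y. x \<in> carrier N \<Longrightarrow> y \<in> carrier N \<Longrightarrow> \<phi> (x \<oplus>\<^bsub>N\<^esub> y) = \<phi> x \<oplus>\<^bsub>M\<^esub> \<phi> y"
    and zero: "\<phi> \<zero>\<^bsub>N\<^esub> = \<zero>\<^bsub>M\<^esub>"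
    and smult: "\<And>r x. r \<in> carrier R \<Longrightarrow> x \<in> carrier N \<Longrightarrow> r \<odot>\<^bsub>N\<^esub> x \<in> carrier N"
      "\<And>r x. r \<in> carrier R \<Longrightarrow> x \<in> carrier N \<Longrightarrow> \<phi> (r \<odot>\<^bsub>N\<^esub> x) = r \<odot>\<^bsub>M\<^esub> \<phi> x"
  shows "free_rank R M = free_rank R N"
proof -
  note iso = module_basis_iso[OF N \<phi> add zero smult]
  interpret N: abelian_monoid N by fact
  let ?\<psi> = "inv_into (carrier N) \<phi>"
  have inv_phi: "?\<psi> (\<phi> x) = x" if "x \<in> carrier N" for x
    using \<phi> that by (simp add: bij_betw_def)
  have onto: "\<exists>x\<in>carrier N. y = \<phi> x" if "y \<in> carrier M" for y
    using \<phi> that by (auto simp: bij_betw_def)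
  \<comment> \<open>\<open>free_rank\<close> is a definite description, so both modules must have
    the same set of basis sizes; the transport is needed in both directions.\<close>
  have from_M: "module_basis R N (?\<psi> ` B)" if "module_basis R M B" for B
  proof (rule module_basis_iso(2)[OF iso(1) bij_betw_inv_into[OF \<phi>] _ _ _ _ that])
    show "?\<psi> (x \<oplus>\<^bsub>M\<^esub> y) = ?\<psi> x \<oplus>\<^bsub>N\<^esub> ?\<psi> y" if "x \<in> carrier M" "y \<in> carrier M" for x y
      using onto[OF that(1)] onto[OF that(2)] by (auto simp: inv_phi simp flip: add)
    show "?\<psi> \<zero>\<^bsub>M\<^esub> = \<zero>\<^bsub>N\<^esub>" by (simp add: inv_phi flip: zero)
    show "r \<odot>\<^bsub>M\<^esub> x \<in> carrier M" if "r \<in> carrier R" "x \<in> carrier M" for r x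
      using onto[OF that(2)] that(1) \<phi> smult(1) by (auto simp: bij_betw_def simp flip: smult(2))
    show "?\<psi> (r \<odot>\<^bsub>M\<^esub> x) = r \<odot>\<^bsub>N\<^esub> ?\<psi> x" if "r \<in> carrier R" "x \<in> carrier M" for r x
      using onto[OF that(2)] that(1) smult(1) by (auto simp: inv_phi simp flip: smult(2))
  qed (use add zero smult in auto)
  have "(\<exists>B. module_basis R M B \<and> card B = n) \<longleftrightarrow> (\<exists>B. module_basis R N B \<and> card B = n)" for n
  proof
    assume "\<exists>B. module_basis R M B \<and> card B = n"
    then obtain B where B: "module_basis R M B" "card B = n" by blast
    have "inj_on ?\<psi> B"
      using B(1) bij_betw_inv_into[OF \<phi>] by (auto simp: module_basis_def bij_betw_def intro: inj_on_subset)
    thus "\<exists>B. module_basis R N B \<and> card B = n" using from_M[OF B(1)] B(2) by (metis card_image)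
  next
    assume "\<exists>B. module_basis R N B \<and> card B = n"
    then obtain B where B: "module_basis R N B" "card B = n" by blast
    have "inj_on \<phi> B"
      using B(1) \<phi> by (auto simp: module_basis_def bij_betw_def intro: inj_on_subset)
    moreover have "module_basis R M (\<phi> ` B)"
      by (rule iso(2)) (use add zero smult B(1) in auto)
    ultimately show "\<exists>B. module_basis R M B \<and> card B = n" using B(2) by (metis card_image)
  qed
  thus ?thesis by (simp add: free_rank_def)
qed

section \<open>The rank of the module of invariants\<close>

context C_infinity
begin

definition invariants_module :: "'c^2^2 \<Rightarrow> ('c poly, 'c fps^(2 + 2)) module" where
  "invariants_module A =
     \<lparr>carrier = invariants A, monoid.mult = undefined, monoid.one = undefined,
      ring.zero = 0, ring.add = (+), module.smult = (\<lambda>p x. fps_of_poly p *s x)\<rparr>"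

lemma invariants_module_simps [simp]:
  "carrier (invariants_module A) = invariants A" "\<zero>\<^bsub>invariants_module A\<^esub> = 0"
  "x \<oplus>\<^bsub>invariants_module A\<^esub> y = x + y" "p \<odot>\<^bsub>invariants_module A\<^esub> x = fps_of_poly p *s x"
  by (simp_all add: invariants_module_def)

lemma polyring_T_Fq_carrier [simp]: "carrier (polyring_T_Fq q) = polys_over (Fq q)"
  by (simp add: polyring_T_Fq_def)

lemma invariants_module_monoid: "abelian_monoid (invariants_module A)"
  by (rule abelian_monoidI) (auto simp: invariants_0 invariants_add algebra_simps)

lemma invariants_module_finsum:
  assumes "f \<in> S \<rightarrow> invariants A" "finite S"
  shows "(\<Oplus>\<^bsub>invariants_module A\<^esub>b\<in>S. f b) = (\<Sum>b\<in>S. f b)"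
proof -
  interpret abelian_monoid "invariants_module A" by (rule invariants_module_monoid)
  show ?thesis using assms(2,1) by (induction S) auto
qed

lemma invariants_basis_iff:
  "module_basis (polyring_T_Fq q) (invariants_module A) B \<longleftrightarrow>
     finite B \<and> B \<subseteq> invariants A \<and>
     (\<forall>x\<in>invariants A. \<exists>!c. c \<in> B \<rightarrow>\<^sub>E polys_over (Fq q) \<and> x = (\<Sum>b\<in>B. fps_of_poly (c b) *s b))"
proof -
  have "(\<Oplus>\<^bsub>invariants_module A\<^esub>b\<in>B. fps_of_poly (c b) *s b) = (\<Sum>b\<in>B. fps_of_poly (c b) *s b)"
    if "finite B" "B \<subseteq> invariants A" "c \<in> B \<rightarrow>\<^sub>E polys_over (Fq q)" for c
    using that by (intro invariants_module_finsum) (auto intro!: invariants_scale simp: PiE_iff)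
  thus ?thesis unfolding module_basis_def by (auto cong: conj_cong)
qed

text \<open>Under the identification of the tensor product with \<open>tate_vectors\<close>,
  \<open>\<tau>\<close> becomes \<open>sigma\<close>; hence \<open>tensor_class\<close> maps the
  invariant vectors isomorphically onto \<open>H1\<close>.\<close>

lemma H1_rank: "h1 q ord \<theta> A = free_rank (polyring_T_Fq q) (invariants_module A)"
proof -
  interpret tensor_representation polyring_T "motive q \<theta> A" "tate_module ord" "motive_pairing A"
    tate_vectors motive_lift
    by (rule motive_tensor_representation)
  have tau: "motive_tate_tau q ord \<theta> A (tensor_class v) = tensor_class (sigma A v)"
    if "v \<in> tate_vectors" for v
    unfolding motive_tate_tau_def
  proof (rule tensor_map_class[OF that])
    fix z :: "('c poly^2) \<times> 'c fps" assume z: "z \<in> carrier (motive q \<theta> A) \<times> carrier (tate_module ord)"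
    show "(case z of (m, f) \<Rightarrow> (motive_tau q m, frob f)) \<in> carrier (motive q \<theta> A) \<times> carrier (tate_module ord)"
      using z by (auto intro: frob_closed)
    show "motive_pairing A (case z of (m, f) \<Rightarrow> (motive_tau q m, frob f)) = sigma A (motive_pairing A z)"
      by (cases z) (simp add: motive_pairing_def sigma_scale coords_tau)
  next
    fix v w
    have "sigma A (v - w) + sigma A w = sigma A v" by (simp flip: sigma_add)
    thus "sigma A (v - w) = sigma A v - sigma A w" by (simp add: eq_diff_eq)
  qed
  have sub: "invariants A \<subseteq> tate_vectors" by (auto simp: invariants_def tate_vectors_def)
  have carrier: "carrier (H1 q ord \<theta> A) = tensor_class ` invariants A"
  proof -
    have "carrier (H1 q ord \<theta> A) =
        {x \<in> tensor_class ` tate_vectors. motive_tate_tau q ord \<theta> A x = x}"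
      by (simp add: H1_def motive_tate_def tensor_carrier)
    also have "\<dots> = tensor_class ` {v \<in> tate_vectors. sigma A v = v}"
    proof -
      have "motive_tate_tau q ord \<theta> A (tensor_class v) = tensor_class v \<longleftrightarrow> sigma A v = v"
        if "v \<in> tate_vectors" for v
        using tau[OF that] tensor_class_inj[OF that, of "sigma A v"] by metis
      thus ?thesis by auto
    qed
    also have "{v \<in> tate_vectors. sigma A v = v} = invariants A"
      by (auto simp: invariants_def tate_vectors_def)
    finally show ?thesis .
  qed
  show ?thesis unfolding h1_def
  proof (rule free_rank_iso[OF invariants_module_monoid, of tensor_class])
    show "bij_betw tensor_class (carrier (invariants_module A)) (carrier (H1 q ord \<theta> A))"
      using tensor_class_inj sub by (auto simp: bij_betw_def carrier inj_on_def subset_iff)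
    show "tensor_class (x \<oplus>\<^bsub>invariants_module A\<^esub> y) = tensor_class x \<oplus>\<^bsub>H1 q ord \<theta> A\<^esub> tensor_class y"
      if "x \<in> carrier (invariants_module A)" "y \<in> carrier (invariants_module A)" for x y
      using that sub by (simp add: H1_def motive_tate_def tensor_add subset_iff)
    show "tensor_class \<zero>\<^bsub>invariants_module A\<^esub> = \<zero>\<^bsub>H1 q ord \<theta> A\<^esub>"
      by (simp add: H1_def motive_tate_def tensor_zero)
    show "r \<odot>\<^bsub>invariants_module A\<^esub> x \<in> carrier (invariants_module A)"
      if "r \<in> carrier (polyring_T_Fq q)" "x \<in> carrier (invariants_module A)" for r x
      using that by (simp add: invariants_scale)
    show "tensor_class (r \<odot>\<^bsub>invariants_module A\<^esub> x) = r \<odot>\<^bsub>H1 q ord \<theta> A\<^esub> tensor_class x"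
      if "r \<in> carrier (polyring_T_Fq q)" "x \<in> carrier (invariants_module A)" for r x
    proof -
      have "r \<odot>\<^bsub>tensor_product polyring_T (motive q \<theta> A) (tate_module ord)\<^esub> tensor_class x =
          tensor_class (fps_of_poly r *s x)"
        by (rule tensor_smult)
          (use that sub in \<open>auto simp: ring_of_type_algebra_def motive_pairing_def vec_eq_iff algebra_simps\<close>)
      thus ?thesis by (simp add: H1_def motive_tate_def)
    qed
  qed
qed

text \<open>
  Two bases have equally many elements because reduction modulo \<open>T\<close> turns a basis of \<open>n\<close> elements
  into a set of \<open>n\<close>-tuples over \<open>F\<^sub>q\<close>.
\<close>
lemma invariants_basis_card_le:
  assumes B: "module_basis (polyring_T_Fq q) (invariants_module A) B"
    and B': "module_basis (polyring_T_Fq q) (invariants_module A) B'"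
  shows "card B \<le> card B'"
proof -
  let ?S = "Fq q :: 'c set"
  note S = is_subfieldD[OF Fq_is_subfield] polys_over_0[OF Fq_is_subfield]
  have fin: "finite B" "finite B'" and sub: "B \<subseteq> invariants A" "B' \<subseteq> invariants A"
    and ex: "\<And>x. x \<in> invariants A \<Longrightarrow> \<exists>c. c \<in> B \<rightarrow>\<^sub>E polys_over ?S \<and> x = (\<Sum>b\<in>B. fps_of_poly (c b) *s b)"
    and ex': "\<And>x. x \<in> invariants A \<Longrightarrow> \<exists>c. c \<in> B' \<rightarrow>\<^sub>E polys_over ?S \<and> x = (\<Sum>b\<in>B'. fps_of_poly (c b) *s b)"
    using B B' unfolding invariants_basis_iff by blast+
  have comb: "(\<Sum>b\<in>D. fps_of_poly (c b) *s b) \<in> invariants A"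
    if "c \<in> D \<rightarrow> polys_over ?S" "D \<subseteq> invariants A" for c D
    using that by (intro invariants_sum invariants_scale) auto
  have uniq: "c b = d b" if "c \<in> B \<rightarrow> polys_over ?S" "d \<in> B \<rightarrow> polys_over ?S" "b \<in> B"
    "(\<Sum>b\<in>B. fps_of_poly (c b) *s b) = (\<Sum>b\<in>B. fps_of_poly (d b) *s b)" for c d b
  proof -
    have "restrict c B = restrict d B"
    proof -
      have "\<exists>!e. e \<in> B \<rightarrow>\<^sub>E polys_over ?S \<and>
          (\<Sum>b\<in>B. fps_of_poly (c b) *s b) = (\<Sum>b\<in>B. fps_of_poly (e b) *s b)"
        using B comb[OF that(1) sub(1)] unfolding invariants_basis_iff by blast
      moreover have "restrict c B \<in> B \<rightarrow>\<^sub>E polys_over ?S" "restrict d B \<in> B \<rightarrow>\<^sub>E polys_over ?S"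
        using that(1,2) by auto
      moreover have "(\<Sum>b\<in>B. fps_of_poly (c b) *s b) = (\<Sum>b\<in>B. fps_of_poly (restrict c B b) *s b)"
        "(\<Sum>b\<in>B. fps_of_poly (c b) *s b) = (\<Sum>b\<in>B. fps_of_poly (restrict d B b) *s b)"
        unfolding that(4)[symmetric] using that(4) by (auto intro!: sum.cong)
      ultimately show ?thesis by blast
    qed
    thus ?thesis using that(3) by (metis restrict_apply')
  qed
  define x where "x = (\<lambda>c :: 'c fps^(2 + 2) \<Rightarrow> 'c. \<Sum>b\<in>B. fps_of_poly [:c b:] *s b)"
  have x: "x c \<in> invariants A" if "c \<in> B \<rightarrow>\<^sub>E ?S" for c
    unfolding x_def using that S by (intro comb sub) (auto simp: PiE_iff)
  define d where "d c = (SOME d. d \<in> B' \<rightarrow>\<^sub>E polys_over ?S \<and> x c = (\<Sum>b\<in>B'. fps_of_poly (d b) *s b))" for c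
  have "d c \<in> B' \<rightarrow>\<^sub>E polys_over ?S \<and> x c = (\<Sum>b\<in>B'. fps_of_poly (d c b) *s b)"
    if "c \<in> B \<rightarrow>\<^sub>E ?S" for c
    unfolding d_def by (rule someI_ex[OF ex'[OF x[OF that]]])
  hence d: "\<And>c. c \<in> B \<rightarrow>\<^sub>E ?S \<Longrightarrow> d c \<in> B' \<rightarrow>\<^sub>E polys_over ?S"
    "\<And>c. c \<in> B \<rightarrow>\<^sub>E ?S \<Longrightarrow> x c = (\<Sum>b\<in>B'. fps_of_poly (d c b) *s b)" by blast+
  \<comment> \<open>Sends constant coefficients with respect to \<open>B\<close> to the coefficients
    modulo T with respect to \<open>B'\<close>.\<close>
  define f where "f = (\<lambda>c. \<lambda>b\<in>B'. Polynomial.coeff (d c b) 0)"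
  have "inj_on f (B \<rightarrow>\<^sub>E ?S)"
  proof (rule inj_onI)
    fix c1 c2 assume c: "c1 \<in> B \<rightarrow>\<^sub>E ?S" "c2 \<in> B \<rightarrow>\<^sub>E ?S" and "f c1 = f c2"
    hence eq0: "Polynomial.coeff (d c1 b) 0 = Polynomial.coeff (d c2 b) 0" if "b \<in> B'" for b
      using that by (metis f_def restrict_apply')
    \<comment> \<open>Equal images make the difference of the two elements T times an invariant,
      hence T times a combination of \<open>B\<close>. Uniqueness then equates the constants
      \<open>c1 b - c2 b\<close> with multiples of T, so they vanish.\<close>
    have "\<exists>s\<in>polys_over ?S. d c1 b - d c2 b = pCons 0 s" if b: "b \<in> B'" for b
    proof -
      obtain a s where as: "d c1 b - d c2 b = pCons a s" by (rule pCons_cases)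
      moreover have "d c1 b - d c2 b \<in> polys_over ?S"
        using d(1)[OF c(1)] d(1)[OF c(2)] b by (intro polys_over_diff Fq_is_subfield) auto
      moreover have "a = 0" using eq0[OF b] arg_cong[OF as, of "\<lambda>p. Polynomial.coeff p 0"] by simp
      ultimately show ?thesis by auto
    qed
    then obtain s where s: "\<And>b. b \<in> B' \<Longrightarrow> s b \<in> polys_over ?S"
      "\<And>b. b \<in> B' \<Longrightarrow> d c1 b - d c2 b = pCons 0 (s b)" by metis
    define z where "z = (\<Sum>b\<in>B'. fps_of_poly (s b) *s b)"
    have "z \<in> invariants A" unfolding z_def using s(1) by (intro comb sub) auto
    then obtain r where r: "r \<in> B \<rightarrow>\<^sub>E polys_over ?S" "z = (\<Sum>b\<in>B. fps_of_poly (r b) *s b)"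
      using ex by blast
    have X: "fps_of_poly (pCons 0 p) = fps_X * fps_of_poly p" for p :: "'c poly"
      by (simp add: fps_of_poly_pCons)
    have "x c1 - x c2 = (\<Sum>b\<in>B'. fps_of_poly (d c1 b - d c2 b) *s b)"
      by (simp add: d(2)[OF c(1)] d(2)[OF c(2)] fps_of_poly_diff vector_sub_rdistrib sum_subtractf)
    also have "\<dots> = (\<Sum>b\<in>B'. fps_X *s (fps_of_poly (s b) *s b))"
      by (intro sum.cong) (simp_all add: s(2) X)
    also have "\<dots> = fps_X *s z" by (simp add: z_def vec_eq_iff sum_distrib_left mult.assoc)
    also have "\<dots> = (\<Sum>b\<in>B. fps_of_poly (pCons 0 (r b)) *s b)"
      by (simp add: r(2) X vec_eq_iff sum_distrib_left mult.assoc)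
    finally have "x c1 - x c2 = (\<Sum>b\<in>B. fps_of_poly (pCons 0 (r b)) *s b)" .
    moreover have "x c1 - x c2 = (\<Sum>b\<in>B. fps_of_poly [:c1 b - c2 b:] *s b)"
    proof -
      have const_diff: "fps_of_poly [:c1 b - c2 b:] = fps_of_poly [:c1 b:] - fps_of_poly [:c2 b:]" for b
        by (simp flip: fps_of_poly_diff)
      show ?thesis unfolding x_def const_diff by (simp add: vector_sub_rdistrib sum_subtractf)
    qed
    moreover have diff: "c1 b - c2 b \<in> ?S" if "b \<in> B" for b
    proof -
      have "c1 b \<in> ?S" "- c2 b \<in> ?S" using c that S(3) by auto
      from S(5)[OF this] show ?thesis by simp
    qed
    ultimately have "[:c1 b - c2 b:] = pCons 0 (r b)" if "b \<in> B" for b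
      using that r(1) S by (intro uniq[of "\<lambda>b. [:c1 b - c2 b:]" "\<lambda>b. pCons 0 (r b)"]) (auto simp: PiE_iff)
    hence "c1 b = c2 b" if "b \<in> B" for b using that by simp
    thus "c1 = c2" using c by (intro PiE_ext) auto
  qed
  moreover have "f ` (B \<rightarrow>\<^sub>E ?S) \<subseteq> B' \<rightarrow>\<^sub>E ?S"
    using d(1) by (auto simp: f_def PiE_iff polys_over_def)
  ultimately have "card (B \<rightarrow>\<^sub>E ?S) \<le> card (B' \<rightarrow>\<^sub>E ?S)"
    using fin card_Fq(1) by (intro card_inj_on_le finite_PiE)
  hence "card ?S ^ card B \<le> card ?S ^ card B'" using fin by (simp add: card_PiE)
  moreover have "card ?S > 1"
  proof -
    have "card {0, 1 :: 'c} \<le> card ?S" using S card_Fq(1) by (intro card_mono) auto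
    thus ?thesis by simp
  qed
  ultimately show ?thesis by (rule power_le_imp_le_exp[rotated])
qed

lemma h1_eq_4:
  fixes \<Psi>0 :: "'c fps^(2 + 2)^(2 + 2)"
  assumes "\<And>i. \<Psi>0 $ i \<in> invariants A" "det \<Psi>0 \<noteq> 0"
  shows "h1 q ord \<theta> A = 4"
proof -
  obtain \<Psi> :: "'c fps^(2 + 2)^(2 + 2)" where \<Psi>: "\<And>i. \<Psi> $ i \<in> invariants A" "det \<Psi> \<noteq> 0"
    and span: "\<And>x. x \<in> invariants A \<Longrightarrow>
      \<exists>c. (\<forall>i. c i \<in> polys_over (Fq q)) \<and> x = (\<Sum>i\<in>UNIV. fps_of_poly (c i) *s \<Psi> $ i)"
    using invariants_basis[OF assms] by blast
  define e where "e = (\<lambda>i. \<Psi> $ i)"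
  have inj: "inj e"
  proof (rule injI, rule ccontr)
    fix i j assume "e i = e j" "i \<noteq> j"
    hence "det \<Psi> = 0" using det_identical_rows[of i j \<Psi>] by (simp add: e_def row_def)
    thus False using \<Psi>(2) by contradiction
  qed
  have reindex: "(\<Sum>b\<in>range e. fps_of_poly (c b) *s b) = (\<Sum>i\<in>UNIV. fps_of_poly (c (e i)) *s \<Psi> $ i)" for c
    using inj by (simp add: sum.reindex e_def)
  \<comment> \<open>Replacing row i by the zero combination gives determinant 0, and by
    multilinearity also, up to sign, the i-th coefficient times \<open>det \<Psi>\<close>.\<close>
  have indep: "c i = d i" if "(\<Sum>i\<in>UNIV. fps_of_poly (c i) *s \<Psi> $ i) = (\<Sum>i\<in>UNIV. fps_of_poly (d i) *s \<Psi> $ i)"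
    for c d i
  proof -
    have "(\<Sum>i\<in>UNIV. fps_of_poly (c i - d i) *s \<Psi> $ i) = 0"
      using that by (simp add: fps_of_poly_diff vector_sub_rdistrib sum_subtractf)
    hence "fps_of_poly (c i - d i) * det \<Psi> = 0"
      using det_replace_row_diff_sum[of \<Psi> i 0 "\<lambda>i. fps_of_poly (c i - d i)"] by simp
    hence "fps_of_poly (c i - d i) = 0" using \<Psi>(2) by simp
    thus ?thesis by (simp add: fps_of_poly_diff fps_of_poly_eq_iff)
  qed
  have basis: "module_basis (polyring_T_Fq q) (invariants_module A) (range e)"
    unfolding invariants_basis_iff
  proof (intro conjI ballI)
    fix x assume "x \<in> invariants A"
    then obtain c where c: "\<And>i. c i \<in> polys_over (Fq q)" "x = (\<Sum>i\<in>UNIV. fps_of_poly (c i) *s \<Psi> $ i)"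
      using span by blast
    define c' where "c' = restrict (\<lambda>b. c (inv_into UNIV e b)) (range e)"
    have c': "c' (e i) = c i" for i using inj by (simp add: c'_def)
    show "\<exists>!c. c \<in> range e \<rightarrow>\<^sub>E polys_over (Fq q) \<and> x = (\<Sum>b\<in>range e. fps_of_poly (c b) *s b)"
    proof (rule ex1I[of _ c'])
      show "c' \<in> range e \<rightarrow>\<^sub>E polys_over (Fq q) \<and> x = (\<Sum>b\<in>range e. fps_of_poly (c' b) *s b)"
        using c c' unfolding reindex by (auto simp: c'_def)
      fix d assume d: "d \<in> range e \<rightarrow>\<^sub>E polys_over (Fq q) \<and> x = (\<Sum>b\<in>range e. fps_of_poly (d b) *s b)"
      hence "d (e i) = c' (e i)" for i
        unfolding c' using c(2) reindex by (intro indep) simp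
      thus "d = c'" using d by (intro PiE_ext[of d "range e" "\<lambda>_. polys_over (Fq q)" c']) (auto simp: c'_def c)
    qed
  qed (use \<Psi>(1) in \<open>auto simp: e_def\<close>)
  have card: "card (range e) = 4" using inj by (simp add: card_image)
  have "card B = 4" if "module_basis (polyring_T_Fq q) (invariants_module A) B" for B
    using invariants_basis_card_le[OF that basis] invariants_basis_card_le[OF basis that] card by simp
  hence "free_rank (polyring_T_Fq q) (invariants_module A) = 4"
    unfolding free_rank_def using basis card by (intro the_equality) blast+
  thus ?thesis by (simp add: H1_rank)
qed

end

section \<open>Solving the recursion for the coefficients\<close>

text \<open>For p = (X - r) s the derivative at \<open>r\<close> equals s(r), so \<open>r\<close> is
  not a root of \<open>s\<close>: each factor split off contributes a new root.\<close>

lemma card_roots_separable: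
  fixes p :: "'a::field poly"
  assumes root: "\<And>p :: 'a poly. Polynomial.degree p > 0 \<Longrightarrow> \<exists>x. poly p x = 0"
  shows "(\<And>x. poly p x = 0 \<Longrightarrow> poly (pderiv p) x \<noteq> 0) \<Longrightarrow> p \<noteq> 0 \<Longrightarrow>
    card {x. poly p x = 0} = Polynomial.degree p"
proof (induction "Polynomial.degree p" arbitrary: p)
  case 0
  then obtain c where "p = [:c:]" "c \<noteq> 0" by (metis degree_eq_zeroE pCons_0_0)
  thus ?case by simp
next
  case (Suc n)
  then obtain r where r: "poly p r = 0" using root[of p] by auto
  then obtain s where s: "p = [:- r, 1:] * s" by (metis dvdE poly_eq_0_iff_dvd)
  have s0: "s \<noteq> 0" using s Suc.prems(2) by (metis mult_zero_right)
  have deg: "n = Polynomial.degree s"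
    using Suc.hyps(2) s0 unfolding s by (subst (asm) degree_mult_eq) auto
  have d: "poly (pderiv p) x = poly s x + (x - r) * poly (pderiv s) x" for x
    unfolding s pderiv_mult by (simp add: pderiv_pCons algebra_simps)
  have pr: "poly p x = (x - r) * poly s x" for x unfolding s by (simp add: algebra_simps)
  have sr: "poly s r \<noteq> 0" using Suc.prems(1)[OF r] d[of r] by simp
  have "card {x. poly s x = 0} = Polynomial.degree s"
  proof (rule Suc.hyps(1)[OF deg _ s0])
    show "poly (pderiv s) x \<noteq> 0" if "poly s x = 0" for x
      using Suc.prems(1)[of x] that by (auto simp: pr d)
  qed
  moreover have "{x. poly p x = 0} = insert r {x. poly s x = 0}" by (auto simp: pr)
  moreover have "finite {x. poly s x = 0}" using s0 poly_roots_finite by blast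
  ultimately show ?case using sr deg Suc.hyps(2) by simp
qed

lemma real_le_four_power: "2 * real n \<le> 4 ^ n"
proof (induction n)
  case (Suc n)
  have "(1 :: real) \<le> 4 ^ n" by simp
  with Suc have "2 + 2 * real n \<le> 3 * 4 ^ n" by linarith
  also have "\<dots> \<le> 4 * 4 ^ n" by simp
  finally show ?case by simp
qed simp

text \<open>For q = 2 the first inequality of the domain is equivalent to v > -2/3 and appears in
  \<open>v_bounds\<close>; \<open>D13\<close> records the second.\<close>

locale motive_D13 = C_infinity ord 2 \<theta> for ord :: "'c::field \<Rightarrow> ereal" and \<theta> +
  fixes a11 a12 a21 :: 'c and u v :: real
  assumes ord_a11: "ord a11 = -1"
    and ord_a12: "ord a12 = ereal u"
    and ord_a21: "ord a21 = ereal v"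
    and D13: "- 4 - 4 * v < 2 * u"
    and v_bounds: "- 2 / 3 < v" "v \<le> 0"
begin

lemma CHAR_2: "CHAR('c) = 2"
proof -
  obtain k where "2 = CHAR('c) ^ k" "k > 0" using q_prime_power by auto
  hence "CHAR('c) dvd 2" by (metis dvd_power)
  thus ?thesis using prime_char by (simp add: primes_dvd_imp_eq)
qed

lemma two_eq_0: "(2 :: 'c) = 0"
  using of_nat_CHAR[where 'a='c] by (simp add: CHAR_2)

lemma add_self [simp]: "(x :: 'c) + x = 0"
  using two_eq_0 by (metis mult_2 mult_zero_left)

lemma minus_eq [simp]: "- (x :: 'c) = x"
  by (rule minus_unique) simp

lemma add_eq_0_iff_eq: "(x :: 'c) + y = 0 \<longleftrightarrow> x = y"
  by (metis add_self add_left_cancel)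

lemma square_add: "((x :: 'c) + y)\<^sup>2 = x\<^sup>2 + y\<^sup>2"
  by (simp add: power2_sum two_eq_0)

lemma fourth_add: "((x :: 'c) + y) ^ 4 = x ^ 4 + y ^ 4"
proof -
  have "(x + y) ^ 4 = ((x + y)\<^sup>2)\<^sup>2" by (simp flip: power_mult)
  also have "\<dots> = x ^ 4 + y ^ 4" unfolding square_add by (simp flip: power_mult)
  finally show ?thesis .
qed

lemma ords: "ord \<theta> = ereal (-1)" "ord a11 = ereal (-1)"
  using ord_theta ord_a11 by (simp_all add: one_ereal_def)

lemma theta_nonzero: "\<theta> \<noteq> 0" and a21_nonzero: "a21 \<noteq> 0"
  using ord_nonzero[OF ords(1)] ord_nonzero[OF ord_a21] by auto

text \<open>
  The coefficients \<open>(x\<^sub>k, y\<^sub>k)\<close> of the last two coordinates of a \<open>\<tau>\<close>-invariant element satisfy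
  \<open>recursion (x\<^sub>k\<^sub>-\<^sub>1, y\<^sub>k\<^sub>-\<^sub>1) (x\<^sub>k, y\<^sub>k)\<close>.
\<close>
definition recursion :: "'c \<times> 'c \<Rightarrow> 'c \<times> 'c \<Rightarrow> bool" where
  "recursion = (\<lambda>(x', y') (x, y).
     \<theta>\<^sup>2 * x ^ 4 + a11 * x\<^sup>2 + a21 * y\<^sup>2 + x = x' ^ 4 \<and> \<theta>\<^sup>2 * y ^ 4 + a12 * x\<^sup>2 + y = y' ^ 4)"

definition y_squared :: "'c \<Rightarrow> 'c \<Rightarrow> 'c" where
  "y_squared x' x = (x' ^ 4 + x + a11 * x\<^sup>2 + \<theta>\<^sup>2 * x ^ 4) / a21"

text \<open>The first equation of the recursion gives \<open>y\<^sup>2\<close>, which is inserted into the square of the second.\<close>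
definition elimination_poly :: "'c \<Rightarrow> 'c \<Rightarrow> 'c poly" where
  "elimination_poly x' y' =
     [:\<theta> ^ 4 * x' ^ 16 / a21 ^ 4 + x' ^ 4 / a21 + y' ^ 8, 1 / a21, a11 / a21, 0,
       \<theta> ^ 4 / a21 ^ 4 + a12\<^sup>2 + \<theta>\<^sup>2 / a21, 0, 0, 0, \<theta> ^ 4 * a11 ^ 4 / a21 ^ 4,
       0, 0, 0, 0, 0, 0, 0, \<theta> ^ 12 / a21 ^ 4:]"

text \<open>In characteristic two squaring is additive. The squared second equation thus involves
  only y^8 = (y^2)^4 and y^2, both polynomial in x, and apart from the constant only exponents of x
  that are powers of two occur.\<close>

lemma poly_elimination_poly:
  "poly (elimination_poly x' y') x =
     \<theta> ^ 4 * y_squared x' x ^ 4 + a12\<^sup>2 * x ^ 4 + y_squared x' x + y' ^ 8"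
proof -
  have "y_squared x' x ^ 4 = (x' ^ 16 + x ^ 4 + a11 ^ 4 * x ^ 8 + \<theta> ^ 8 * x ^ 16) / a21 ^ 4"
    by (simp add: y_squared_def power_divide fourth_add power_mult_distrib flip: power_mult)
  moreover have "poly (elimination_poly x' y') x =
      \<theta> ^ 4 * ((x' ^ 16 + x ^ 4 + a11 ^ 4 * x ^ 8 + \<theta> ^ 8 * x ^ 16) / a21 ^ 4) + a12\<^sup>2 * x ^ 4 +
      (x' ^ 4 + x + a11 * x\<^sup>2 + \<theta>\<^sup>2 * x ^ 4) / a21 + y' ^ 8"
    by (simp add: elimination_poly_def algebra_simps add_divide_distrib power_numeral_reduce)
  ultimately show ?thesis by (simp only: y_squared_def)
qed

lemma recursion_if_root:
  assumes "poly (elimination_poly x' y') x = 0"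
  shows "\<exists>y. recursion (x', y') (x, y) \<and> y\<^sup>2 = y_squared x' x"
proof -
  obtain y where y: "y\<^sup>2 = y_squared x' x"
    using algebraically_closed[of "[:y_squared x' x, 0, 1:]"]
    by (auto simp: power2_eq_square add_eq_0_iff_eq)
  have "a21 * y\<^sup>2 = x' ^ 4 + x + a11 * x\<^sup>2 + \<theta>\<^sup>2 * x ^ 4"
    using a21_nonzero by (simp add: y y_squared_def)
  moreover have "p + s + (t + z + s + p) + z = t" for p s t z :: 'c
  proof -
    have "p + s + (t + z + s + p) + z = t + (p + p) + (s + s) + (z + z)" by (simp only: ac_simps)
    thus ?thesis by simp
  qed
  ultimately have 1: "\<theta>\<^sup>2 * x ^ 4 + a11 * x\<^sup>2 + a21 * y\<^sup>2 + x = x' ^ 4" by (simp only:)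
  have "y_squared x' x ^ 4 = y ^ 8" unfolding y[symmetric] by (simp flip: power_mult)
  \<comment> \<open>The second equation can be recovered from its square, since a field has no
    nilpotents.\<close>
  hence "(\<theta>\<^sup>2 * y ^ 4 + a12 * x\<^sup>2 + y + y' ^ 4)\<^sup>2 = poly (elimination_poly x' y') x"
    unfolding poly_elimination_poly square_add power_mult_distrib y
    by (simp flip: power_mult)
  hence "(\<theta>\<^sup>2 * y ^ 4 + a12 * x\<^sup>2 + y + y' ^ 4)\<^sup>2 = 0" using assms by simp
  hence "\<theta>\<^sup>2 * y ^ 4 + a12 * x\<^sup>2 + y = y' ^ 4"
    by (simp add: add_eq_0_iff_eq)
  thus ?thesis using 1 y by (intro exI[of _ y]) (simp only: recursion_def split conj_absorb)
qed

lemma card_initial_values: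
  "\<exists>V. finite V \<and> card V = 16 \<and> (\<forall>z\<in>V. recursion (0, 0) z)"
proof -
  let ?p = "elimination_poly 0 0"
  let ?R = "{x. poly ?p x = 0}"
  have deg: "Polynomial.degree ?p = 16"
    using theta_nonzero a21_nonzero by (simp add: elimination_poly_def)
  \<comment> \<open>All exponents other than 0 and 1 are even, so in characteristic two only the
    linear coefficient survives; being \<open>1 / a21\<close>, it excludes multiple roots.\<close>
  have "pderiv [:c0, c1, c2, 0, c4, 0, 0, 0, c8, 0, 0, 0, 0, 0, 0, 0, c16:] = [:c1:]"
    for c0 c1 c2 c4 c8 c16 :: 'c
    by (simp add: pderiv_pCons)
  hence "poly (pderiv ?p) x = 1 / a21" for x
    by (simp add: elimination_poly_def)
  moreover have "?p \<noteq> 0" using deg by auto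
  ultimately have card: "card ?R = 16"
    using card_roots_separable[of ?p] algebraically_closed deg a21_nonzero by simp
  have "\<forall>x\<in>?R. \<exists>y. recursion (0, 0) (x, y)" using recursion_if_root[of 0 0] by blast
  then obtain f where f: "\<forall>x\<in>?R. recursion (0, 0) (x, f x)" by metis
  have "inj_on (\<lambda>x. (x, f x)) ?R" by (rule inj_onI) auto
  hence "card ((\<lambda>x. (x, f x)) ` ?R) = 16" using card by (simp add: card_image)
  moreover have "finite ?R" using card by (metis card.infinite zero_neq_numeral)
  ultimately show ?thesis using f by (intro exI[of _ "(\<lambda>x. (x, f x)) ` ?R"]) auto
qed

text \<open>The constant coefficient has order at least 4w - v and the linear one exactly -v, so the
  elimination polynomial has a root x of order at least 4w. The bound for y follows from y^2 being a
  quotient by \<open>a21\<close> of terms of order at least 4w.\<close>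

lemma recursion_step:
  assumes x': "ereal w \<le> ord x'" and y': "ereal ((w - v) / 2) \<le> ord y'" and w: "w \<ge> 1 / 2"
  shows "\<exists>x y. recursion (x', y') (x, y) \<and> ereal (4 * w) \<le> ord x \<and> ereal ((4 * w - v) / 2) \<le> ord y"
proof -
  have le: "ereal a \<le> c" if "ereal b \<le> c" "a \<le> b" for a b c
    using that by (meson ereal_less_eq(3) order_trans)
  let ?p = "elimination_poly x' y'"
  have "ereal (4 * w - v) \<le> ord (\<theta> ^ 4 * x' ^ 16 / a21 ^ 4)"
  proof (rule le)
    show "ereal (real 4 * (-1) + real 16 * w - real 4 * v) \<le> ord (\<theta> ^ 4 * x' ^ 16 / a21 ^ 4)"
      by (intro ord_ge_divide ord_ge_mult ord_ge_power ord_power_eq x' ord_a21) (simp add: ords)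
    \<comment> \<open>Equivalent to 4 + 3v \<le> 12w; the right side is at least 6 and v \<le>
      0.\<close>
    show "4 * w - v \<le> real 4 * (-1) + real 16 * w - real 4 * v" using w v_bounds by simp
  qed
  moreover have "ereal (4 * w - v) \<le> ord (x' ^ 4 / a21)"
    using ord_ge_divide[OF ord_ge_power[OF x', of 4] ord_a21] by simp
  \<comment> \<open>The available bound is 4w - 4v, which is large enough because v \<le> 0.\<close>
  moreover have "ereal (4 * w - v) \<le> ord (y' ^ 8)"
    by (rule le[OF ord_ge_power[OF y', of 8]]) (use v_bounds in simp)
  ultimately have "ereal (4 * w - v) \<le> ord (Polynomial.coeff ?p 0)"
    by (auto simp: elimination_poly_def intro!: ord_ge_add)
  moreover have "ord (Polynomial.coeff ?p 1) = ereal (- v)"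
    using ord_divide_eq[of 1 0 a21 v] ord_a21 by (simp add: elimination_poly_def zero_ereal_def)
  ultimately obtain x where x: "poly ?p x = 0" "ereal (4 * w) \<le> ord x"
    using small_root_exists[of 1 ?p "- v" "4 * w"] by auto
  obtain y where y: "recursion (x', y') (x, y)" "y\<^sup>2 = y_squared x' x"
    using recursion_if_root[OF x(1)] by blast
  have "ereal (4 * w) \<le> ord (x' ^ 4)" using ord_ge_power[OF x', of 4] by simp
  moreover have "ereal (4 * w) \<le> ord (a11 * x\<^sup>2)"
  proof (rule le)
    show "ereal (- 1 + real 2 * (4 * w)) \<le> ord (a11 * x\<^sup>2)"
      by (intro ord_ge_mult ord_ge_power x(2)) (simp add: ords)
  qed (use w in simp)
  moreover have "ereal (4 * w) \<le> ord (\<theta>\<^sup>2 * x ^ 4)"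
  proof (rule le)
    show "ereal (real 2 * (- 1) + real 4 * (4 * w)) \<le> ord (\<theta>\<^sup>2 * x ^ 4)"
      by (intro ord_ge_mult ord_ge_power x(2)) (simp add: ords)
  qed (use w in simp)
  ultimately have "ereal (4 * w - v) \<le> ord (y\<^sup>2)"
    unfolding y(2) y_squared_def by (intro ord_ge_divide ord_ge_add x(2) ord_a21)
  hence "ereal ((4 * w - v) / 2) \<le> ord y"
    by (cases "ord y") (use ord_power_eq[of y _ 2] ord_not_minf[of y] in auto)
  thus ?thesis using x(2) y(1) by blast
qed

text \<open>A too small order of x makes \<open>\<theta>^2 x^4\<close> dominate the first equation
  and fixes ord y; then \<open>\<theta>^2 y^4\<close> has strictly smaller order than both terms it
  should equal in sum. The bound for y follows from the second equation in the same way.\<close>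

lemma initial_value_bound:
  assumes "recursion (0, 0) (x, y)"
  shows "ereal (1 / 2) \<le> ord x" and "ereal ((1 / 2 - v) / 2) \<le> ord y"
proof -
  have eq1: "a21 * y\<^sup>2 = \<theta>\<^sup>2 * x ^ 4 + (a11 * x\<^sup>2 + x)" and eq2: "\<theta>\<^sup>2 * y ^ 4 = a12 * x\<^sup>2 + y"
  proof -
    have "a21 * y\<^sup>2 + (\<theta>\<^sup>2 * x ^ 4 + (a11 * x\<^sup>2 + x)) = 0" "\<theta>\<^sup>2 * y ^ 4 + (a12 * x\<^sup>2 + y) = 0"
      using assms by (simp_all add: recursion_def ac_simps)
    thus "a21 * y\<^sup>2 = \<theta>\<^sup>2 * x ^ 4 + (a11 * x\<^sup>2 + x)" "\<theta>\<^sup>2 * y ^ 4 = a12 * x\<^sup>2 + y"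
      by (simp_all only: add_eq_0_iff_eq)
  qed
  show x: "ereal (1 / 2) \<le> ord x"
  proof (rule ccontr)
    assume "\<not> ?thesis"
    then obtain r where r: "ord x = ereal r" "r < 1 / 2"
      using ord_not_minf[of x] by (cases "ord x") auto
    have l: "ord (\<theta>\<^sup>2 * x ^ 4) = ereal (real 2 * (- 1) + real 4 * r)"
      by (intro ord_mult_eq ord_power_eq ords r)
    moreover have "ord (a11 * x\<^sup>2) = ereal (- 1 + real 2 * r)"
      by (intro ord_mult_eq ord_power_eq ords r)
    \<comment> \<open>Here -2 + 4r < -1 + 2r holds precisely for r < 1/2; the term \<open>x\<close>
      alone would only require r < 2/3.\<close>
    hence "ereal (real 2 * (- 1) + real 4 * r) < ord (a11 * x\<^sup>2 + x)"
      using r by (intro ord_gr_add) auto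
    ultimately have a: "ord (a21 * y\<^sup>2) = ereal (real 2 * (- 1) + real 4 * r)"
      unfolding eq1 by (subst ord_add_eq) auto
    have "y \<noteq> 0" using a by auto
    then obtain s where s: "ord y = ereal s" by (rule ord_real)
    have "ord (a21 * y\<^sup>2) = ereal (v + real 2 * s)" by (intro ord_mult_eq ord_power_eq ord_a21 s)
    hence s2: "2 * s = 4 * r - 2 - v" using a by simp
    have "ord (\<theta>\<^sup>2 * y ^ 4) = ereal (real 2 * (- 1) + real 4 * s)"
      by (intro ord_mult_eq ord_power_eq ords s)
    moreover have "ord (a12 * x\<^sup>2) = ereal (u + real 2 * r)"
      by (intro ord_mult_eq ord_power_eq ord_a12 r)
    \<comment> \<open>Substituting s, the comparison with \<open>a12 * x^2\<close> becomes 6r - 6 -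
      2v < u, which follows from u > -2 - 2v. The comparison with \<open>y\<close> needs s < 2/3,
      and v > -2/3 yields even s < 1/3.\<close>
    hence "ereal (real 2 * (- 1) + real 4 * s) < ord (a12 * x\<^sup>2 + y)"
      using s s2 r D13 v_bounds by (intro ord_gr_add) auto
    ultimately show False unfolding eq2 by simp
  qed
  show "ereal ((1 / 2 - v) / 2) \<le> ord y"
  proof (rule ccontr)
    assume "\<not> ?thesis"
    then obtain s where s: "ord y = ereal s" "s < (1 / 2 - v) / 2"
      using ord_not_minf[of y] by (cases "ord y") auto
    have "ord (\<theta>\<^sup>2 * y ^ 4) = ereal (real 2 * (- 1) + real 4 * s)"
      by (intro ord_mult_eq ord_power_eq ords s)
    moreover have "ereal (real 2 * (- 1) + real 4 * s) < ord (a12 * x\<^sup>2 + y)"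
    proof (rule ord_gr_add)
      have "ereal (real 2 * (- 1) + real 4 * s) < ereal (u + real 2 * (1 / 2))"
        using s D13 by simp
      also have "\<dots> \<le> ord (a12 * x\<^sup>2)"
        by (intro ord_ge_mult ord_ge_power x) (simp add: ord_a12)
      finally show "ereal (real 2 * (- 1) + real 4 * s) < ord (a12 * x\<^sup>2)" .
      show "ereal (real 2 * (- 1) + real 4 * s) < ord y"
        using s v_bounds by simp
    qed
    ultimately show False unfolding eq2 by simp
  qed
qed

lemma recursion_lift:
  assumes "recursion (0, 0) (x, y)"
  shows "\<exists>g h. g 0 = x \<and> h 0 = y \<and> (\<forall>n. recursion (g n, h n) (g (Suc n), h (Suc n))) \<and>
     (\<lambda>n. ord (g n)) \<longlonglongrightarrow> \<infinity> \<and> (\<lambda>n. ord (h n)) \<longlonglongrightarrow> \<infinity>"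
proof -
  \<comment> \<open>Starts at the bound 1/2 for initial values and is multiplied by four in each
    step.\<close>
  define w :: "nat \<Rightarrow> real" where "w n = 4 ^ n / 2" for n
  define I where "I = (\<lambda>n (x, y). ereal (w n) \<le> ord x \<and> ereal ((w n - v) / 2) \<le> ord y)"
  have "\<exists>f. \<forall>n. (I n (f n) \<and> (n = 0 \<longrightarrow> f n = (x, y))) \<and> recursion (f n) (f (Suc n))"
  proof (rule dependent_nat_choice)
    show "\<exists>z. I 0 z \<and> (0 = 0 \<longrightarrow> z = (x, y))"
      using initial_value_bound[OF assms] by (auto simp: I_def w_def)
    show "\<exists>z'. (I (Suc n) z' \<and> (Suc n = 0 \<longrightarrow> z' = (x, y))) \<and> recursion z z'"
      if "I n z \<and> (n = 0 \<longrightarrow> z = (x, y))" for z n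
      using recursion_step[of "w n" "fst z" "snd z"] that
      by (force simp: I_def w_def split_beta)
  qed
  then obtain f where f: "\<And>n. I n (f n)" "f 0 = (x, y)" "\<And>n. recursion (f n) (f (Suc n))"
    by auto
  have lim: "s \<longlonglongrightarrow> \<infinity>" if s: "\<And>n. ereal (real n / 2) \<le> s n" for s :: "nat \<Rightarrow> ereal"
    unfolding tendsto_PInfty eventually_sequentially
  proof (intro allI exI impI)
    fix r :: real and n assume "n \<ge> nat \<lceil>2 * r\<rceil> + 1"
    hence "ereal r < ereal (real n / 2)" by (simp; linarith)
    thus "ereal r < s n" using s[of n] by (rule order_less_le_trans)
  qed
  have "ereal (real n / 2) \<le> ord (fst (f n))" "ereal (real n / 2) \<le> ord (snd (f n))" for n
  proof -
    have "ereal (real n / 2) \<le> ereal (w n)" "ereal (real n / 2) \<le> ereal ((w n - v) / 2)"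
      using real_le_four_power[of n] v_bounds by (simp_all add: w_def)
    thus "ereal (real n / 2) \<le> ord (fst (f n))" "ereal (real n / 2) \<le> ord (snd (f n))"
      using f(1)[of n] unfolding I_def split_beta by (blast intro: order_trans)+
  qed
  from lim[OF this(1)] lim[OF this(2)] show ?thesis
    using f by (intro exI[of _ "fst \<circ> f"] exI[of _ "snd \<circ> f"]) simp
qed

end

section \<open>From solutions of the recursion to invariant elements\<close>

context motive_D13
begin

definition A_matrix :: "'c^2^2" where
  "A_matrix = vector [vector [a11, a12], vector [a21, 0]]"

text \<open>The coordinates at the \<open>e_j\<close> are forced to be
  \<open>(T - \<theta>) * frob (G j)\<close>. What remains is
  \<open>G_j = (T - \<theta>^2) frob^2 G_j - (\<Sum>i. A_ij frob G_i)\<close>, whose coefficients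
  give the recursion; \<open>A\<close> enters transposed.\<close>

lemma invariant_with_initial_value:
  assumes "recursion (0, 0) (x, y)"
  shows "\<exists>w\<in>invariants A_matrix. fps_nth (w $ Inr 1) 0 = x \<and> fps_nth (w $ Inr 2) 0 = y"
proof -
  obtain g h where gh: "g 0 = x" "h 0 = y" "\<And>n. recursion (g n, h n) (g (Suc n), h (Suc n))"
    "(\<lambda>n. ord (g n)) \<longlonglongrightarrow> \<infinity>" "(\<lambda>n. ord (h n)) \<longlonglongrightarrow> \<infinity>"
    using recursion_lift[OF assms] by auto
  define G where "G = (\<lambda>j :: 2. Abs_fps (if j = 1 then g else h))"
  define w :: "'c fps^(2 + 2)" where
    "w = (\<chi> k. case k of Inl j \<Rightarrow> (fps_X - fps_const \<theta>) * frob (G j) | Inr j \<Rightarrow> G j)"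
  have G: "G j \<in> tate ord" for j using gh(4,5) by (simp add: G_def tate_def)
  hence "w $ k \<in> tate ord" for k
    by (cases k) (auto simp: w_def intro!: tate_mult tate_diff tate_X tate_const frob_closed)
  moreover have "sigma A_matrix w = w"
  proof -
    have p4: "(a\<^sup>2)\<^sup>2 = a ^ 4" for a :: 'c by (simp flip: power_mult)
    have "sigma A_matrix w $ Inl j = w $ Inl j" for j by (simp add: sigma_nth w_def)
    moreover have "sigma A_matrix w $ Inr j = w $ Inr j" for j
    proof (rule fps_ext)
      fix n
      have expand: "sigma A_matrix w $ Inr j = fps_X * frob (frob (G j)) -
          fps_const (\<theta>\<^sup>2) * frob (frob (G j)) - (\<Sum>i\<in>UNIV. fps_const (A_matrix $ i $ j) * frob (G i))"
        by (simp add: sigma_nth w_def frob_mult frob_diff left_diff_distrib)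
      have rec: "recursion (if n = 0 then (0, 0) else (g (n - 1), h (n - 1))) (g n, h n)"
        using gh assms by (cases n) auto
      have alg: "w - p - (s + t) = z" if "p + s + t + z = w" for p s t w z :: 'c
        using that by (metis add.assoc add_diff_cancel_left' diff_diff_eq)
      \<comment> \<open>At n = 0 the preceding coefficients are zero, in accordance with the initial
        pair \<open>(0, 0)\<close>.\<close>
      define g' h' where "g' = (if n = 0 then 0 else g (n - 1))" and "h' = (if n = 0 then 0 else h (n - 1))"
      \<comment> \<open>The summand with factor 0 stands for the lower right entry of
        \<open>A\<close>, so that both equations have the same shape.\<close>
      have rec': "\<theta>\<^sup>2 * g n ^ 4 + a11 * (g n)\<^sup>2 + a21 * (h n)\<^sup>2 + g n = g' ^ 4"
        "\<theta>\<^sup>2 * h n ^ 4 + a12 * (g n)\<^sup>2 + 0 * (h n)\<^sup>2 + h n = h' ^ 4"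
        using rec by (auto simp: recursion_def g'_def h'_def split: if_splits)
      have "fps_nth (sigma A_matrix w $ Inr j) n = (if j = 1 then g' else h') ^ 4 -
          \<theta>\<^sup>2 * (if j = 1 then g n else h n) ^ 4 - (A_matrix $ 1 $ j * (g n)\<^sup>2 + A_matrix $ 2 $ j * (h n)\<^sup>2)"
        unfolding expand by (simp add: tate_tau_def p4 G_def g'_def h'_def sum_2)
      also have "\<dots> = (if j = 1 then g n else h n)"
      proof (cases "j = 1")
        case True
        thus ?thesis using alg[OF rec'(1)] by (simp add: A_matrix_def)
      next
        case False
        hence "j = 2" using exhaust_2 by blast
        thus ?thesis using alg[OF rec'(2)] by (simp add: A_matrix_def)
      qed
      finally show "fps_nth (sigma A_matrix w $ Inr j) n = fps_nth (w $ Inr j) n"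
        by (simp add: w_def G_def)
    qed
    ultimately have "sigma A_matrix w $ k = w $ k" for k by (cases k) auto
    thus ?thesis by (simp add: vec_eq_iff)
  qed
  ultimately have "w \<in> invariants A_matrix" by (simp add: invariants_def)
  moreover have "fps_nth (w $ Inr 1) 0 = x" "fps_nth (w $ Inr 2) 0 = y"
    by (simp_all add: w_def G_def gh)
  ultimately show ?thesis by blast
qed

lemma exists_independent_invariants:
  "\<exists>\<Psi> :: 'c fps^(2 + 2)^(2 + 2). (\<forall>i. \<Psi> $ i \<in> invariants A_matrix) \<and> det \<Psi> \<noteq> 0"
proof -
  obtain V where V: "finite V" "card V = 16" "\<forall>z\<in>V. recursion (0, 0) z"
    using card_initial_values by blast
  have "\<forall>z\<in>V. \<exists>w\<in>invariants A_matrix. fps_nth (w $ Inr 1) 0 = fst z \<and> fps_nth (w $ Inr 2) 0 = snd z"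
    using V(3) invariant_with_initial_value by (metis prod.collapse)
  then obtain f where f: "\<And>z. z \<in> V \<Longrightarrow> f z \<in> invariants A_matrix"
    "\<And>z. z \<in> V \<Longrightarrow> fps_nth (f z $ Inr 1) 0 = fst z \<and> fps_nth (f z $ Inr 2) 0 = snd z" by metis
  have "inj_on (\<lambda>z. constant_terms (f z)) V"
  proof (rule inj_onI)
    fix z z' assume z: "z \<in> V" "z' \<in> V" and "constant_terms (f z) = constant_terms (f z')"
    hence "fps_nth (f z $ k) 0 = fps_nth (f z' $ k) 0" for k
      by (simp add: constant_terms_def vec_eq_iff)
    thus "z = z'" using f(2)[OF z(1)] f(2)[OF z(2)] by (simp add: prod_eq_iff)
  qed
  hence "card ((\<lambda>z. constant_terms (f z)) ` V) = 16" using V(2) by (simp add: card_image)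
  \<comment> \<open>The sixteen constant terms exceed 2^3 = 8.\<close>
  thus ?thesis
    using f(1) V(1) by (intro independent_invariants[of "(\<lambda>z. constant_terms (f z)) ` V"]) auto
qed

end

theorem proposition7p2:
  fixes ord :: "'c::field \<Rightarrow> ereal" and \<theta> a11 a12 a21 :: 'c and u v :: real
  assumes "C_infinity ord 2 \<theta>"
    and "ord a11 = -1"
    and "a12 \<noteq> 0" and "a21 \<noteq> 0"
    and "ord a12 = ereal u" and "ord a21 = ereal v"
    and "(u, v) \<in> D13 2"
    and "-2/3 < v" and "v \<le> 0"
  shows "h1 2 ord \<theta> (vector [vector [a11, a12], vector [a21, 0]]) = 4"
proof -
  interpret C_infinity ord 2 \<theta> by fact
  interpret motive_D13 ord \<theta> a11 a12 a21 u v
    by unfold_locales (use assms in \<open>auto simp: D13_def\<close>)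
  show ?thesis
    using exists_independent_invariants h1_eq_4 by (auto simp: A_matrix_def)
qed

end
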